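(* Let $(X,\mu)$ be a Lebesgue space with $\mu(X)=1$ and let $T$ be a measure-preserving automorphism of $(X,\mu)$. For a semimetric $\rho$ on $X$ put $$\rho_n^{av}(x,y)=\frac1n\sum_{k=0}^{n-1}\rho(T^kx,T^ky),\qquad n\ge 1.$$ Then the following conditions are equivalent: 1) $T$ has a purely discrete spectrum. 2) For every admissible semimetric $\rho\in L^1(X\times X,\mu\times\mu)$ and every $\varepsilon>0$, the sequence of $\varepsilon$-entropies is bounded: $\sup_{n\ge1}\mathbb{H}_\varepsilon(\rho_n^{av},\mu)<\infty$. 3) There exists an admissible metric $\rho\in L^1(X\times X,\mu\times\mu)$ such that for every $\varepsilon>0$ one has $\sup_{n\ge1}\mathbb{H}_\varepsilon(\rho_n^{av},\mu)<\infty$.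
   Context: A Lebesgue space with $\mu(X)=1$ is a standard probability space. An automorphism is a measurable, mod $0$ invertible, $\mu$-preserving transformation. $T$ has purely discrete spectrum if the eigenfunctions of the unitary operator $U_T f=f\circ T$ span a dense subspace of $L^2(X,\mu)$. A semimetric on $X$ is a function $\rho:X\times X\to[0,\infty)$ with $\rho(x,x)=0$, $\rho(x,y)=\rho(y,x)$ and $\rho(x,z)\le\rho(x,y)+\rho(y,z)$; it is a metric if moreover $\rho(x,y)>0$ for $x\ne y$. A (semi)metric $\rho$ is admissible if it is measurable as a function on the Lebesgue space $(X\times X,\mu\times\mu)$ and there is a set $X_1\subset X$ of full measure such that $(X_1,\rho)$ is separable. For $\varepsilon>0$, the $\varepsilon$-entropy $\mathbb{H}_\varepsilon(\rho,\mu)$ is $\log_2 k$, where $k$ is the smallest positive integer for which $X$ is the union of measurable sets $X_0,X_1,\dots,X_k$ with $\mu(X_0)<\varepsilon$ and $\mathrm{diam}_\rho(X_j)<\varepsilon$ for $j=1,\dots,k$; if no such $k$ exists, $\mathbb{H}_\varepsilon(\rho,\mu)=\infty$. *)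

theory Defs
  imports "HOL-Probability.Probability"
begin

definition iso_mod_0 :: "'a measure \<Rightarrow> 'b measure \<Rightarrow> bool" where
  "iso_mod_0 M N \<longleftrightarrow>
     (\<exists>A\<in>null_sets M. \<exists>B\<in>null_sets N. \<exists>\<phi>. bij_betw \<phi> (space M - A) (space N - B) \<and>
        (\<forall>E. E \<subseteq> space M - A \<longrightarrow> (E \<in> sets M \<longleftrightarrow> \<phi> ` E \<in> sets N)) \<and>
        (\<forall>E. E \<subseteq> space M - A \<longrightarrow> E \<in> sets M \<longrightarrow> emeasure N (\<phi> ` E) = emeasure M E))"

text \<open>
  The disjoint union of the interval \<open>[0, c]\<close> with Lebesgue measure and at most countably many
  atoms, realised on the real line: the atom number \<open>n\<close> has mass \<open>p n\<close> and sits at the point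
  \<open>c + n + 1\<close>. A vanishing \<open>c\<close> or \<open>p n\<close> means that the corresponding part is absent.
\<close>

definition interval_with_atoms :: "real \<Rightarrow> (nat \<Rightarrow> real) \<Rightarrow> real measure \<Rightarrow> bool" where
  "interval_with_atoms c p N \<longleftrightarrow>
     0 \<le> c \<and> (\<forall>n. 0 \<le> p n) \<and> sets N = sets borel \<and>
     (\<forall>A\<in>sets borel. emeasure N A =
        emeasure lborel (A \<inter> {0..c}) + (\<Sum>n. ennreal (p n) * indicator A (c + real n + 1)))"

definition lebesgue_prob_space :: "'a measure \<Rightarrow> bool" where
  "lebesgue_prob_space M \<longleftrightarrow> prob_space M \<and> complete_measure M \<and>
     (\<exists>c p N. interval_with_atoms c p N \<and> iso_mod_0 M (completion N))"

definition automorphism :: "'a measure \<Rightarrow> ('a \<Rightarrow> 'a) \<Rightarrow> bool" where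
  "automorphism M T \<longleftrightarrow> T \<in> measurable M M \<and> distr M M T = M \<and>
     (\<exists>S\<in>measurable M M. (AE x in M. S (T x) = x) \<and> (AE x in M. T (S x) = x))"

definition L2_functions :: "'a measure \<Rightarrow> ('a \<Rightarrow> complex) set" where
  "L2_functions M = {f \<in> borel_measurable M. integrable M (\<lambda>x. (cmod (f x))\<^sup>2)}"

definition L2_seminorm :: "'a measure \<Rightarrow> ('a \<Rightarrow> complex) \<Rightarrow> real" where
  "L2_seminorm M f = sqrt (LINT x|M. (cmod (f x))\<^sup>2)"

definition eigenfunctions :: "'a measure \<Rightarrow> ('a \<Rightarrow> 'a) \<Rightarrow> ('a \<Rightarrow> complex) set" where
  "eigenfunctions M T = {f \<in> L2_functions M. \<not> (AE x in M. f x = 0) \<and>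
     (\<exists>c. AE x in M. f (T x) = c * f x)}"

text \<open>Elements of \<open>L\<^sup>2\<close> are represented by functions rather than by classes modulo \<open>0\<close>.\<close>

definition purely_discrete_spectrum :: "'a measure \<Rightarrow> ('a \<Rightarrow> 'a) \<Rightarrow> bool" where
  "purely_discrete_spectrum M T \<longleftrightarrow>
     (\<forall>g\<in>L2_functions M. \<forall>\<epsilon>>0. \<exists>F a. finite F \<and> F \<subseteq> eigenfunctions M T \<and>
        L2_seminorm M (\<lambda>x. g x - (\<Sum>f\<in>F. a f * f x)) < \<epsilon>)"

definition semimetric_on :: "'a set \<Rightarrow> ('a \<Rightarrow> 'a \<Rightarrow> real) \<Rightarrow> bool" where
  "semimetric_on X \<rho> \<longleftrightarrow>
     (\<forall>x\<in>X. \<forall>y\<in>X. 0 \<le> \<rho> x y) \<and> (\<forall>x\<in>X. \<rho> x x = 0) \<and> (\<forall>x\<in>X. \<forall>y\<in>X. \<rho> x y = \<rho> y x) \<and>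
     (\<forall>x\<in>X. \<forall>y\<in>X. \<forall>z\<in>X. \<rho> x z \<le> \<rho> x y + \<rho> y z)"

text \<open>
  \<open>Metric_space\<close> is not used for metrics because it constrains the values of the distance
  outside of the carrier, too, and has no counterpart for semimetrics.
\<close>

definition metric_on :: "'a set \<Rightarrow> ('a \<Rightarrow> 'a \<Rightarrow> real) \<Rightarrow> bool" where
  "metric_on X \<rho> \<longleftrightarrow> semimetric_on X \<rho> \<and> (\<forall>x\<in>X. \<forall>y\<in>X. x \<noteq> y \<longrightarrow> 0 < \<rho> x y)"

definition separable_on :: "'a set \<Rightarrow> ('a \<Rightarrow> 'a \<Rightarrow> real) \<Rightarrow> bool" where
  "separable_on X \<rho> \<longleftrightarrow>
     (\<exists>D. countable D \<and> D \<subseteq> X \<and> (\<forall>x\<in>X. \<forall>\<epsilon>>0. \<exists>d\<in>D. \<rho> x d < \<epsilon>))"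

text \<open>
  The product of two Lebesgue spaces as a Lebesgue space is the completion of
  \<open>M \<Otimes>\<^sub>M M\<close>, which itself is not complete in general.
\<close>

abbreviation square_space :: "'a measure \<Rightarrow> ('a \<times> 'a) measure" where
  "square_space M \<equiv> completion (M \<Otimes>\<^sub>M M)"

definition admissible :: "'a measure \<Rightarrow> ('a \<Rightarrow> 'a \<Rightarrow> real) \<Rightarrow> bool" where
  "admissible M \<rho> \<longleftrightarrow> semimetric_on (space M) \<rho> \<and>
     (\<lambda>(x, y). \<rho> x y) \<in> borel_measurable (square_space M) \<and>
     (\<exists>X\<^sub>1\<in>sets M. emeasure M (space M - X\<^sub>1) = 0 \<and> separable_on X\<^sub>1 \<rho>)"

definition average_semimetric ::
    "('a \<Rightarrow> 'a) \<Rightarrow> ('a \<Rightarrow> 'a \<Rightarrow> real) \<Rightarrow> nat \<Rightarrow> 'a \<Rightarrow> 'a \<Rightarrow> real" where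
  "average_semimetric T \<rho> n x y = (1 / real n) * (\<Sum>k<n. \<rho> ((T ^^ k) x) ((T ^^ k) y))"

definition semimetric_diam :: "('a \<Rightarrow> 'a \<Rightarrow> real) \<Rightarrow> 'a set \<Rightarrow> ennreal" where
  "semimetric_diam \<rho> A = (SUP (x, y)\<in>A \<times> A. ennreal (\<rho> x y))"

definition entropy_cover :: "'a measure \<Rightarrow> ('a \<Rightarrow> 'a \<Rightarrow> real) \<Rightarrow> real \<Rightarrow> nat \<Rightarrow> bool" where
  "entropy_cover M \<rho> \<epsilon> k \<longleftrightarrow>
     (\<exists>A :: nat \<Rightarrow> 'a set. (\<forall>j\<le>k. A j \<in> sets M) \<and> space M = (\<Union>j\<le>k. A j) \<and>
        emeasure M (A 0) < ennreal \<epsilon> \<and> (\<forall>j\<in>{1..k}. semimetric_diam \<rho> (A j) < ennreal \<epsilon>))"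

definition eps_entropy :: "'a measure \<Rightarrow> ('a \<Rightarrow> 'a \<Rightarrow> real) \<Rightarrow> real \<Rightarrow> ereal" where
  "eps_entropy M \<rho> \<epsilon> =
     (if \<exists>k\<ge>1. entropy_cover M \<rho> \<epsilon> k
      then ereal (log 2 (real (LEAST k. 1 \<le> k \<and> entropy_cover M \<rho> \<epsilon> k)))
      else \<infinity>)"

end

theory Submission
  imports Defs
begin

text \<open>
  From 1) to 2): for eigenfunctions \<open>f\<close> the semimetric \<open>\<bar>f x - f y\<bar>\<close> is \<open>T\<close>-invariant. If eigenfunctions
  span, then \<open>\<rho> x y \<le> \<epsilon> + G x + G y + W x y\<close>, where \<open>G\<close> has a small integral and \<open>W\<close> is a combination
  of such semimetrics. One partition into sets of small \<open>W\<close>-diameter then serves all averages; only the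
  exceptional set, where the orbit average of \<open>G\<close> is large, depends on \<open>n\<close>.

  From 3) to 1): bounded entropy makes the orbit of an indicator function \<open>f\<close>, on average over time, close to
  a space of step functions whose dimension does not depend on \<open>n\<close>. Split \<open>f = g + h\<close> with \<open>g\<close> a nearly best
  approximation from the span of the eigenfunctions. The spectral measure of \<open>h\<close> has only small atoms, so by
  Wiener's lemma the orbit of \<open>h\<close> is asymptotically almost orthogonal to all spaces of bounded dimension,
  hence to the orbit of \<open>f\<close>, and \<open>\<parallel>h\<parallel>\<^sup>2\<close> is almost \<open>\<langle>f, h\<rangle>\<close>.
\<close>

section \<open>Positive definite sequences and measures on the circle\<close>

text \<open>The cells of the entropy covers for different \<open>n\<close> are unrelated; only their
  number is bounded. So no single partition can be passed to a limit. The argument must hold for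
  whichever \<open>K\<close> sets occur at time \<open>n\<close>, which is why it uses correlations
  averaged over all pairs of times: they bound weighted orbit sums simultaneously for all weights of
  modulus at most 1. Spectral theory enters one vector at a time. The correlations of
  \<open>h\<close> form a positive definite Toeplitz array, so a measure on the circle represents
  them; up to the factor given by the squared norm of \<open>h\<close>, the mass of an atom
  \<open>w\<close> is the squared norm of the component of \<open>h\<close> in the eigenspace of
  \<open>w\<close>. A metric controls measurable sets only qualitatively. To conclude from a small
  \<open>\<rho> x y\<close> that \<open>x\<close> and \<open>y\<close> lie on the same side of
  \<open>B\<close>, a positive lower bound for \<open>\<rho>\<close> between \<open>B\<close> and
  its complement is wanted, off a small set. This is a Lusin-type statement: it combines positivity
  of the metric with compact inner approximation in the real-line model of the Lebesgue
  space.\<close>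

lemma sum_powers_root_of_unity:
  fixes l :: int and P :: nat
  assumes "l \<noteq> 0" "\<bar>l\<bar> < int P"
  shows "(\<Sum>m<P. iexp (2 * pi * real_of_int l / real P) ^ m) = 0"
proof -
  let ?u = "iexp (2 * pi * real_of_int l / real P)"
  have P: "P > 0" using assms by auto
  have "?u \<noteq> 1"
  proof
    assume "?u = 1"
    then obtain n :: int where "2 * pi * real_of_int l / real P = of_int (2 * n) * pi"
      by (auto simp: exp_eq_1)
    then have "real_of_int l = real_of_int n * real P" using P by (simp add: field_simps)
    then have "l = n * int P" by (metis of_int_eq_iff of_int_mult of_int_of_nat_eq)
    with assms have "\<bar>n\<bar> * int P < 1 * int P" "n \<noteq> 0" by (auto simp: abs_mult)
    then have "\<bar>n\<bar> < 1" using P by (metis mult_less_cancel_right_pos of_nat_0_less_iff)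
    with \<open>n \<noteq> 0\<close> show False by simp
  qed
  moreover have "?u ^ P = 1"
  proof -
    have "?u ^ P = exp (of_nat P * (\<i> * complex_of_real (2 * pi * real_of_int l / real P)))"
      by (simp only: exp_of_nat_mult)
    also have "of_nat P * (\<i> * complex_of_real (2 * pi * real_of_int l / real P))
        = of_int (2 * l) * (of_real pi * \<i>)"
      using P by (simp add: field_simps)
    also have "exp \<dots> = 1" by (auto simp: exp_eq_1)
    finally show ?thesis .
  qed
  ultimately show ?thesis by (simp add: geometric_sum)
qed

lemma toeplitz_shift:
  fixes c :: "nat \<Rightarrow> nat \<Rightarrow> complex"
  assumes "\<And>i j. c (Suc i) (Suc j) = c i j"
  shows "c (i + k) (j + k) = c i j"
  by (induction k) (simp_all add: assms)

text \<open>The approximating measures live on roots of unity of order \<open>2N\<close>; the Fejer weights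
  \<open>1 - a/N\<close> tend to \<open>1\<close>.\<close>

lemma herglotz_approx:
  fixes c :: "nat \<Rightarrow> nat \<Rightarrow> complex"
  assumes toep: "\<And>i j. c (Suc i) (Suc j) = c i j"
    and herm: "\<And>i j. c j i = cnj (c i j)"
    and psd: "\<And>n x. 0 \<le> Re (\<Sum>i<n. \<Sum>j<n. x i * cnj (x j) * c i j)"
    and c0: "c 0 0 = 1" and N: "N > 0"
  shows "\<exists>\<mu>. real_distribution \<mu> \<and> measure \<mu> {-1<..8} = 1 \<and>
    (\<forall>a\<le>N. char \<mu> (real a) = of_real (1 - real a / real N) * c a 0)"
proof -
  \<comment> \<open>The exponents met below are \<open>a + k - j\<close> with
    \<open>a \<le> N\<close> and \<open>j, k < N\<close>, so their absolute value is less than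
    \<open>2 * N\<close>: with this many nodes only the exponent 0 survives the summation.\<close>
  define P where "P = 2 * N"
  define \<theta> where "\<theta> m = 2 * pi * real m / real P" for m :: nat
  \<comment> \<open>The Toeplitz form at the vector \<open>cnj (iexp (\<theta> m) ^ j)\<close>,
    hence nonnegative. Up to normalisation it is the Fejer mean of the Fourier series with
    coefficients \<open>c\<close>, evaluated at the node \<open>\<theta> m\<close>.\<close>
  define S where "S m = (\<Sum>j<N. \<Sum>k<N. cnj (iexp (\<theta> m) ^ j) * cnj (cnj (iexp (\<theta> m) ^ k)) * c j k)" for m
  define w where "w m = (if m < P then Re (S m) / (real P * real N) else 0)" for m
  have P: "P > 0" using N by (simp add: P_def)
  have S_nonneg: "0 \<le> Re (S m)" for m
    unfolding S_def by (rule psd)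
  have "cnj (S m) = S m" for m
  proof -
    have "cnj (S m) = (\<Sum>j<N. \<Sum>k<N. iexp (\<theta> m) ^ j * cnj (iexp (\<theta> m) ^ k) * c k j)"
      unfolding S_def cnj_sum by (intro sum.cong refl) (simp add: herm[symmetric])
    also have "\<dots> = S m"
      unfolding S_def by (subst sum.swap) (intro sum.cong refl, simp)
    finally show ?thesis .
  qed
  then have S_real: "of_real (Re (S m)) = S m" for m
    by (simp add: complex_eq_iff)
  have key: "(\<Sum>m<P. iexp (\<theta> m) ^ a * complex_of_real (w m)) = of_real (1 - real a / real N) * c a 0"
    if a: "a \<le> N" for a
  proof -
    have orth: "(\<Sum>m<P. iexp (\<theta> m) ^ a * cnj (iexp (\<theta> m) ^ j) * iexp (\<theta> m) ^ k) =
        (if j = a + k then of_nat P else 0)" if "j < N" "k < N" for j k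
    proof -
      let ?l = "int a + int k - int j"
      have "iexp (\<theta> m) ^ a * cnj (iexp (\<theta> m) ^ j) * iexp (\<theta> m) ^ k =
          iexp (2 * pi * real_of_int ?l / real P) ^ m" for m
      proof -
        have "iexp (\<theta> m) ^ a * cnj (iexp (\<theta> m) ^ j) * iexp (\<theta> m) ^ k =
          exp (of_nat a * (\<i> * of_real (\<theta> m)) + of_nat j * (- \<i> * of_real (\<theta> m)) + of_nat k * (\<i> * of_real (\<theta> m)))"
          by (simp only: exp_add exp_of_nat_mult complex_cnj_power exp_cnj complex_cnj_mult
              complex_cnj_i complex_cnj_complex_of_real)
        also have "of_nat a * (\<i> * of_real (\<theta> m)) + of_nat j * (- \<i> * of_real (\<theta> m)) + of_nat k * (\<i> * of_real (\<theta> m))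
           = of_nat m * (\<i> * complex_of_real (2 * pi * real_of_int ?l / real P))"
          using P by (simp add: \<theta>_def field_simps)
        finally show ?thesis by (simp only: exp_of_nat_mult)
      qed
      then have eq: "(\<Sum>m<P. iexp (\<theta> m) ^ a * cnj (iexp (\<theta> m) ^ j) * iexp (\<theta> m) ^ k) =
        (\<Sum>m<P. iexp (2 * pi * real_of_int ?l / real P) ^ m)" by simp
      show ?thesis
      proof (cases "j = a + k")
        case True
        then have "?l = 0" by simp
        then show ?thesis unfolding eq using True by simp
      next
        case False
        then have "?l \<noteq> 0" by simp
        moreover have "\<bar>?l\<bar> < int P" using that a by (auto simp: P_def)
        ultimately have "(\<Sum>m<P. iexp (2 * pi * real_of_int ?l / real P) ^ m) = 0"
          by (rule sum_powers_root_of_unity)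
        with False show ?thesis unfolding eq by (simp only: if_False)
      qed
    qed
    have "(\<Sum>m<P. iexp (\<theta> m) ^ a * complex_of_real (w m)) =
       (\<Sum>m<P. (\<Sum>j<N. \<Sum>k<N. iexp (\<theta> m) ^ a * cnj (iexp (\<theta> m) ^ j) * iexp (\<theta> m) ^ k * c j k)) / (of_nat P * of_nat N)"
    proof (simp only: sum_divide_distrib[of _ "{..<P}"], intro sum.cong refl)
      fix m assume "m \<in> {..<P}"
      then have "complex_of_real (w m) = S m / (of_nat P * of_nat N)"
        unfolding w_def by (simp add: S_real)
      then show "iexp (\<theta> m) ^ a * complex_of_real (w m) = (\<Sum>j<N. \<Sum>k<N. iexp (\<theta> m) ^ a * cnj (iexp (\<theta> m) ^ j) * iexp (\<theta> m) ^ k * c j k) / (of_nat P * of_nat N)"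
        by (simp add: S_def sum_distrib_left mult.assoc)
    qed
    also have "(\<Sum>m<P. (\<Sum>j<N. \<Sum>k<N. iexp (\<theta> m) ^ a * cnj (iexp (\<theta> m) ^ j) * iexp (\<theta> m) ^ k * c j k))
       = (\<Sum>j<N. \<Sum>k<N. (\<Sum>m<P. iexp (\<theta> m) ^ a * cnj (iexp (\<theta> m) ^ j) * iexp (\<theta> m) ^ k) * c j k)"
    proof -
      have "(\<Sum>m<P. (\<Sum>j<N. \<Sum>k<N. iexp (\<theta> m) ^ a * cnj (iexp (\<theta> m) ^ j) * iexp (\<theta> m) ^ k * c j k)) = (\<Sum>j<N. \<Sum>m<P. \<Sum>k<N. iexp (\<theta> m) ^ a * cnj (iexp (\<theta> m) ^ j) * iexp (\<theta> m) ^ k * c j k)"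
        by (rule sum.swap)
      also have "\<dots> = (\<Sum>j<N. \<Sum>k<N. \<Sum>m<P. iexp (\<theta> m) ^ a * cnj (iexp (\<theta> m) ^ j) * iexp (\<theta> m) ^ k * c j k)"
        by (intro sum.cong refl sum.swap)
      finally show ?thesis by (simp only: sum_distrib_right)
    qed
    also have "\<dots> = (\<Sum>j<N. \<Sum>k<N. if j = a + k then of_nat P * c a 0 else 0)"
    proof (intro sum.cong refl)
      fix j k assume "j \<in> {..<N}" "k \<in> {..<N}"
      then show "(\<Sum>m<P. iexp (\<theta> m) ^ a * cnj (iexp (\<theta> m) ^ j) * iexp (\<theta> m) ^ k) * c j k =
        (if j = a + k then of_nat P * c a 0 else 0)"
        using orth[of j k] toeplitz_shift[of c a k 0] toep by simp
    qed
    also have "\<dots> = (\<Sum>k<N. \<Sum>j<N. if j = a + k then of_nat P * c a 0 else 0)"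
      by (rule sum.swap)
    \<comment> \<open>Of the pairs with \<open>j = a + k\<close>, exactly \<open>N - a\<close> fit
      below \<open>N\<close>, and each contributes \<open>c a 0\<close> by the Toeplitz property.
      This count is the source of the Fejer weight.\<close>
    also have "\<dots> = (\<Sum>k<N. if k < N - a then of_nat P * c a 0 else 0)"
      by (intro sum.cong refl) (auto simp: sum.delta)
    also have "\<dots> = (\<Sum>k\<in>{..<N} \<inter> {k. k < N - a}. of_nat P * c a 0)"
      by (subst sum.inter_restrict) simp_all
    also have "{..<N} \<inter> {k. k < N - a} = {..<N - a}" by auto
    also have "(\<Sum>k\<in>{..<N - a}. of_nat P * c a 0) / (of_nat P * of_nat N) = of_real (1 - real a / real N) * c a 0"
      using a N P by (simp add: field_simps of_nat_diff)
    finally show ?thesis .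
  qed
  have w_nonneg: "0 \<le> w m" for m using S_nonneg by (simp add: w_def)
  have "complex_of_real (\<Sum>m<P. w m) = 1" using key[of 0] c0 by simp
  then have w_sum: "(\<Sum>m<P. w m) = 1" using of_real_eq_1_iff by blast
  have w_nn: "(\<integral>\<^sup>+m. ennreal (w m) \<partial>count_space UNIV) = 1"
  proof -
    have "(\<integral>\<^sup>+m. ennreal (w m) \<partial>count_space UNIV) = (\<Sum>m<P. ennreal (w m))"
      by (rule nn_integral_count_space') (auto simp: w_def)
    then show ?thesis using w_sum w_nonneg by simp
  qed
  define p where "p = embed_pmf w"
  have pmf_p: "pmf p m = w m" for m
    unfolding p_def using w_nonneg w_nn by (rule pmf_embed_pmf)
  define \<mu> where "\<mu> = distr (measure_pmf p) borel \<theta>"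
  have "prob_space \<mu>" unfolding \<mu>_def by (rule prob_space.prob_space_distr) (auto simp: measure_pmf.prob_space_axioms)
  then have rd: "real_distribution \<mu>"
    unfolding real_distribution_def real_distribution_axioms_def by (simp add: \<mu>_def)
  interpret \<mu>: real_distribution \<mu> by fact
  \<comment> \<open>The nodes lie in the interval from 0 to \<open>2 * pi\<close>, and
    \<open>2 * pi < 8\<close>. One bounded window for all \<open>N\<close> is what tightness
    requires.\<close>
  have "measure \<mu> {-1<..8} = 1"
  proof (rule \<mu>.prob_eq_1[THEN iffD2], simp)
    have "AE m in measure_pmf p. m < P"
      by (auto simp: AE_measure_pmf_iff set_pmf_iff pmf_p w_def split: if_splits)
    then have "AE m in measure_pmf p. \<theta> m \<in> {-1<..8}"
    proof eventually_elim
      case (elim m)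
      then have "real m / real P \<le> 1" by simp
      then have "2 * pi * (real m / real P) \<le> 2 * pi * 1" by (intro mult_left_mono) auto
      then have "\<theta> m \<le> 2 * pi" by (simp add: \<theta>_def)
      moreover have "pi < 4" by (rule pi_less_4)
      moreover have "0 \<le> \<theta> m" by (simp add: \<theta>_def)
      ultimately show ?case by auto
    qed
    then show "AE x in \<mu>. x \<in> {-1<..8}"
      unfolding \<mu>_def by (subst AE_distr_iff) auto
  qed
  moreover have "char \<mu> (real a) = of_real (1 - real a / real N) * c a 0" if "a \<le> N" for a
  proof -
    have "char \<mu> (real a) = (LINT m|measure_pmf p. iexp (real a * \<theta> m))"
      unfolding char_def \<mu>_def by (rule integral_distr) auto
    also have "\<dots> = (\<Sum>m<P. pmf p m *\<^sub>R iexp (real a * \<theta> m))"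
      by (rule integral_measure_pmf) (auto simp: set_pmf_iff pmf_p w_def split: if_splits)
    also have "\<dots> = (\<Sum>m<P. iexp (\<theta> m) ^ a * complex_of_real (w m))"
    proof (intro sum.cong refl)
      fix m
      have "iexp (real a * \<theta> m) = exp (of_nat a * (\<i> * of_real (\<theta> m)))" by (simp add: mult_ac)
      then show "pmf p m *\<^sub>R iexp (real a * \<theta> m) = iexp (\<theta> m) ^ a * complex_of_real (w m)"
        by (simp add: exp_of_nat_mult pmf_p scaleR_conv_of_real)
    qed
    finally show ?thesis using key[OF that] by simp
  qed
  ultimately show ?thesis using rd by blast
qed

text \<open>The approximating measures share a bounded window, so they are tight and a subsequence
  converges weakly. Characteristic functions converge along it, and the Fejer weights tend to 1, so
  the limit has \<open>c a 0\<close> as its characteristic function at \<open>a\<close>. Its image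
  under \<open>iexp\<close> is the measure on the circle. Two indices instead of one integer
  difference match the correlations of an orbit and avoid negative exponents.\<close>

lemma herglotz:
  fixes c :: "nat \<Rightarrow> nat \<Rightarrow> complex"
  assumes toep: "\<And>i j. c (Suc i) (Suc j) = c i j"
    and herm: "\<And>i j. c j i = cnj (c i j)"
    and psd: "\<And>n x. 0 \<le> Re (\<Sum>i<n. \<Sum>j<n. x i * cnj (x j) * c i j)"
    and c0: "c 0 0 = 1"
  obtains \<tau> :: "complex measure" where "prob_space \<tau>" "sets \<tau> = sets borel"
    "AE z in \<tau>. cmod z = 1" "\<And>i j. c i j = (LINT z|\<tau>. z ^ i * cnj z ^ j)"
proof -
  have "\<forall>N. \<exists>\<mu>. real_distribution \<mu> \<and> measure \<mu> {-1<..8} = 1 \<and>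
    (\<forall>a\<le>Suc N. char \<mu> (real a) = of_real (1 - real a / real (Suc N)) * c a 0)"
    using herglotz_approx[OF assms] by blast
  then obtain \<mu> where rd: "\<And>N. real_distribution (\<mu> N)" and supp: "\<And>N. measure (\<mu> N) {-1<..8} = 1"
    and char: "\<And>N a. a \<le> Suc N \<Longrightarrow> char (\<mu> N) (real a) = of_real (1 - real a / real (Suc N)) * c a 0"
    by metis
  have "tight \<mu>"
    unfolding tight_def
  proof (intro conjI allI impI)
    fix \<epsilon> :: real assume "\<epsilon> > 0"
    then have "(-1 :: real) < 8 \<and> (\<forall>N. measure (\<mu> N) {-1<..8} > 1 - \<epsilon>)" by (simp add: supp)
    then show "\<exists>a b. a < b \<and> (\<forall>N. measure (\<mu> N) {a<..b} > 1 - \<epsilon>)" by blast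
  qed (rule rd)
  then obtain r \<nu> where r: "strict_mono (r :: nat \<Rightarrow> nat)" and \<nu>: "real_distribution \<nu>"
    and wc: "weak_conv_m (\<mu> \<circ> r) \<nu>"
    using tight_imp_convergent_subsubsequence[of \<mu> id] by (auto simp: strict_mono_def)
  interpret \<nu>: real_distribution \<nu> by fact
  have char_\<nu>: "char \<nu> (real a) = c a 0" for a
  proof -
    have "(\<lambda>n. char ((\<mu> \<circ> r) n) (real a)) \<longlonglongrightarrow> char \<nu> (real a)"
      by (rule levy_continuity1[OF _ \<nu> wc]) (simp add: rd)
    moreover have "(\<lambda>n. char ((\<mu> \<circ> r) n) (real a)) \<longlonglongrightarrow> c a 0"
    proof -
      have "(\<lambda>N. 1 - real a / real (Suc N)) \<longlonglongrightarrow> 1 - 0"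
        by (intro tendsto_intros LIMSEQ_Suc[OF lim_const_over_n])
      then have "(\<lambda>N. complex_of_real (1 - real a / real (Suc N)) * c a 0) \<longlonglongrightarrow> of_real (1 - 0) * c a 0"
        by (rule tendsto_mult[OF tendsto_of_real tendsto_const])
      then have "(\<lambda>N. complex_of_real (1 - real a / real (Suc N)) * c a 0) \<longlonglongrightarrow> c a 0" by simp
      moreover have "eventually (\<lambda>N. of_real (1 - real a / real (Suc N)) * c a 0 = char (\<mu> N) (real a)) sequentially"
        using eventually_ge_at_top[of a] by eventually_elim (simp only: char)
      ultimately have "(\<lambda>N. char (\<mu> N) (real a)) \<longlonglongrightarrow> c a 0"
        by (rule Lim_transform_eventually)
      then show ?thesis using LIMSEQ_subseq_LIMSEQ[OF _ r] by (simp add: o_def)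
    qed
    ultimately show ?thesis by (rule LIMSEQ_unique)
  qed
  define \<tau> where "\<tau> = distr \<nu> borel iexp"
  have iexp_meas: "iexp \<in> borel_measurable \<nu>" by measurable
  have "prob_space \<tau>" unfolding \<tau>_def by (rule \<nu>.prob_space_distr) (rule iexp_meas)
  moreover have "sets \<tau> = sets borel" by (simp add: \<tau>_def)
  moreover have "AE z in \<tau>. cmod z = 1"
    unfolding \<tau>_def by (subst AE_distr_iff[OF iexp_meas]) (auto simp: norm_exp_i_times)
  moreover have "c i j = (LINT z|\<tau>. z ^ i * cnj z ^ j)" for i j
  proof -
    have I: "(LINT z|\<tau>. z ^ i * cnj z ^ j) = (LINT x|\<nu>. iexp x ^ i * cnj (iexp x) ^ j)" for i j
      unfolding \<tau>_def by (rule integral_distr[OF iexp_meas]) (intro borel_measurable_continuous_onI continuous_intros)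
    \<comment> \<open>The characteristic function is known at natural numbers only. For
      \<open>j \<le> i\<close> the integrand reduces to the power \<open>i - j\<close> because
      \<open>z * cnj z = 1\<close> on the circle; the other case follows by conjugation.\<close>
    have ge: "c i j = (LINT z|\<tau>. z ^ i * cnj z ^ j)" if "j \<le> i" for i j
    proof -
      have "iexp x ^ i * cnj (iexp x) ^ j = iexp (real (i - j) * x)" for x
      proof -
        have "iexp x ^ i * cnj (iexp x) ^ j = iexp x ^ (i - j) * (iexp x * cnj (iexp x)) ^ j"
          using that by (simp add: power_mult_distrib mult.assoc[symmetric] power_add[symmetric])
        also have "iexp x * cnj (iexp x) = 1"
          by (simp only: complex_norm_square[symmetric] norm_exp_i_times power_one of_real_1)
        also have "iexp x ^ (i - j) = exp (of_nat (i - j) * (\<i> * of_real x))"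
          by (simp only: exp_of_nat_mult)
        also have "of_nat (i - j) * (\<i> * of_real x) = \<i> * of_real (real (i - j) * x)" by simp
        finally show ?thesis by simp
      qed
      then have "(LINT z|\<tau>. z ^ i * cnj z ^ j) = char \<nu> (real (i - j))"
        unfolding I char_def by simp
      also have "\<dots> = c (0 + (i - j)) 0" by (simp add: char_\<nu>)
      also have "\<dots> = c i j"
        using toeplitz_shift[of c "i - j" j 0] toep that by simp
      finally show ?thesis by simp
    qed
    show ?thesis
    proof (cases "j \<le> i")
      case True then show ?thesis by (rule ge)
    next
      case False
      then have "c j i = (LINT z|\<tau>. z ^ j * cnj z ^ i)" by (intro ge) simp
      then have "c i j = cnj (LINT z|\<tau>. z ^ j * cnj z ^ i)" using herm by metis
      also have "\<dots> = (LINT z|\<tau>. cnj (z ^ j * cnj z ^ i))" by (rule Bochner_Integration.integral_cnj[symmetric])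
      finally show ?thesis by (simp add: mult.commute)
    qed
  qed
  ultimately show ?thesis by (rule that)
qed

section \<open>Cesaro means of powers and Wiener's lemma on atoms\<close>

definition power_mean :: "nat \<Rightarrow> complex \<Rightarrow> complex" where
  "power_mean n u = (\<Sum>i<n. u ^ i) / of_nat n"

lemma cmod_power_mean_le:
  assumes "cmod u \<le> 1"
  shows "cmod (power_mean n u) \<le> 1"
proof -
  have "cmod (\<Sum>i<n. u ^ i) \<le> (\<Sum>i<n. 1)"
    by (rule sum_norm_le) (simp add: norm_power power_le_one assms)
  then show ?thesis by (auto simp: power_mean_def norm_divide divide_le_eq)
qed

lemma power_mean_tendsto:
  assumes "cmod u = 1"
  shows "(\<lambda>n. power_mean n u) \<longlonglongrightarrow> (if u = 1 then 1 else 0)"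
proof (cases "u = 1")
  case True
  have "eventually (\<lambda>n. 1 = power_mean n u) sequentially"
    using eventually_gt_at_top[of 0] by eventually_elim (simp add: power_mean_def True)
  from Lim_transform_eventually[OF tendsto_const this] show ?thesis using True by simp
next
  case False
  have "(\<lambda>n. 2 / cmod (u - 1) / real n) \<longlonglongrightarrow> 0" by (rule lim_const_over_n)
  then have "(\<lambda>n. power_mean n u) \<longlonglongrightarrow> 0"
  proof (rule Lim_null_comparison[rotated], intro always_eventually allI)
    fix n
    have "cmod (u ^ n - 1) \<le> cmod (u ^ n) + cmod 1" by (rule norm_triangle_ineq4)
    then have "cmod (u ^ n - 1) \<le> 2" using assms by (simp add: norm_power)
    then show "cmod (power_mean n u) \<le> 2 / cmod (u - 1) / real n"
      using False by (simp add: power_mean_def geometric_sum norm_divide norm_mult divide_right_mono)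
  qed
  then show ?thesis using False by simp
qed

lemma borel_measurable_power_mean [measurable]: "power_mean n \<in> borel_measurable borel"
  unfolding power_mean_def[abs_def] divide_inverse
  by (intro borel_measurable_continuous_onI continuous_intros)

lemma borel_measurable_cnj [measurable (raw)]:
  "f \<in> borel_measurable M \<Longrightarrow> (\<lambda>x. cnj (f x)) \<in> borel_measurable M"
  by (rule measurable_compose[where g = cnj])
    (auto intro!: borel_measurable_continuous_onI continuous_intros)

text \<open>A measure on the plane carried by the circle, not a measure on a circle type: the
  integrands are then polynomials in \<open>z\<close> and \<open>cnj z\<close>, and
  \<open>cnj z\<close> serves as the inverse of \<open>z\<close> almost everywhere.\<close>

locale circle_measure = prob_space \<tau> for \<tau> :: "complex measure" +
  assumes sets_borel [measurable_cong]: "sets \<tau> = sets borel"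
    and on_circle: "AE z in \<tau>. cmod z = 1"
begin

lemma space_UNIV [simp]: "space \<tau> = UNIV"
  using sets_eq_imp_space_eq[OF sets_borel] by simp

lemma prob_UNIV [simp]: "prob UNIV = 1"
  using prob_space by simp

text \<open>Multiplication by \<open>cnj w\<close> rotates \<open>w\<close> to 1, the only point of
  the circle at which the means do not tend to 0.\<close>

lemma power_mean_tendsto_AE:
  assumes "cmod w = 1"
  shows "AE z in \<tau>. (\<lambda>n. power_mean n (cnj w * z)) \<longlonglongrightarrow> indicator {w} z"
    and "AE z in \<tau>. cmod (power_mean n (cnj w * z)) \<le> 1"
proof -
  have *: "cnj w * z = 1 \<longleftrightarrow> z = w" for z
  proof -
    have "w * cnj w = 1" using assms by (simp only: complex_norm_square[symmetric]) simp
    then show ?thesis by (metis mult.commute mult.left_commute mult_1_right)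
  qed
  show "AE z in \<tau>. (\<lambda>n. power_mean n (cnj w * z)) \<longlonglongrightarrow> indicator {w} z"
    using on_circle
  proof eventually_elim
    case (elim z)
    then show ?case using power_mean_tendsto[of "cnj w * z"] assms
      by (auto simp: norm_mult * indicator_def split: if_splits)
  qed
  show "AE z in \<tau>. cmod (power_mean n (cnj w * z)) \<le> 1"
    using on_circle
    by eventually_elim (rule cmod_power_mean_le, simp add: norm_mult assms)
qed

lemma power_mean_indicator_bound:
  assumes w: "cmod w = 1"
  shows "AE z in \<tau>. norm ((cmod (power_mean n (cnj w * z) - indicator {w} z))\<^sup>2) \<le> 4"
  using power_mean_tendsto_AE(2)[OF w, of n]
proof eventually_elim
  case (elim z)
  have "cmod (power_mean n (cnj w * z) - indicator {w} z) \<le> 1 + 1"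
    by (rule order_trans[OF norm_triangle_ineq4 add_mono[OF elim]]) (simp add: indicator_def)
  from power_mono[OF this, of 2] show ?case by simp
qed

text \<open>Dominated convergence. Convergence in the square mean is the form that carries over to
  the averages of an orbit, where it yields the Cauchy property.\<close>

lemma power_mean_indicator:
  assumes w: "cmod w = 1"
  shows "(\<lambda>n. LINT z|\<tau>. (cmod (power_mean n (cnj w * z) - indicator {w} z))\<^sup>2) \<longlonglongrightarrow> 0"
proof -
  have "(\<lambda>n. LINT z|\<tau>. (cmod (power_mean n (cnj w * z) - indicator {w} z))\<^sup>2) \<longlonglongrightarrow> (LINT z|\<tau>. 0)"
  proof (rule integral_dominated_convergence[where w = "\<lambda>_. 4"])
    show "AE z in \<tau>. (\<lambda>n. (cmod (power_mean n (cnj w * z) - indicator {w} z))\<^sup>2) \<longlonglongrightarrow> 0"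
      using power_mean_tendsto_AE(1)[OF w]
    proof eventually_elim
      case (elim z)
      then have "(\<lambda>n. (cmod (power_mean n (cnj w * z) - indicator {w} z))\<^sup>2)
        \<longlonglongrightarrow> (cmod (indicator {w} z - indicator {w} z))\<^sup>2"
        by (intro tendsto_intros)
      then show ?case by simp
    qed
    show "AE z in \<tau>. norm ((cmod (power_mean n (cnj w * z) - indicator {w} z))\<^sup>2) \<le> 4" for n
      by (rule power_mean_indicator_bound[OF w])
  qed auto
  then show ?thesis by simp
qed

lemma power_mean_square:
  assumes w: "cmod w = 1"
  shows "(\<lambda>n. LINT z|\<tau>. (cmod (power_mean n (cnj w * z)))\<^sup>2) \<longlonglongrightarrow> prob {w}"
proof -
  have "(\<lambda>n. LINT z|\<tau>. (cmod (power_mean n (cnj w * z)))\<^sup>2) \<longlonglongrightarrow> (LINT z|\<tau>. indicator {w} z)"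
  proof (rule integral_dominated_convergence[where w = "\<lambda>_. 1"])
    show "AE z in \<tau>. (\<lambda>n. (cmod (power_mean n (cnj w * z)))\<^sup>2) \<longlonglongrightarrow> indicator {w} z"
      using power_mean_tendsto_AE(1)[OF w]
    proof eventually_elim
      case (elim z)
      then have "(\<lambda>n. (cmod (power_mean n (cnj w * z)))\<^sup>2) \<longlonglongrightarrow> (cmod (indicator {w} z))\<^sup>2"
        by (intro tendsto_intros)
      moreover have "(cmod (indicator {w} z))\<^sup>2 = indicator {w} z" by (cases "z = w") auto
      ultimately show ?case by (simp only:)
    qed
    show "AE z in \<tau>. norm ((cmod (power_mean n (cnj w * z)))\<^sup>2) \<le> 1" for n
      using power_mean_tendsto_AE(2)[OF w, of n] by eventually_elim (simp add: power_le_one)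
  qed auto
  then show ?thesis by simp
qed

lemma power_mean_integral:
  assumes w: "cmod w = 1"
  shows "(\<lambda>n. LINT z|\<tau>. power_mean n (cnj w * z)) \<longlonglongrightarrow> of_real (prob {w})"
proof -
  have "(\<lambda>n. LINT z|\<tau>. power_mean n (cnj w * z)) \<longlonglongrightarrow> (LINT z|\<tau>. indicator {w} z)"
  proof (rule integral_dominated_convergence[where w = "\<lambda>_. 1"])
    show "AE z in \<tau>. (\<lambda>n. power_mean n (cnj w * z)) \<longlonglongrightarrow> indicator {w} z"
      by (rule power_mean_tendsto_AE(1)[OF w])
    show "AE z in \<tau>. norm (power_mean n (cnj w * z)) \<le> 1" for n
      by (rule power_mean_tendsto_AE(2)[OF w])
  qed auto
  also have "(LINT z|\<tau>. indicator {w} z) = complex_of_real (prob {w})"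
  proof -
    have "(LINT z|\<tau>. indicator {w} z) = (LINT z|\<tau>. complex_of_real (indicator {w} z))"
      by (intro Bochner_Integration.integral_cong refl) (simp add: indicator_def)
    also have "\<dots> = of_real (LINT z|\<tau>. indicator {w} z)" by (rule integral_complex_of_real)
    finally show ?thesis by simp
  qed
  finally show ?thesis .
qed

lemma integrable_trig: "integrable \<tau> (\<lambda>z. z ^ i * cnj z ^ j)"
  using on_circle by (intro integrable_const_bound[of _ 1]) (auto simp: norm_mult norm_power)

text \<open>The mean of \<open>(cmod (c i j))\<^sup>2\<close> is the double integral of
  \<open>(cmod (power_mean n (cnj w * z)))\<^sup>2\<close> over \<open>z\<close> and
  \<open>w\<close>. The inner integral tends to the mass of \<open>w\<close>, so the limit is the
  integral of the atom masses, which is at most \<open>s\<close>. The inner integral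
  \<open>F n w\<close> is a finite trigonometric sum in \<open>w\<close>, so it can be integrated
  term by term.\<close>

lemma wiener:
  fixes c :: "nat \<Rightarrow> nat \<Rightarrow> complex"
  assumes c: "\<And>i j. c i j = (LINT z|\<tau>. z ^ i * cnj z ^ j)"
    and atoms: "\<And>w. cmod w = 1 \<Longrightarrow> prob {w} \<le> s" and e: "e > 0"
  shows "eventually (\<lambda>n. (\<Sum>i<n. \<Sum>j<n. (cmod (c i j))\<^sup>2) / (real n)\<^sup>2 < s + e) sequentially"
proof -
  define F where "F n w = (LINT z|\<tau>. (cmod (power_mean n (cnj w * z)))\<^sup>2)" for n w
  have F_eq: "complex_of_real (F n w) = (\<Sum>i<n. \<Sum>j<n. cnj w ^ i * w ^ j * c i j) / (of_nat n)\<^sup>2" for n w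
  proof -
    have "complex_of_real (F n w) = (LINT z|\<tau>. complex_of_real ((cmod (power_mean n (cnj w * z)))\<^sup>2))"
      unfolding F_def by (rule integral_complex_of_real[symmetric])
    also have "\<dots> = (LINT z|\<tau>. (\<Sum>i<n. \<Sum>j<n. cnj w ^ i * w ^ j / (of_nat n)\<^sup>2 * (z ^ i * cnj z ^ j)))"
    proof (intro Bochner_Integration.integral_cong refl)
      fix z
      have "complex_of_real ((cmod (power_mean n (cnj w * z)))\<^sup>2) = power_mean n (cnj w * z) * cnj (power_mean n (cnj w * z))"
        by (rule complex_norm_square)
      also have "\<dots> = ((\<Sum>i<n. (cnj w * z) ^ i) * (\<Sum>j<n. (w * cnj z) ^ j)) / (of_nat n)\<^sup>2"
        by (simp add: power_mean_def power2_eq_square)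
      also have "\<dots> = (\<Sum>i<n. \<Sum>j<n. cnj w ^ i * w ^ j / (of_nat n)\<^sup>2 * (z ^ i * cnj z ^ j))"
        unfolding sum_product sum_divide_distrib
        by (intro sum.cong refl) (simp add: power_mult_distrib)
      finally show "complex_of_real ((cmod (power_mean n (cnj w * z)))\<^sup>2) = (\<Sum>i<n. \<Sum>j<n. cnj w ^ i * w ^ j / (of_nat n)\<^sup>2 * (z ^ i * cnj z ^ j))" .
    qed
    also have "\<dots> = (\<Sum>i<n. \<Sum>j<n. cnj w ^ i * w ^ j / (of_nat n)\<^sup>2 * c i j)"
      by (simp add: integrable_trig c)
    finally show ?thesis by (simp add: sum_divide_distrib)
  qed
  have F_meas: "(\<lambda>w. F n w) \<in> borel_measurable \<tau>" for n
  proof -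
    have "F n = (\<lambda>w. Re ((\<Sum>i<n. \<Sum>j<n. cnj w ^ i * w ^ j * c i j) / (of_nat n)\<^sup>2))"
      by (rule ext) (metis F_eq Re_complex_of_real)
    then show ?thesis by simp
  qed
  have int_F: "(LINT w|\<tau>. F n w) = (\<Sum>i<n. \<Sum>j<n. (cmod (c i j))\<^sup>2) / (real n)\<^sup>2" for n
  proof -
    have "complex_of_real (LINT w|\<tau>. F n w) = (LINT w|\<tau>. complex_of_real (F n w))"
      by (rule integral_complex_of_real[symmetric])
    also have "\<dots> = (LINT w|\<tau>. (\<Sum>i<n. \<Sum>j<n. c i j / (of_nat n)\<^sup>2 * (w ^ j * cnj w ^ i)))"
      unfolding F_eq by (intro Bochner_Integration.integral_cong refl) (simp add: sum_divide_distrib mult_ac)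
    also have "\<dots> = (\<Sum>i<n. \<Sum>j<n. c i j / (of_nat n)\<^sup>2 * c j i)"
      by (simp add: integrable_trig c)
    also have "\<dots> = (\<Sum>i<n. \<Sum>j<n. complex_of_real ((cmod (c i j))\<^sup>2 / (real n)\<^sup>2))"
    proof (intro sum.cong refl)
      fix i j
      have "c j i = cnj (c i j)"
        unfolding c by (subst Bochner_Integration.integral_cnj[symmetric]) (simp add: mult.commute)
      then show "c i j / (of_nat n)\<^sup>2 * c j i = complex_of_real ((cmod (c i j))\<^sup>2 / (real n)\<^sup>2)"
        using complex_norm_square[of "c i j"] by simp
    qed
    finally show ?thesis
      by (simp add: sum_divide_distrib of_real_sum[symmetric] del: of_real_sum of_real_divide of_real_power)
  qed
  \<comment> \<open>The map sending \<open>w\<close> to the mass of its singleton is measurable as a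
    pointwise limit of the functions \<open>F n\<close>; the limit is known on the circle only,
    hence the cut-off to 0 elsewhere.\<close>
  have atom_meas: "(\<lambda>w. if cmod w = 1 then prob {w} else 0) \<in> borel_measurable \<tau>"
  proof (rule borel_measurable_LIMSEQ_real)
    show "(\<lambda>w. if cmod w = 1 then F n w else 0) \<in> borel_measurable \<tau>" for n
      using F_meas by (intro measurable_If) auto
    show "(\<lambda>n. if cmod w = 1 then F n w else 0) \<longlonglongrightarrow> (if cmod w = 1 then prob {w} else 0)" for w
      using power_mean_square[of w] by (auto simp: F_def)
  qed
  have "(\<lambda>n. LINT w|\<tau>. F n w) \<longlonglongrightarrow> (LINT w|\<tau>. (if cmod w = 1 then prob {w} else 0))"
  proof (rule integral_dominated_convergence[where w = "\<lambda>_. 1"])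
    show "AE w in \<tau>. (\<lambda>n. F n w) \<longlonglongrightarrow> (if cmod w = 1 then prob {w} else 0)"
      using on_circle by eventually_elim (auto simp: F_def power_mean_square)
    show "AE w in \<tau>. norm (F n w) \<le> 1" for n
      using on_circle
    proof eventually_elim
      case (elim w)
      have "F n w \<le> (LINT z|\<tau>. 1)"
        unfolding F_def
      proof (rule integral_mono_AE)
        show A: "AE z in \<tau>. (cmod (power_mean n (cnj w * z)))\<^sup>2 \<le> 1"
          using power_mean_tendsto_AE(2)[OF elim, of n] by eventually_elim (simp add: power_le_one)
        show "integrable \<tau> (\<lambda>z. (cmod (power_mean n (cnj w * z)))\<^sup>2)"
          by (rule integrable_const_bound[of _ 1]) (use A in auto)
      qed auto
      moreover have "0 \<le> F n w" unfolding F_def by simp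
      ultimately show ?case by simp
    qed
  qed (use F_meas atom_meas in auto)
  moreover have "(LINT w|\<tau>. (if cmod w = 1 then prob {w} else 0)) \<le> (LINT w|\<tau>. s)"
  proof (rule integral_mono_AE)
    show "integrable \<tau> (\<lambda>w. (if cmod w = 1 then prob {w} else 0))"
      by (rule integrable_const_bound[of _ 1]) (use atom_meas in auto)
    show "AE w in \<tau>. (if cmod w = 1 then prob {w} else 0) \<le> s"
      using on_circle by eventually_elim (simp add: atoms)
  qed auto
  ultimately have "eventually (\<lambda>n. (LINT w|\<tau>. F n w) < s + e) sequentially"
    using e by (intro order_tendstoD(2)) auto
  then show ?thesis unfolding int_F .
qed

end

section \<open>Square-integrable functions\<close>

definition L2_inner :: "'a measure \<Rightarrow> ('a \<Rightarrow> complex) \<Rightarrow> ('a \<Rightarrow> complex) \<Rightarrow> complex" where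
  "L2_inner M f g = (LINT x|M. f x * cnj (g x))"

lemma L2_measurable [measurable_dest]: "f \<in> L2_functions M \<Longrightarrow> f \<in> borel_measurable M"
  by (simp add: L2_functions_def)

lemma L2_integrable: "f \<in> L2_functions M \<Longrightarrow> integrable M (\<lambda>x. (cmod (f x))\<^sup>2)"
  by (simp add: L2_functions_def)

lemma L2_integrable_mult:
  assumes f: "f \<in> L2_functions M" and g: "g \<in> L2_functions M"
  shows "integrable M (\<lambda>x. f x * cnj (g x))"
proof (rule Bochner_Integration.integrable_bound)
  show "integrable M (\<lambda>x. (cmod (f x))\<^sup>2 + (cmod (g x))\<^sup>2)"
    using f g by (intro Bochner_Integration.integrable_add L2_integrable)
  show "(\<lambda>x. f x * cnj (g x)) \<in> borel_measurable M" using f g by measurable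
  have "cmod (f x) * cmod (g x) \<le> (cmod (f x))\<^sup>2 + (cmod (g x))\<^sup>2" for x
  proof -
    have "0 \<le> cmod (f x) * cmod (g x)" by simp
    moreover have "2 * (cmod (f x) * cmod (g x)) \<le> (cmod (f x))\<^sup>2 + (cmod (g x))\<^sup>2"
      using sum_squares_bound[of "cmod (f x)" "cmod (g x)"] by (simp only: mult.assoc)
    ultimately show ?thesis by linarith
  qed
  then show "AE x in M. norm (f x * cnj (g x)) \<le> norm ((cmod (f x))\<^sup>2 + (cmod (g x))\<^sup>2)"
    by (simp add: norm_mult)
qed

lemma L2_scale: "f \<in> L2_functions M \<Longrightarrow> (\<lambda>x. c * f x) \<in> L2_functions M"
  by (auto simp: L2_functions_def norm_mult power_mult_distrib)

lemma L2_add: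
  assumes f: "f \<in> L2_functions M" and g: "g \<in> L2_functions M"
  shows "(\<lambda>x. f x + g x) \<in> L2_functions M"
proof -
  have "integrable M (\<lambda>x. (cmod (f x + g x))\<^sup>2)"
  proof (rule Bochner_Integration.integrable_bound)
    show "integrable M (\<lambda>x. 2 * (cmod (f x))\<^sup>2 + 2 * (cmod (g x))\<^sup>2)"
      using f g by (intro Bochner_Integration.integrable_add integrable_mult_right L2_integrable)
    show "(\<lambda>x. (cmod (f x + g x))\<^sup>2) \<in> borel_measurable M" using f g by measurable
    have "(cmod (f x + g x))\<^sup>2 \<le> 2 * (cmod (f x))\<^sup>2 + 2 * (cmod (g x))\<^sup>2" for x
    proof -
      have "(cmod (f x + g x))\<^sup>2 \<le> (cmod (f x) + cmod (g x))\<^sup>2"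
        by (intro power_mono norm_triangle_ineq) simp
      also have "\<dots> \<le> 2 * (cmod (f x))\<^sup>2 + 2 * (cmod (g x))\<^sup>2"
        using sum_squares_bound[of "cmod (f x)" "cmod (g x)"] by (simp add: power2_sum)
      finally show ?thesis .
    qed
    then show "AE x in M. norm ((cmod (f x + g x))\<^sup>2) \<le> norm (2 * (cmod (f x))\<^sup>2 + 2 * (cmod (g x))\<^sup>2)"
      by simp
  qed
  then show ?thesis using f g unfolding L2_functions_def by auto
qed

lemma L2_diff:
  assumes "f \<in> L2_functions M" and "g \<in> L2_functions M"
  shows "(\<lambda>x. f x - g x) \<in> L2_functions M"
  using L2_add[OF assms(1) L2_scale[OF assms(2), of "-1"]] by simp

lemma L2_zero: "(\<lambda>x. 0) \<in> L2_functions M"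
  by (simp add: L2_functions_def)

lemma L2_sum:
  assumes "\<And>i. i \<in> I \<Longrightarrow> f i \<in> L2_functions M"
  shows "(\<lambda>x. \<Sum>i\<in>I. f i x) \<in> L2_functions M"
  using assms by (induction I rule: infinite_finite_induct) (auto simp: L2_zero intro: L2_add)

lemma (in finite_measure) L2_bounded:
  assumes f: "f \<in> borel_measurable M" and K: "\<And>x. x \<in> space M \<Longrightarrow> cmod (f x) \<le> K"
  shows "f \<in> L2_functions M"
proof -
  have "integrable M (\<lambda>x. (cmod (f x))\<^sup>2)"
    using f K by (intro integrable_const_bound[of _ "K\<^sup>2"]) (auto intro!: AE_I2 power_mono)
  then show ?thesis using f by (simp add: L2_functions_def)
qed

lemma L2_inner_commute: "L2_inner M g f = cnj (L2_inner M f g)"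
  unfolding L2_inner_def
  by (subst Bochner_Integration.integral_cnj[symmetric]) (simp add: mult.commute)

lemma L2_inner_sum_left:
  assumes "\<And>i. i \<in> I \<Longrightarrow> f i \<in> L2_functions M" "g \<in> L2_functions M"
  shows "L2_inner M (\<lambda>x. \<Sum>i\<in>I. a i * f i x) g = (\<Sum>i\<in>I. a i * L2_inner M (f i) g)"
proof -
  have "L2_inner M (\<lambda>x. \<Sum>i\<in>I. a i * f i x) g = (LINT x|M. (\<Sum>i\<in>I. a i * (f i x * cnj (g x))))"
    unfolding L2_inner_def by (simp add: sum_distrib_right mult.assoc)
  also have "\<dots> = (\<Sum>i\<in>I. LINT x|M. a i * (f i x * cnj (g x)))"
    using assms by (intro Bochner_Integration.integral_sum integrable_mult_right L2_integrable_mult)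
  finally show ?thesis by (simp add: L2_inner_def)
qed

lemma L2_inner_sum_right:
  assumes "\<And>i. i \<in> I \<Longrightarrow> f i \<in> L2_functions M" "g \<in> L2_functions M"
  shows "L2_inner M g (\<lambda>x. \<Sum>i\<in>I. a i * f i x) = (\<Sum>i\<in>I. cnj (a i) * L2_inner M g (f i))"
  using L2_inner_sum_left[of I f M g a] assms L2_inner_commute[of M g]
  by (simp add: cnj_sum)

lemma L2_inner_add_left:
  assumes "f \<in> L2_functions M" "g \<in> L2_functions M" "h \<in> L2_functions M"
  shows "L2_inner M (\<lambda>x. f x + g x) h = L2_inner M f h + L2_inner M g h"
  unfolding L2_inner_def using assms
  by (simp add: distrib_right L2_integrable_mult)

lemma L2_inner_add_right:
  assumes "f \<in> L2_functions M" "g \<in> L2_functions M" "h \<in> L2_functions M"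
  shows "L2_inner M h (\<lambda>x. f x + g x) = L2_inner M h f + L2_inner M h g"
  unfolding L2_inner_def using assms
  by (simp add: distrib_left L2_integrable_mult)

lemma L2_inner_diff_left:
  assumes "f \<in> L2_functions M" "g \<in> L2_functions M" "h \<in> L2_functions M"
  shows "L2_inner M (\<lambda>x. f x - g x) h = L2_inner M f h - L2_inner M g h"
  unfolding L2_inner_def using assms
  by (simp add: left_diff_distrib L2_integrable_mult)

lemma L2_inner_diff_right:
  assumes "f \<in> L2_functions M" "g \<in> L2_functions M" "h \<in> L2_functions M"
  shows "L2_inner M h (\<lambda>x. f x - g x) = L2_inner M h f - L2_inner M h g"
  unfolding L2_inner_def using assms
  by (simp add: right_diff_distrib L2_integrable_mult)

lemma L2_inner_scale_left: "L2_inner M (\<lambda>x. c * f x) g = c * L2_inner M f g"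
  unfolding L2_inner_def by (simp add: mult.assoc)

lemma L2_inner_scale_right: "L2_inner M f (\<lambda>x. c * g x) = cnj c * L2_inner M f g"
  by (metis L2_inner_commute L2_inner_scale_left complex_cnj_mult complex_cnj_cnj)

lemma L2_seminorm_nonneg [simp]: "0 \<le> L2_seminorm M f"
  by (simp add: L2_seminorm_def)

lemma L2_seminorm_square: "(L2_seminorm M f)\<^sup>2 = (LINT x|M. (cmod (f x))\<^sup>2)"
  by (simp add: L2_seminorm_def)

lemma L2_inner_self: "L2_inner M f f = of_real ((L2_seminorm M f)\<^sup>2)"
  unfolding L2_inner_def L2_seminorm_square integral_complex_of_real[symmetric] complex_norm_square ..

lemma L2_cauchy_schwarz:
  assumes f: "f \<in> L2_functions M" and g: "g \<in> L2_functions M"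
  shows "cmod (L2_inner M f g) \<le> L2_seminorm M f * L2_seminorm M g"
proof -
  define A B where "A = L2_seminorm M f" and "B = L2_seminorm M g"
  have AB: "A \<ge> 0" "B \<ge> 0" by (simp_all add: A_def B_def)
  \<comment> \<open>The product is bounded by the arithmetic mean of
    \<open>s * (cmod (f x))\<^sup>2\<close> and \<open>(cmod (g x))\<^sup>2 / s\<close>, where
    \<open>s\<close> is the optimal weight. The slack \<open>e\<close> keeps \<open>s\<close>
    defined and positive when a seminorm vanishes; it is sent to 0 at the end.\<close>
  have "cmod (L2_inner M f g) \<le> (A + e) * (B + e)" if e: "e > 0" for e
  proof -
    define s where "s = (B + e) / (A + e)"
    have s: "s > 0" using AB e by (simp add: s_def add_nonneg_pos)
    have "cmod (L2_inner M f g) \<le> (LINT x|M. cmod (f x * cnj (g x)))"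
      unfolding L2_inner_def by (rule integral_norm_bound)
    also have "\<dots> \<le> (LINT x|M. (s * (cmod (f x))\<^sup>2 + (cmod (g x))\<^sup>2 / s) / 2)"
    proof (rule integral_mono)
      show "integrable M (\<lambda>x. cmod (f x * cnj (g x)))"
        by (intro integrable_norm L2_integrable_mult f g)
      show "integrable M (\<lambda>x. (s * (cmod (f x))\<^sup>2 + (cmod (g x))\<^sup>2 / s) / 2)"
        using L2_integrable[OF f] L2_integrable[OF g] by auto
      fix x
      have "0 \<le> (s * cmod (f x) - cmod (g x))\<^sup>2 / s" using s by simp
      also have "\<dots> = s * (cmod (f x))\<^sup>2 + (cmod (g x))\<^sup>2 / s - 2 * (cmod (f x) * cmod (g x))"
        using s by (simp add: power2_diff field_simps power2_eq_square)
      finally show "cmod (f x * cnj (g x)) \<le> (s * (cmod (f x))\<^sup>2 + (cmod (g x))\<^sup>2 / s) / 2"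
        by (simp add: norm_mult)
    qed
    also have "\<dots> = (s * A\<^sup>2 + B\<^sup>2 / s) / 2"
      using L2_integrable[OF f] L2_integrable[OF g] by (simp add: A_def B_def L2_seminorm_square)
    also have "\<dots> \<le> (A + e) * (B + e)"
    proof -
      have "s * A\<^sup>2 \<le> s * (A + e)\<^sup>2" using AB e s by (intro mult_left_mono power_mono) auto
      also have "\<dots> = (A + e) * (B + e)" using AB e by (simp add: s_def power2_eq_square)
      finally have 1: "s * A\<^sup>2 \<le> (A + e) * (B + e)" .
      have "B\<^sup>2 / s \<le> (B + e)\<^sup>2 / s" using AB e s by (intro divide_right_mono power_mono) auto
      also have "\<dots> = (A + e) * (B + e)" using AB e by (simp add: s_def power2_eq_square)
      finally show ?thesis using 1 by simp
    qed
    finally show ?thesis .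
  qed
  then have "\<forall>e>0. cmod (L2_inner M f g) \<le> (A + e) * (B + e)" by blast
  moreover have "((\<lambda>e. (A + e) * (B + e)) \<longlongrightarrow> (A + 0) * (B + 0)) (at_right 0)"
    by (intro tendsto_intros)
  ultimately have "cmod (L2_inner M f g) \<le> (A + 0) * (B + 0)"
    by (intro tendsto_lowerbound[of _ _ "at_right (0::real)"]) (auto simp: eventually_at_right_less eventually_at_filter)
  then show ?thesis by (simp add: A_def B_def)
qed

lemma L2_seminorm_add_square:
  assumes "f \<in> L2_functions M" "g \<in> L2_functions M"
  shows "(L2_seminorm M (\<lambda>x. f x + g x))\<^sup>2 =
    (L2_seminorm M f)\<^sup>2 + 2 * Re (L2_inner M f g) + (L2_seminorm M g)\<^sup>2"
proof -
  have "L2_inner M (\<lambda>x. f x + g x) (\<lambda>x. f x + g x) =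
      L2_inner M f f + L2_inner M f g + (cnj (L2_inner M f g) + L2_inner M g g)"
    by (simp only: L2_inner_add_left[OF assms L2_add[OF assms]] L2_inner_add_right assms
      L2_inner_commute[of M g f])
  then have "Re (L2_inner M (\<lambda>x. f x + g x) (\<lambda>x. f x + g x)) =
      Re (L2_inner M f f) + 2 * Re (L2_inner M f g) + Re (L2_inner M g g)"
    by simp
  then show ?thesis by (simp only: L2_inner_self Re_complex_of_real)
qed

lemma L2_seminorm_scale: "L2_seminorm M (\<lambda>x. c * f x) = cmod c * L2_seminorm M f"
  by (simp add: L2_seminorm_def norm_mult power_mult_distrib real_sqrt_mult)

lemma L2_seminorm_diff_square:
  assumes "f \<in> L2_functions M" "g \<in> L2_functions M"
  shows "(L2_seminorm M (\<lambda>x. f x - g x))\<^sup>2 =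
    (L2_seminorm M f)\<^sup>2 - 2 * Re (L2_inner M f g) + (L2_seminorm M g)\<^sup>2"
  using L2_seminorm_add_square[OF assms(1) L2_scale[OF assms(2), of "-1"]]
    L2_seminorm_scale[of M "-1" g] L2_inner_scale_right[of M f "-1" g] by simp

lemma L2_triangle:
  assumes "f \<in> L2_functions M" "g \<in> L2_functions M"
  shows "L2_seminorm M (\<lambda>x. f x + g x) \<le> L2_seminorm M f + L2_seminorm M g"
proof (rule power2_le_imp_le)
  have "Re (L2_inner M f g) \<le> L2_seminorm M f * L2_seminorm M g"
    using complex_Re_le_cmod L2_cauchy_schwarz[OF assms] by (rule order_trans)
  then show "(L2_seminorm M (\<lambda>x. f x + g x))\<^sup>2 \<le> (L2_seminorm M f + L2_seminorm M g)\<^sup>2"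
    by (simp add: L2_seminorm_add_square[OF assms] power2_sum)
qed simp

lemma L2_triangle_diff:
  assumes "f \<in> L2_functions M" "g \<in> L2_functions M"
  shows "L2_seminorm M (\<lambda>x. f x - g x) \<le> L2_seminorm M f + L2_seminorm M g"
  using L2_triangle[OF assms(1) L2_scale[OF assms(2), of "-1"]] L2_seminorm_scale[of M "-1" g] by simp

lemma L2_triangle3:
  assumes "f \<in> L2_functions M" "g \<in> L2_functions M" "h \<in> L2_functions M"
  shows "L2_seminorm M (\<lambda>x. f x - h x) \<le> L2_seminorm M (\<lambda>x. f x - g x) + L2_seminorm M (\<lambda>x. g x - h x)"
  using L2_triangle[OF L2_diff[OF assms(1,2)] L2_diff[OF assms(2,3)]] by simp

lemma L2_seminorm_commute: "L2_seminorm M (\<lambda>x. f x - g x) = L2_seminorm M (\<lambda>x. g x - f x)"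
  by (simp add: L2_seminorm_def norm_minus_commute)

lemma L2_seminorm_eq_0_iff:
  assumes "f \<in> L2_functions M"
  shows "L2_seminorm M f = 0 \<longleftrightarrow> (AE x in M. f x = 0)"
  using integral_nonneg_eq_0_iff_AE[OF L2_integrable[OF assms]] by (simp add: L2_seminorm_def)

lemma (in prob_space) L2_indicator:
  assumes "B \<in> sets M"
  shows "indicator B \<in> L2_functions M" "L2_seminorm M (indicator B) \<le> 1"
proof -
  show 1: "indicator B \<in> L2_functions M"
    by (rule L2_bounded[of _ 1]) (use assms in \<open>auto simp: indicator_def\<close>)
  have "(LINT x|M. (cmod (indicator B x))\<^sup>2) \<le> (LINT x|M. 1)"
    using L2_integrable[OF 1] by (intro integral_mono) (auto simp: indicator_def)
  then show "L2_seminorm M (indicator B) \<le> 1" by (simp add: L2_seminorm_def prob_space)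
qed

lemma (in prob_space) L1_le_L2:
  assumes "f \<in> L2_functions M"
  shows "integrable M f" "(LINT x|M. cmod (f x)) \<le> L2_seminorm M f"
proof -
  have 1: "(\<lambda>x. complex_of_real (cmod (f x))) \<in> L2_functions M"
    using assms by (auto simp: L2_functions_def)
  have 2: "(\<lambda>x. 1) \<in> L2_functions M" by (simp add: L2_functions_def)
  show "integrable M f" using L2_integrable_mult[OF assms 2] by simp
  have "L2_inner M (\<lambda>x. complex_of_real (cmod (f x))) (\<lambda>x. 1) = of_real (LINT x|M. cmod (f x))"
    unfolding L2_inner_def by simp
  then have "cmod (complex_of_real (LINT x|M. cmod (f x))) \<le> L2_seminorm M f"
    using L2_cauchy_schwarz[OF 1 2] by (simp add: L2_seminorm_def prob_space)
  then show "(LINT x|M. cmod (f x)) \<le> L2_seminorm M f" by simp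
qed

text \<open>On a probability space the sequence is also Cauchy in \<open>L\<^sup>1\<close>, so a
  subsequence converges almost everywhere. Fatou's lemma along this subsequence turns the Cauchy
  bound for \<open>f m\<close> and \<open>f n\<close> into the same bound for \<open>f n\<close> and
  the limit.\<close>

lemma (in prob_space) L2_complete:
  assumes f: "\<And>n. f n \<in> L2_functions M"
    and cauchy: "\<And>e. e > 0 \<Longrightarrow> \<exists>N. \<forall>m\<ge>N. \<forall>n\<ge>N. L2_seminorm M (\<lambda>x. f m x - f n x) < e"
  obtains g where "g \<in> L2_functions M" "(\<lambda>n. L2_seminorm M (\<lambda>x. f n x - g x)) \<longlonglongrightarrow> 0"
proof -
  have int: "integrable M (f n)" for n using f by (rule L1_le_L2)
  have "\<exists>N. \<forall>i\<ge>N. \<forall>j\<ge>N. (LINT x|M. norm (f i x - f j x)) < e" if "e > 0" for e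
  proof -
    obtain N where "\<forall>m\<ge>N. \<forall>n\<ge>N. L2_seminorm M (\<lambda>x. f m x - f n x) < e" using cauchy[OF \<open>e > 0\<close>] by blast
    then show ?thesis using L1_le_L2(2)[OF L2_diff[OF f f]] le_less_trans by blast
  qed
  then obtain r where r: "strict_mono r" and ae: "AE x in M. Cauchy (\<lambda>i. f (r i) x)"
    using cauchy_L1_AE_cauchy_subseq[of M f] int by blast
  define g where "g x = lim (\<lambda>i. f (r i) x)" for x
  have [measurable]: "f n \<in> borel_measurable M" for n using f by measurable
  have g_meas [measurable]: "g \<in> borel_measurable M" unfolding g_def by measurable
  have conv: "AE x in M. (\<lambda>i. f (r i) x) \<longlonglongrightarrow> g x"
    using ae unfolding g_def by eventually_elim (rule convergent_LIMSEQ_iff[THEN iffD1, OF Cauchy_convergent])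
  have bound: "(\<lambda>x. f n x - g x) \<in> L2_functions M \<and> L2_seminorm M (\<lambda>x. f n x - g x) \<le> e"
    if N: "\<forall>m\<ge>N. \<forall>n\<ge>N. L2_seminorm M (\<lambda>x. f m x - f n x) < e" and "n \<ge> N" and e: "e > 0" for n N e
  proof -
    have "(\<integral>\<^sup>+x. ennreal ((cmod (f n x - g x))\<^sup>2) \<partial>M)
        \<le> (\<integral>\<^sup>+x. liminf (\<lambda>i. ennreal ((cmod (f n x - f (r i) x))\<^sup>2)) \<partial>M)"
    proof (rule nn_integral_mono_AE, use conv in eventually_elim)
      case (elim x)
      then have "(\<lambda>i. ennreal ((cmod (f n x - f (r i) x))\<^sup>2)) \<longlonglongrightarrow> ennreal ((cmod (f n x - g x))\<^sup>2)"
        by (intro tendsto_ennrealI tendsto_intros)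
      then have "liminf (\<lambda>i. ennreal ((cmod (f n x - f (r i) x))\<^sup>2)) = ennreal ((cmod (f n x - g x))\<^sup>2)"
        by (rule lim_imp_Liminf[OF sequentially_bot])
      then show ?case by (rule eq_refl[OF sym])
    qed
    also have "\<dots> \<le> liminf (\<lambda>i. (\<integral>\<^sup>+x. ennreal ((cmod (f n x - f (r i) x))\<^sup>2) \<partial>M))"
      by (rule nn_integral_liminf) simp
    also have "\<dots> \<le> liminf (\<lambda>i. ennreal (e\<^sup>2))"
    proof (rule Liminf_mono)
      show "eventually (\<lambda>i. (\<integral>\<^sup>+x. ennreal ((cmod (f n x - f (r i) x))\<^sup>2) \<partial>M) \<le> ennreal (e\<^sup>2)) sequentially"
        using eventually_ge_at_top[of N]
      proof eventually_elim
        case (elim i)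
        then have "r i \<ge> N" using seq_suble[OF r, of i] by simp
        then have "L2_seminorm M (\<lambda>x. f n x - f (r i) x) < e" using N \<open>n \<ge> N\<close> by blast
        then have "(L2_seminorm M (\<lambda>x. f n x - f (r i) x))\<^sup>2 \<le> e\<^sup>2" by (intro power_mono) auto
        moreover have "(\<integral>\<^sup>+x. ennreal ((cmod (f n x - f (r i) x))\<^sup>2) \<partial>M) = ennreal ((L2_seminorm M (\<lambda>x. f n x - f (r i) x))\<^sup>2)"
          unfolding L2_seminorm_square
          by (rule nn_integral_eq_integral) (use L2_integrable[OF L2_diff[OF f f]] in auto)
        ultimately show ?case by (simp add: ennreal_leI)
      qed
    qed
    also have "\<dots> = ennreal (e\<^sup>2)" by (simp add: Liminf_const)
    finally have le: "(\<integral>\<^sup>+x. ennreal ((cmod (f n x - g x))\<^sup>2) \<partial>M) \<le> ennreal (e\<^sup>2)" .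
    have int: "integrable M (\<lambda>x. (cmod (f n x - g x))\<^sup>2)"
    proof (rule integrableI_bounded)
      show "(\<integral>\<^sup>+x. ennreal (norm ((cmod (f n x - g x))\<^sup>2)) \<partial>M) < \<infinity>"
        using le_less_trans[OF le ennreal_less_top] by simp
    qed measurable
    then have "ennreal ((L2_seminorm M (\<lambda>x. f n x - g x))\<^sup>2) \<le> ennreal (e\<^sup>2)"
      using le nn_integral_eq_integral[OF int] unfolding L2_seminorm_square by simp
    then have "(L2_seminorm M (\<lambda>x. f n x - g x))\<^sup>2 \<le> e\<^sup>2" by (simp add: ennreal_le_iff)
    then have "L2_seminorm M (\<lambda>x. f n x - g x) \<le> e"
      using e by (rule power2_le_imp_le[OF _ less_imp_le])
    moreover have "(\<lambda>x. f n x - g x) \<in> L2_functions M" using int by (simp add: L2_functions_def)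
    ultimately show ?thesis by blast
  qed
  have "g \<in> L2_functions M"
  proof -
    obtain N where "\<forall>m\<ge>N. \<forall>n\<ge>N. L2_seminorm M (\<lambda>x. f m x - f n x) < 1" using cauchy[of 1] by auto
    then have "(\<lambda>x. f N x - g x) \<in> L2_functions M" using bound[of N 1 N] by auto
    from L2_diff[OF f[of N] this] show ?thesis by simp
  qed
  moreover have "(\<lambda>n. L2_seminorm M (\<lambda>x. f n x - g x)) \<longlonglongrightarrow> 0"
  proof (rule LIMSEQ_I)
    fix e :: real assume "e > 0"
    then obtain N where "\<forall>m\<ge>N. \<forall>n\<ge>N. L2_seminorm M (\<lambda>x. f m x - f n x) < e / 2"
      using cauchy[of "e / 2"] by auto
    then have "L2_seminorm M (\<lambda>x. f n x - g x) \<le> e / 2" if "n \<ge> N" for n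
      using bound[of N "e / 2" n] that \<open>e > 0\<close> by auto
    then show "\<exists>N. \<forall>n\<ge>N. norm (L2_seminorm M (\<lambda>x. f n x - g x) - 0) < e"
      using \<open>e > 0\<close> by (intro exI[of _ N]) fastforce
  qed
  ultimately show ?thesis by (rule that)
qed

section \<open>Spectral measures of a measure-preserving map\<close>

locale measure_preserving = prob_space M for M :: "'a measure" +
  fixes T :: "'a \<Rightarrow> 'a"
  assumes T_measurable [measurable]: "T \<in> measurable M M" and distr_T: "distr M M T = M"
begin

lemma funpow_T_measurable [measurable]: "(T ^^ n) \<in> measurable M M"
  by (induction n) (auto intro: measurable_comp[OF _ T_measurable])

lemma distr_funpow: "distr M M (T ^^ n) = M"
proof (induction n)
  case 0
  then show ?case by (simp add: id_def)
next
  case (Suc n)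
  have "distr M M (T ^^ Suc n) = distr (distr M M (T ^^ n)) M T"
    by (simp add: distr_distr)
  then show ?case by (simp only: Suc distr_T)
qed

lemma integral_funpow:
  fixes f :: "'a \<Rightarrow> 'b :: {banach, second_countable_topology}"
  assumes "f \<in> borel_measurable M"
  shows "(LINT x|M. f ((T ^^ n) x)) = (LINT x|M. f x)"
  using integral_distr[OF funpow_T_measurable[of n] assms] by (simp add: distr_funpow)

lemma integrable_funpow:
  fixes f :: "'a \<Rightarrow> 'b :: {banach, second_countable_topology}"
  assumes "integrable M f"
  shows "integrable M (\<lambda>x. f ((T ^^ n) x))"
  using integrable_distr[OF funpow_T_measurable[of n], of f] assms by (simp add: distr_funpow)

lemma AE_funpow:
  assumes "AE x in M. P x"
  shows "AE x in M. P ((T ^^ n) x)"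
  using assms by (intro AE_distrD[OF funpow_T_measurable]) (simp only: distr_funpow)

lemma L2_funpow:
  assumes "f \<in> L2_functions M"
  shows "(\<lambda>x. f ((T ^^ n) x)) \<in> L2_functions M"
proof -
  have [measurable]: "f \<in> borel_measurable M" using assms by measurable
  show ?thesis
    using integrable_funpow[OF L2_integrable[OF assms], of n] by (simp add: L2_functions_def)
qed

lemma L2_inner_funpow:
  assumes f: "f \<in> L2_functions M" and g: "g \<in> L2_functions M"
  shows "L2_inner M (\<lambda>x. f ((T ^^ n) x)) (\<lambda>x. g ((T ^^ n) x)) = L2_inner M f g"
proof -
  have "(\<lambda>x. f x * cnj (g x)) \<in> borel_measurable M" using f g by measurable
  from integral_funpow[OF this] show ?thesis by (simp add: L2_inner_def)
qed

lemma L2_seminorm_funpow: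
  assumes "f \<in> L2_functions M"
  shows "L2_seminorm M (\<lambda>x. f ((T ^^ n) x)) = L2_seminorm M f"
proof -
  have "(\<lambda>x. (cmod (f x))\<^sup>2) \<in> borel_measurable M" using assms by measurable
  from integral_funpow[OF this] show ?thesis by (simp add: L2_seminorm_def)
qed

lemma L2_orbit_sum:
  assumes "h \<in> L2_functions M"
  shows "(\<lambda>x. \<Sum>i<n. p i * h ((T ^^ i) x)) \<in> L2_functions M"
  using assms by (intro L2_sum L2_scale L2_funpow)

lemma L2_inner_orbit_sum:
  assumes h: "h \<in> L2_functions M"
  shows "L2_inner M (\<lambda>x. \<Sum>i<n. p i * h ((T ^^ i) x)) (\<lambda>x. \<Sum>j<m. q j * h ((T ^^ j) x)) =
    (\<Sum>i<n. \<Sum>j<m. p i * cnj (q j) * L2_inner M (\<lambda>x. h ((T ^^ i) x)) (\<lambda>x. h ((T ^^ j) x)))"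
proof -
  have "L2_inner M (\<lambda>x. \<Sum>i<n. p i * h ((T ^^ i) x)) (\<lambda>x. \<Sum>j<m. q j * h ((T ^^ j) x)) =
    (\<Sum>i<n. p i * L2_inner M (\<lambda>x. h ((T ^^ i) x)) (\<lambda>x. \<Sum>j<m. q j * h ((T ^^ j) x)))"
    by (rule L2_inner_sum_left) (auto intro: L2_funpow L2_orbit_sum h)
  also have "\<dots> = (\<Sum>i<n. p i * (\<Sum>j<m. cnj (q j) * L2_inner M (\<lambda>x. h ((T ^^ i) x)) (\<lambda>x. h ((T ^^ j) x))))"
    by (intro sum.cong refl arg_cong2[where f = "(*)"] L2_inner_sum_right L2_funpow h)
  finally show ?thesis by (simp add: sum_distrib_left mult.assoc)
qed

text \<open>The usual spectral measure of \<open>h\<close> divided by its total mass, so that it is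
  a probability measure as Herglotz's theorem yields it; the squared seminorm restores the
  mass.\<close>

definition spectral_measure :: "('a \<Rightarrow> complex) \<Rightarrow> complex measure \<Rightarrow> bool" where
  "spectral_measure h \<tau> \<longleftrightarrow> circle_measure \<tau> \<and>
    (\<forall>i j. L2_inner M (\<lambda>x. h ((T ^^ i) x)) (\<lambda>x. h ((T ^^ j) x)) =
      of_real ((L2_seminorm M h)\<^sup>2) * (LINT z|\<tau>. z ^ i * cnj z ^ j))"

text \<open>The normalised correlations are Toeplitz because \<open>T\<close> preserves the measure,
  and their quadratic form is the squared norm of a weighted orbit sum, hence nonnegative.\<close>

lemma spectral_measure_exists:
  assumes h: "h \<in> L2_functions M" and pos: "L2_seminorm M h > 0"
  obtains \<tau> where "spectral_measure h \<tau>"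
proof -
  define s where "s = (L2_seminorm M h)\<^sup>2"
  have s: "s > 0" using pos by (simp add: s_def)
  define c where "c i j = L2_inner M (\<lambda>x. h ((T ^^ i) x)) (\<lambda>x. h ((T ^^ j) x)) / of_real s" for i j
  have toep: "c (Suc i) (Suc j) = c i j" for i j
    unfolding c_def
    using L2_inner_funpow[OF L2_funpow[OF h, of i] L2_funpow[OF h, of j], of 1]
    by (simp add: funpow_swap1)
  have herm: "c j i = cnj (c i j)" for i j
    unfolding c_def by (subst L2_inner_commute) simp
  have psd: "0 \<le> Re (\<Sum>i<n. \<Sum>j<n. x i * cnj (x j) * c i j)" for n x
  proof -
    have "(\<Sum>i<n. \<Sum>j<n. x i * cnj (x j) * c i j) =
      L2_inner M (\<lambda>y. \<Sum>i<n. x i * h ((T ^^ i) y)) (\<lambda>y. \<Sum>i<n. x i * h ((T ^^ i) y)) / of_real s"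
      unfolding L2_inner_orbit_sum[OF h] c_def by (simp add: sum_divide_distrib)
    also have "\<dots> = of_real ((L2_seminorm M (\<lambda>y. \<Sum>i<n. x i * h ((T ^^ i) y)))\<^sup>2 / s)"
      by (simp add: L2_inner_self)
    finally show ?thesis using s by (simp only: Re_complex_of_real) simp
  qed
  have c0: "c 0 0 = 1" using s by (simp add: c_def L2_inner_self s_def)
  obtain \<tau> where "prob_space \<tau>" "sets \<tau> = sets borel" "AE z in \<tau>. cmod z = 1"
    and c: "\<And>i j. c i j = (LINT z|\<tau>. z ^ i * cnj z ^ j)"
    by (rule herglotz[OF toep herm psd c0]) blast
  then have "circle_measure \<tau>" by (simp add: circle_measure_def circle_measure_axioms_def)
  moreover have "L2_inner M (\<lambda>x. h ((T ^^ i) x)) (\<lambda>x. h ((T ^^ j) x)) = of_real s * (LINT z|\<tau>. z ^ i * cnj z ^ j)" for i j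
    using s by (simp add: c[symmetric] c_def)
  ultimately have "spectral_measure h \<tau>" unfolding spectral_measure_def s_def by blast
  then show ?thesis by (rule that)
qed

text \<open>The isometry, up to a factor, from the cyclic space of \<open>h\<close> to the
  square-integrable functions of \<open>\<tau>\<close>: the orbit sum with coefficients
  \<open>p i\<close> corresponds to the polynomial with these coefficients.\<close>

lemma spectral_inner:
  assumes h: "h \<in> L2_functions M" and \<tau>: "spectral_measure h \<tau>"
  shows "L2_inner M (\<lambda>x. \<Sum>i<n. p i * h ((T ^^ i) x)) (\<lambda>x. \<Sum>j<m. q j * h ((T ^^ j) x)) =
    of_real ((L2_seminorm M h)\<^sup>2) * (LINT z|\<tau>. (\<Sum>i<n. p i * z ^ i) * cnj (\<Sum>j<m. q j * z ^ j))"
proof -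
  interpret \<tau>: circle_measure \<tau> using \<tau> by (simp add: spectral_measure_def)
  have "(LINT z|\<tau>. (\<Sum>i<n. p i * z ^ i) * cnj (\<Sum>j<m. q j * z ^ j)) =
      (LINT z|\<tau>. (\<Sum>i<n. \<Sum>j<m. p i * cnj (q j) * (z ^ i * cnj z ^ j)))"
    unfolding cnj_sum sum_product
    by (intro Bochner_Integration.integral_cong sum.cong refl) simp
  also have "\<dots> = (\<Sum>i<n. \<Sum>j<m. p i * cnj (q j) * (LINT z|\<tau>. z ^ i * cnj z ^ j))"
    by (simp add: \<tau>.integrable_trig)
  finally show ?thesis
    unfolding L2_inner_orbit_sum[OF h] using \<tau>
    by (simp add: spectral_measure_def sum_distrib_left mult_ac)
qed

text \<open>The component of \<open>h\<close> in the eigenspace of \<open>w\<close> is the \<open>L\<^sup>2\<close>-limit of the averages of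
  \<open>w\<^sup>-\<^sup>i U\<^sup>i h\<close>, which correspond to \<open>power_mean n (cnj w * z)\<close> in \<open>L\<^sup>2(\<tau>)\<close>.\<close>

lemma eigen_component:
  assumes h: "h \<in> L2_functions M" and \<tau>: "spectral_measure h \<tau>" and w: "cmod w = 1"
  obtains e where "e \<in> L2_functions M" "AE x in M. e (T x) = w * e x"
    "(L2_seminorm M (\<lambda>x. h x - e x))\<^sup>2 = (L2_seminorm M h)\<^sup>2 * (1 - measure \<tau> {w})"
proof -
  interpret \<tau>: circle_measure \<tau> using \<tau> by (simp add: spectral_measure_def)
  define s where "s = (L2_seminorm M h)\<^sup>2"
  define A where "A n = (\<lambda>x. \<Sum>i<n. cnj w ^ i / of_nat n * h ((T ^^ i) x))" for n
  have A_L2: "A n \<in> L2_functions M" for n unfolding A_def by (rule L2_orbit_sum[OF h])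
  have pm: "(\<Sum>i<n. cnj w ^ i / of_nat n * z ^ i) = power_mean n (cnj w * z)" for n z
    by (simp add: power_mean_def sum_divide_distrib power_mult_distrib)
  have inner_A: "L2_inner M (A n) (A m) = of_real s * (LINT z|\<tau>. power_mean n (cnj w * z) * cnj (power_mean m (cnj w * z)))" for n m
    unfolding A_def s_def spectral_inner[OF h \<tau>] pm ..
  have inner_hA: "L2_inner M (A n) h = of_real s * (LINT z|\<tau>. power_mean n (cnj w * z))" for n
    using spectral_inner[OF h \<tau>, of "\<lambda>i. cnj w ^ i / of_nat n" n "\<lambda>_. 1" 1]
    unfolding A_def s_def pm by simp
  have norm_A: "(L2_seminorm M (A n))\<^sup>2 = s * (LINT z|\<tau>. (cmod (power_mean n (cnj w * z)))\<^sup>2)" for n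
  proof -
    have "complex_of_real ((L2_seminorm M (A n))\<^sup>2) = of_real s * (LINT z|\<tau>. complex_of_real ((cmod (power_mean n (cnj w * z)))\<^sup>2))"
      unfolding L2_inner_self[symmetric] inner_A complex_norm_square ..
    also have "\<dots> = of_real (s * (LINT z|\<tau>. (cmod (power_mean n (cnj w * z)))\<^sup>2))"
      unfolding integral_complex_of_real by simp
    finally show ?thesis unfolding of_real_eq_iff .
  qed
  have le1: "AE z in \<tau>. cmod (power_mean n (cnj w * z)) \<le> 1" for n
    by (rule \<tau>.power_mean_tendsto_AE(2)[OF w])
  have int_pm: "integrable \<tau> (\<lambda>z. power_mean n (cnj w * z) * cnj (power_mean m (cnj w * z)))" for n m
  proof (rule \<tau>.integrable_const_bound[of _ 1])
    show "AE z in \<tau>. norm (power_mean n (cnj w * z) * cnj (power_mean m (cnj w * z))) \<le> 1"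
      using le1[of n] le1[of m] by eventually_elim (simp add: norm_mult mult_le_one)
  qed measurable
  \<comment> \<open>Squared distance in \<open>\<tau>\<close> from the limit of the means. Comparing
    two averages through this limit bounds the distance of \<open>A n\<close> and \<open>A m\<close>
    and gives the Cauchy property.\<close>
  define d where "d n = (LINT z|\<tau>. (cmod (power_mean n (cnj w * z) - indicator {w} z))\<^sup>2)" for n
  have d0: "d \<longlonglongrightarrow> 0" unfolding d_def[abs_def] by (rule \<tau>.power_mean_indicator[OF w])
  have int_d: "integrable \<tau> (\<lambda>z. (cmod (power_mean n (cnj w * z) - indicator {w} z))\<^sup>2)" for n
    by (rule \<tau>.integrable_const_bound[OF \<tau>.power_mean_indicator_bound[OF w]]) measurable
  have diff_A: "(L2_seminorm M (\<lambda>x. A n x - A m x))\<^sup>2 \<le> s * (2 * d n + 2 * d m)" for n m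
  proof -
    let ?p = "\<lambda>n z. power_mean n (cnj w * z)"
    have "complex_of_real ((L2_seminorm M (\<lambda>x. A n x - A m x))\<^sup>2) =
       L2_inner M (A n) (A n) - L2_inner M (A n) (A m) - (L2_inner M (A m) (A n) - L2_inner M (A m) (A m))"
      unfolding L2_inner_self[symmetric]
      by (simp add: L2_inner_diff_left L2_inner_diff_right A_L2 L2_diff)
    also have "\<dots> = of_real s * (LINT z|\<tau>. ?p n z * cnj (?p n z) - ?p n z * cnj (?p m z) - (?p m z * cnj (?p n z) - ?p m z * cnj (?p m z)))"
      unfolding inner_A using int_pm by (simp add: algebra_simps)
    also have "(\<lambda>z. ?p n z * cnj (?p n z) - ?p n z * cnj (?p m z) - (?p m z * cnj (?p n z) - ?p m z * cnj (?p m z)))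
       = (\<lambda>z. complex_of_real ((cmod (?p n z - ?p m z))\<^sup>2))"
      unfolding complex_norm_square by (simp add: algebra_simps fun_eq_iff)
    also have "of_real s * (LINT z|\<tau>. complex_of_real ((cmod (?p n z - ?p m z))\<^sup>2)) = of_real (s * (LINT z|\<tau>. (cmod (?p n z - ?p m z))\<^sup>2))"
      unfolding integral_complex_of_real by simp
    finally have "(L2_seminorm M (\<lambda>x. A n x - A m x))\<^sup>2 = s * (LINT z|\<tau>. (cmod (?p n z - ?p m z))\<^sup>2)"
      unfolding of_real_eq_iff .
    also have "(LINT z|\<tau>. (cmod (?p n z - ?p m z))\<^sup>2) \<le>
      (LINT z|\<tau>. 2 * (cmod (?p n z - indicator {w} z))\<^sup>2 + 2 * (cmod (?p m z - indicator {w} z))\<^sup>2)"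
    proof (rule integral_mono_AE)
      show "integrable \<tau> (\<lambda>z. (cmod (?p n z - ?p m z))\<^sup>2)"
      proof (rule \<tau>.integrable_const_bound[of _ 4])
        show "AE z in \<tau>. norm ((cmod (?p n z - ?p m z))\<^sup>2) \<le> 4"
          using le1[of n] le1[of m]
        proof eventually_elim
          case (elim z)
          have "cmod (?p n z - ?p m z) \<le> 1 + 1"
            by (rule order_trans[OF norm_triangle_ineq4 add_mono[OF elim]])
          from power_mono[OF this, of 2] show ?case by simp
        qed
      qed measurable
      show "integrable \<tau> (\<lambda>z. 2 * (cmod (?p n z - indicator {w} z))\<^sup>2 + 2 * (cmod (?p m z - indicator {w} z))\<^sup>2)"
        by (intro Bochner_Integration.integrable_add integrable_mult_right int_d)
      show "AE z in \<tau>. (cmod (?p n z - ?p m z))\<^sup>2 \<le> 2 * (cmod (?p n z - indicator {w} z))\<^sup>2 + 2 * (cmod (?p m z - indicator {w} z))\<^sup>2"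
      proof (rule AE_I2)
        fix z
        let ?a = "cmod (?p n z - indicator {w} z)" and ?b = "cmod (?p m z - indicator {w} z)"
        have "cmod (?p n z - ?p m z) \<le> ?a + ?b"
          using norm_triangle_ineq4[of "?p n z - indicator {w} z" "?p m z - indicator {w} z"] by simp
        then have "(cmod (?p n z - ?p m z))\<^sup>2 \<le> (?a + ?b)\<^sup>2" by (intro power_mono) auto
        also have "\<dots> \<le> 2 * ?a\<^sup>2 + 2 * ?b\<^sup>2"
          using sum_squares_bound[of ?a ?b] by (simp add: power2_sum)
        finally show "(cmod (?p n z - ?p m z))\<^sup>2 \<le> 2 * ?a\<^sup>2 + 2 * ?b\<^sup>2" .
      qed
    qed
    also have "\<dots> = 2 * d n + 2 * d m"
      using int_d by (simp add: d_def)
    finally show ?thesis by (simp add: s_def mult_left_mono)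
  qed
  have "\<exists>N. \<forall>m\<ge>N. \<forall>n\<ge>N. L2_seminorm M (\<lambda>x. A m x - A n x) < e" if e: "e > 0" for e
  proof -
    have "(\<lambda>n. 4 * s * d n) \<longlonglongrightarrow> 4 * s * 0" by (intro tendsto_intros d0)
    then have "eventually (\<lambda>n. 4 * s * d n < e\<^sup>2) sequentially"
      using e by (intro order_tendstoD(2)) auto
    then obtain N where N: "\<And>n. n \<ge> N \<Longrightarrow> 4 * s * d n < e\<^sup>2"
      by (auto simp: eventually_sequentially)
    have "L2_seminorm M (\<lambda>x. A m x - A n x) < e" if "m \<ge> N" "n \<ge> N" for m n
    proof -
      have "s * (2 * d m + 2 * d n) = (4 * s * d m + 4 * s * d n) / 2" by (simp add: algebra_simps)
      also have "\<dots> < e\<^sup>2"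
        using N[OF \<open>m \<ge> N\<close>] N[OF \<open>n \<ge> N\<close>] by (simp add: field_simps)
      finally have "(L2_seminorm M (\<lambda>x. A m x - A n x))\<^sup>2 < e\<^sup>2"
        by (rule le_less_trans[OF diff_A])
      then show ?thesis using e by (rule power2_less_imp_less[OF _ less_imp_le])
    qed
    then show ?thesis by blast
  qed
  then obtain e where e: "e \<in> L2_functions M" and lim: "(\<lambda>n. L2_seminorm M (\<lambda>x. A n x - e x)) \<longlonglongrightarrow> 0"
    using L2_complete[of A] A_L2 by blast
  have eT: "(\<lambda>x. e (T x)) \<in> L2_functions M" using L2_funpow[OF e, of 1] by simp
  have AT: "(\<lambda>x. A n (T x)) \<in> L2_functions M" for n using L2_funpow[OF A_L2, of n 1] by simp
  \<comment> \<open>For the averages, \<open>A n (T x) - w * A n x\<close> telescopes to two end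
    terms of total norm at most \<open>2 * L2_seminorm M h / real n\<close>. Replacing
    \<open>A n\<close> by \<open>e\<close> on both sides costs its distance from \<open>e\<close>
    twice.\<close>
  have invar: "L2_seminorm M (\<lambda>x. e (T x) - w * e x) \<le> 2 * L2_seminorm M (\<lambda>x. A n x - e x) + 2 * L2_seminorm M h / real n"
    if n: "n > 0" for n
  proof -
    have "L2_seminorm M (\<lambda>x. e (T x) - w * e x) \<le>
       L2_seminorm M (\<lambda>x. e (T x) - A n (T x)) + L2_seminorm M (\<lambda>x. A n (T x) - w * e x)"
      by (rule L2_triangle3) (intro e eT AT L2_scale)+
    also have "L2_seminorm M (\<lambda>x. A n (T x) - w * e x) \<le>
       L2_seminorm M (\<lambda>x. A n (T x) - w * A n x) + L2_seminorm M (\<lambda>x. w * A n x - w * e x)"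
      by (rule L2_triangle3) (intro e eT AT A_L2 L2_scale)+
    also have "L2_seminorm M (\<lambda>x. e (T x) - A n (T x)) = L2_seminorm M (\<lambda>x. A n x - e x)"
      using L2_seminorm_funpow[OF L2_diff[OF e A_L2[of n]], of 1] by (simp add: L2_seminorm_commute)
    also have "L2_seminorm M (\<lambda>x. w * A n x - w * e x) = L2_seminorm M (\<lambda>x. A n x - e x)"
      using L2_seminorm_scale[of M w "\<lambda>x. A n x - e x"] w by (simp add: right_diff_distrib)
    also have "L2_seminorm M (\<lambda>x. A n (T x) - w * A n x) \<le> 2 * L2_seminorm M h / real n"
    proof -
      have ww: "w * cnj w = 1" using w by (simp only: complex_norm_square[symmetric]) simp
      have "A n (T x) - w * A n x = w / of_nat n * (cnj w ^ n * h ((T ^^ n) x) - h x)" for x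
      proof -
        have "A n (T x) - w * A n x = (\<Sum>i<n. w / of_nat n * (cnj w ^ Suc i * h ((T ^^ Suc i) x) - cnj w ^ i * h ((T ^^ i) x)))"
          unfolding A_def sum_distrib_left sum_subtractf[symmetric]
        proof (intro sum.cong refl)
          fix i
          have "w * cnj w ^ Suc i = cnj w ^ i" using ww by (simp add: mult.assoc[symmetric])
          then show "cnj w ^ i / of_nat n * h ((T ^^ i) (T x)) - w * (cnj w ^ i / of_nat n * h ((T ^^ i) x)) =
            w / of_nat n * (cnj w ^ Suc i * h ((T ^^ Suc i) x) - cnj w ^ i * h ((T ^^ i) x))"
            by (simp only: right_diff_distrib times_divide_eq_left times_divide_eq_right mult.assoc[symmetric] funpow_Suc_right o_apply)
        qed
        also have "\<dots> = w / of_nat n * (\<Sum>i<n. cnj w ^ Suc i * h ((T ^^ Suc i) x) - cnj w ^ i * h ((T ^^ i) x))"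
          by (rule sum_distrib_left[symmetric])
        also have "(\<Sum>i<n. cnj w ^ Suc i * h ((T ^^ Suc i) x) - cnj w ^ i * h ((T ^^ i) x)) = cnj w ^ n * h ((T ^^ n) x) - h x"
          by (subst sum_lessThan_telescope) simp
        finally show ?thesis .
      qed
      then have "L2_seminorm M (\<lambda>x. A n (T x) - w * A n x) = L2_seminorm M (\<lambda>x. cnj w ^ n * h ((T ^^ n) x) - h x) / real n"
        using w by (simp only: L2_seminorm_scale) (simp add: norm_divide)
      also have "L2_seminorm M (\<lambda>x. cnj w ^ n * h ((T ^^ n) x) - h x) \<le> L2_seminorm M (\<lambda>x. cnj w ^ n * h ((T ^^ n) x)) + L2_seminorm M h"
        by (rule L2_triangle_diff) (intro L2_scale L2_funpow h)+
      also have "L2_seminorm M (\<lambda>x. cnj w ^ n * h ((T ^^ n) x)) = L2_seminorm M h"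
        by (simp add: L2_seminorm_scale L2_seminorm_funpow h norm_power w)
      finally show ?thesis by (simp add: divide_right_mono)
    qed
    finally show ?thesis by simp
  qed
  have "(\<lambda>n. 2 * L2_seminorm M (\<lambda>x. A n x - e x) + 2 * L2_seminorm M h / real n) \<longlonglongrightarrow> 2 * 0 + 0"
    by (intro tendsto_add tendsto_mult tendsto_const lim lim_const_over_n)
  moreover have "eventually (\<lambda>n. L2_seminorm M (\<lambda>x. e (T x) - w * e x) \<le> 2 * L2_seminorm M (\<lambda>x. A n x - e x) + 2 * L2_seminorm M h / real n) sequentially"
    using eventually_gt_at_top[of 0] by eventually_elim (rule invar)
  ultimately have "L2_seminorm M (\<lambda>x. e (T x) - w * e x) \<le> 2 * 0 + 0"
    by (rule tendsto_lowerbound) simp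
  then have "L2_seminorm M (\<lambda>x. e (T x) - w * e x) = 0"
    using L2_seminorm_nonneg[of M "\<lambda>x. e (T x) - w * e x"] by linarith
  then have "AE x in M. e (T x) - w * e x = 0"
    using L2_seminorm_eq_0_iff[OF L2_diff[OF eT L2_scale[OF e]]] by blast
  then have eigen: "AE x in M. e (T x) = w * e x" by simp
  have inner_lim: "(\<lambda>n. L2_inner M (A n) g) \<longlonglongrightarrow> L2_inner M e g" if g: "g \<in> L2_functions M" for g
  proof (rule LIM_zero_cancel, rule Lim_null_comparison)
    show "eventually (\<lambda>n. norm (L2_inner M (A n) g - L2_inner M e g) \<le> L2_seminorm M (\<lambda>x. A n x - e x) * L2_seminorm M g) sequentially"
      using L2_cauchy_schwarz[OF L2_diff[OF A_L2 e] g] by (simp add: L2_inner_diff_left A_L2 e g)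
    have "(\<lambda>n. L2_seminorm M (\<lambda>x. A n x - e x) * L2_seminorm M g) \<longlonglongrightarrow> 0 * L2_seminorm M g"
      by (intro tendsto_intros lim)
    then show "(\<lambda>n. L2_seminorm M (\<lambda>x. A n x - e x) * L2_seminorm M g) \<longlonglongrightarrow> 0" by simp
  qed
  \<comment> \<open>The inner product of \<open>e\<close> with \<open>h\<close> and the squared norm
    of \<open>e\<close> turn out to be the same number, as for an orthogonal projection; expanding
    the square of the difference then gives the distance.\<close>
  have "L2_inner M e h = of_real (s * measure \<tau> {w})"
  proof (rule LIMSEQ_unique[OF inner_lim[OF h]])
    have "(\<lambda>n. of_real s * (LINT z|\<tau>. power_mean n (cnj w * z))) \<longlonglongrightarrow> of_real s * of_real (measure \<tau> {w})"
      by (intro tendsto_intros \<tau>.power_mean_integral[OF w])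
    then show "(\<lambda>n. L2_inner M (A n) h) \<longlonglongrightarrow> of_real (s * measure \<tau> {w})" by (simp add: inner_hA)
  qed
  moreover have "(L2_seminorm M e)\<^sup>2 = s * measure \<tau> {w}"
  proof (rule LIMSEQ_unique)
    show "(\<lambda>n. (L2_seminorm M (A n))\<^sup>2) \<longlonglongrightarrow> s * measure \<tau> {w}"
      unfolding norm_A by (intro tendsto_intros \<tau>.power_mean_square[OF w])
    have "(\<lambda>n. L2_seminorm M (A n)) \<longlonglongrightarrow> L2_seminorm M e"
    proof (rule LIM_zero_cancel, rule Lim_null_comparison[OF _ lim], intro always_eventually allI)
      fix n
      have "L2_seminorm M (A n) \<le> L2_seminorm M (\<lambda>x. A n x - e x) + L2_seminorm M e"
        using L2_triangle[OF L2_diff[OF A_L2 e] e, of n] by simp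
      moreover have "L2_seminorm M e \<le> L2_seminorm M (\<lambda>x. A n x - e x) + L2_seminorm M (A n)"
        using L2_triangle[OF L2_diff[OF e A_L2] A_L2, of n n] by (simp add: L2_seminorm_commute[of M e])
      ultimately show "norm (L2_seminorm M (A n) - L2_seminorm M e) \<le> L2_seminorm M (\<lambda>x. A n x - e x)"
        by simp
    qed
    then show "(\<lambda>n. (L2_seminorm M (A n))\<^sup>2) \<longlonglongrightarrow> (L2_seminorm M e)\<^sup>2" by (intro tendsto_intros)
  qed
  ultimately have "(L2_seminorm M (\<lambda>x. h x - e x))\<^sup>2 = s * (1 - measure \<tau> {w})"
    unfolding L2_seminorm_diff_square[OF h e] L2_inner_commute[of M h e]
    by (simp add: s_def algebra_simps)
  with e eigen show ?thesis unfolding s_def by (rule that)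
qed

end

lemma L2_seminorm_cong_AE:
  assumes "f \<in> borel_measurable M" "g \<in> borel_measurable M" "AE x in M. f x = g x"
  shows "L2_seminorm M f = L2_seminorm M g"
proof -
  have "(LINT x|M. (cmod (f x))\<^sup>2) = (LINT x|M. (cmod (g x))\<^sup>2)"
    using assms by (intro integral_cong_AE) auto
  then show ?thesis by (simp add: L2_seminorm_def)
qed

lemma sum_le_sqrt_sum_squares:
  fixes f :: "'b \<Rightarrow> real"
  shows "(\<Sum>i\<in>I. f i) \<le> sqrt (real (card I)) * sqrt (\<Sum>i\<in>I. (f i)\<^sup>2)"
proof -
  have "(\<Sum>i\<in>I. f i) \<le> sqrt ((\<Sum>i\<in>I. (f i)\<^sup>2) * real (card I))"
    using sum_squared_le_sum_of_squares[of f I] by (intro real_le_rsqrt) simp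
  then show ?thesis by (simp add: real_sqrt_mult mult.commute)
qed

section \<open>The span of the eigenfunctions and residuals of nearly best approximation\<close>

context measure_preserving
begin

definition eigen_span :: "('a \<Rightarrow> complex) set" where
  "eigen_span = {g. \<exists>F a. finite F \<and> F \<subseteq> eigenfunctions M T \<and> g = (\<lambda>x. \<Sum>f\<in>F. a f * f x)}"

lemma eigen_span_L2: "g \<in> eigen_span \<Longrightarrow> g \<in> L2_functions M"
  unfolding eigen_span_def by (auto intro!: L2_sum L2_scale simp: eigenfunctions_def)

lemma eigen_span_0: "(\<lambda>x. 0) \<in> eigen_span"
  unfolding eigen_span_def by (intro CollectI exI[of _ "{}"]) simp

lemma eigen_span_scale:
  assumes "g \<in> eigen_span"
  shows "(\<lambda>x. c * g x) \<in> eigen_span"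
proof -
  obtain F a where "finite F" "F \<subseteq> eigenfunctions M T" "g = (\<lambda>x. \<Sum>f\<in>F. a f * f x)"
    using assms by (auto simp: eigen_span_def)
  then show ?thesis
    unfolding eigen_span_def
    by (intro CollectI exI[of _ F] exI[of _ "\<lambda>f. c * a f"]) (simp add: sum_distrib_left mult.assoc)
qed

lemma eigen_span_add:
  assumes "g \<in> eigen_span" "h \<in> eigen_span"
  shows "(\<lambda>x. g x + h x) \<in> eigen_span"
proof -
  obtain F a where F: "finite F" "F \<subseteq> eigenfunctions M T" and g: "g = (\<lambda>x. \<Sum>f\<in>F. a f * f x)"
    using assms(1) by (auto simp: eigen_span_def)
  obtain G b where G: "finite G" "G \<subseteq> eigenfunctions M T" and h: "h = (\<lambda>x. \<Sum>f\<in>G. b f * f x)"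
    using assms(2) by (auto simp: eigen_span_def)
  define c where "c f = (if f \<in> F then a f else 0) + (if f \<in> G then b f else 0)" for f
  have "g x + h x = (\<Sum>f\<in>F \<union> G. c f * f x)" for x
  proof -
    have "g x = (\<Sum>f\<in>F \<union> G. (if f \<in> F then a f else 0) * f x)"
      unfolding g using F G by (intro sum.mono_neutral_cong_left) auto
    moreover have "h x = (\<Sum>f\<in>F \<union> G. (if f \<in> G then b f else 0) * f x)"
      unfolding h using F G by (intro sum.mono_neutral_cong_left) auto
    ultimately show ?thesis by (simp add: c_def distrib_right sum.distrib)
  qed
  then show ?thesis
    unfolding eigen_span_def using F G by (intro CollectI exI[of _ "F \<union> G"] exI[of _ c]) auto
qed

lemma eigenfunction_in_span: "e \<in> eigenfunctions M T \<Longrightarrow> e \<in> eigen_span"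
  unfolding eigen_span_def by (intro CollectI exI[of _ "{e}"] exI[of _ "\<lambda>_. 1"]) simp

lemma purely_discrete_spectrum_iff:
  "purely_discrete_spectrum M T \<longleftrightarrow>
    (\<forall>g\<in>L2_functions M. \<forall>\<epsilon>>0. \<exists>s\<in>eigen_span. L2_seminorm M (\<lambda>x. g x - s x) < \<epsilon>)"
  unfolding purely_discrete_spectrum_def eigen_span_def by fastforce

text \<open>A near-minimiser \<open>g\<close> of the distance from \<open>f\<close> replaces the orthogonal projection onto the
  closed span of the eigenfunctions: large atoms of the spectral measure of the residual \<open>f - g\<close>
  would allow an improvement of \<open>g\<close>.\<close>

lemma near_minimiser:
  assumes f: "f \<in> L2_functions M" and f1: "L2_seminorm M f \<le> 1" and \<eta>: "0 < \<eta>" "\<eta> \<le> 1"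
  obtains g h where "g \<in> eigen_span" "h = (\<lambda>x. f x - g x)" "L2_seminorm M h \<le> 2"
    "(L2_seminorm M h)\<^sup>2 - 5 * sqrt \<eta> \<le> Re (L2_inner M f h)"
    "eventually (\<lambda>n. (\<Sum>i<n. \<Sum>j<n. cmod (L2_inner M (\<lambda>x. h ((T ^^ i) x)) (\<lambda>x. h ((T ^^ j) x))))
       \<le> (real n)\<^sup>2 * (2 * sqrt \<eta>)) sequentially"
proof -
  define D where "D = (INF g\<in>eigen_span. (L2_seminorm M (\<lambda>x. f x - g x))\<^sup>2)"
  have bdd: "bdd_below ((\<lambda>g. (L2_seminorm M (\<lambda>x. f x - g x))\<^sup>2) ` eigen_span)"
    by (rule bdd_belowI2[of _ 0]) simp
  have D_le: "D \<le> (L2_seminorm M (\<lambda>x. f x - g x))\<^sup>2" if "g \<in> eigen_span" for g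
    unfolding D_def by (rule cINF_lower[OF bdd that])
  have "eigen_span \<noteq> {}" using eigen_span_0 by auto
  moreover have "D < D + \<eta>" using \<eta> by simp
  ultimately obtain g where g: "g \<in> eigen_span" and gD: "(L2_seminorm M (\<lambda>x. f x - g x))\<^sup>2 < D + \<eta>"
    unfolding D_def using cINF_less_iff[OF _ bdd] by blast
  define h where "h = (\<lambda>x. f x - g x)"
  note g2 = eigen_span_L2[OF g]
  have h: "h \<in> L2_functions M" unfolding h_def by (rule L2_diff[OF f g2])
  have hD: "(L2_seminorm M h)\<^sup>2 < D + \<eta>" using gD by (simp add: h_def)
  have "D \<le> (L2_seminorm M f)\<^sup>2" using D_le[OF eigen_span_0] by simp
  also have "\<dots> \<le> 1" using f1 by (simp add: power_le_one)
  finally have "D \<le> 1" .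
  then have h_sq: "(L2_seminorm M h)\<^sup>2 \<le> 2" using hD \<eta> by simp
  have h2: "L2_seminorm M h \<le> 2"
    by (rule power2_le_imp_le) (use h_sq in simp_all)
  have "g = (\<lambda>x. f x - h x)" by (simp add: h_def)
  then have "L2_seminorm M g \<le> L2_seminorm M f + L2_seminorm M h"
    using L2_triangle_diff[OF f h] by simp
  then have g3: "L2_seminorm M g \<le> 3" using f1 h2 by simp
  \<comment> \<open>A first-variation argument: shrinking \<open>g\<close> by the factor
    \<open>1 - sqrt \<eta>\<close> stays in the span, so it gains at most \<open>\<eta>\<close>.
    With \<open>L2_seminorm M g \<le> 3\<close> the errors add up to
    \<open>9 * \<eta> + \<eta>\<close>, and division by \<open>2 * sqrt \<eta>\<close> leaves the
    constant 5.\<close>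
  have "Re (L2_inner M g h) \<ge> - 5 * sqrt \<eta>"
  proof -
    let ?r = "sqrt \<eta>"
    have r: "?r > 0" "?r * ?r = \<eta>" using \<eta> by auto
    have "(\<lambda>x. of_real (1 - ?r) * g x) \<in> eigen_span" by (rule eigen_span_scale[OF g])
    from D_le[OF this] have "D \<le> (L2_seminorm M (\<lambda>x. h x + of_real ?r * g x))\<^sup>2"
      by (simp add: h_def algebra_simps)
    also have "\<dots> = (L2_seminorm M h)\<^sup>2 + 2 * Re (L2_inner M h (\<lambda>x. of_real ?r * g x)) + \<eta> * (L2_seminorm M g)\<^sup>2"
      using r \<eta> by (simp add: L2_seminorm_add_square h L2_scale g2 L2_seminorm_scale power_mult_distrib)
    also have "Re (L2_inner M h (\<lambda>x. of_real ?r * g x)) = ?r * Re (L2_inner M g h)"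
      unfolding L2_inner_scale_right L2_inner_commute[of M h g] by simp
    also have "\<eta> * (L2_seminorm M g)\<^sup>2 \<le> \<eta> * 3\<^sup>2"
      using \<eta> g3 by (intro mult_left_mono power_mono) auto
    finally have "0 \<le> 2 * (?r * Re (L2_inner M g h)) + 10 * \<eta>" using hD by simp
    also have "\<dots> = 2 * ?r * (Re (L2_inner M g h) + 5 * ?r)"
      using r(2) by (simp add: algebra_simps)
    finally have "0 \<le> Re (L2_inner M g h) + 5 * ?r" using r(1) by (simp add: zero_le_mult_iff)
    then show ?thesis by simp
  qed
  moreover have "L2_inner M f h = L2_inner M h h + L2_inner M g h"
  proof -
    have "f = (\<lambda>x. h x + g x)" by (simp add: h_def)
    then show ?thesis using L2_inner_add_left[OF h g2 h] by simp
  qed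
  ultimately have Re_fh: "(L2_seminorm M h)\<^sup>2 - 5 * sqrt \<eta> \<le> Re (L2_inner M f h)"
    by (simp add: L2_inner_self flip: of_real_power)
  define c where "c i j = L2_inner M (\<lambda>x. h ((T ^^ i) x)) (\<lambda>x. h ((T ^^ j) x))" for i j
  have "eventually (\<lambda>n. (\<Sum>i<n. \<Sum>j<n. cmod (c i j)) \<le> (real n)\<^sup>2 * (2 * sqrt \<eta>)) sequentially"
  proof (cases "L2_seminorm M h = 0")
    case True
    have "cmod (c i j) \<le> 0" for i j
      using L2_cauchy_schwarz[OF L2_funpow[OF h] L2_funpow[OF h], of i j]
      by (simp add: c_def L2_seminorm_funpow[OF h] True)
    then show ?thesis using \<eta> by (simp add: sum_nonpos)
  next
    case False
    then have hpos: "L2_seminorm M h > 0" by (simp add: order_less_le)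
    define s where "s = (L2_seminorm M h)\<^sup>2"
    have s: "s > 0" using hpos by (simp add: s_def)
    obtain \<tau> where \<tau>: "spectral_measure h \<tau>" using spectral_measure_exists[OF h hpos] .
    interpret \<tau>: circle_measure \<tau> using \<tau> by (simp add: spectral_measure_def)
    define c' where "c' i j = (LINT z|\<tau>. z ^ i * cnj z ^ j)" for i j
    have c_eq: "c i j = of_real s * c' i j" for i j
      using \<tau> by (simp add: spectral_measure_def c_def c'_def s_def)
    \<comment> \<open>Moving the component \<open>e\<close> of the residual from \<open>h\<close> to
      \<open>g\<close> lowers the squared distance by \<open>s\<close> times the atom, and
      near-minimality of \<open>g\<close> allows a gain below \<open>\<eta>\<close> only. If
      \<open>e\<close> vanishes almost everywhere it is no eigenfunction, and then \<open>g\<close>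
      itself is compared.\<close>
    have atoms: "measure \<tau> {w} \<le> \<eta> / s" if w: "cmod w = 1" for w
    proof -
      obtain e where e: "e \<in> L2_functions M" "AE x in M. e (T x) = w * e x"
        and dist: "(L2_seminorm M (\<lambda>x. h x - e x))\<^sup>2 = s * (1 - measure \<tau> {w})"
        using eigen_component[OF h \<tau> w] unfolding s_def by blast
      have "D \<le> (L2_seminorm M (\<lambda>x. h x - e x))\<^sup>2"
      proof (cases "AE x in M. e x = 0")
        case True
        then have "AE x in M. h x - e x = h x" by eventually_elim simp
        then have "L2_seminorm M (\<lambda>x. h x - e x) = L2_seminorm M h"
          using h e(1) by (intro L2_seminorm_cong_AE L2_measurable L2_diff)
        then show ?thesis using D_le[OF g] by (simp add: h_def)
      next
        case False
        then have "e \<in> eigenfunctions M T" using e by (auto simp: eigenfunctions_def)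
        from D_le[OF eigen_span_add[OF g eigenfunction_in_span[OF this]]] show ?thesis
          by (simp add: h_def algebra_simps)
      qed
      then have "s - \<eta> < s * (1 - measure \<tau> {w})" using dist hD by (simp add: s_def)
      then have "measure \<tau> {w} * s < \<eta>" by (simp add: algebra_simps)
      then show ?thesis using s by (simp add: pos_le_divide_eq)
    qed
    \<comment> \<open>Wiener's lemma is used with tolerance equal to the bound on the atoms. Undoing
      the normalisation gives a mean square of at most
      \<open>2 * s * \<eta> \<le> 4 * \<eta>\<close>, since \<open>s \<le> 2\<close>; Cauchy-Schwarz
      over the pairs of times turns this into \<open>2 * sqrt \<eta>\<close>.\<close>
    have "\<eta> / s > 0" using \<eta> s by simp
    from \<tau>.wiener[OF c'_def atoms this]
    have "eventually (\<lambda>n. (\<Sum>i<n. \<Sum>j<n. (cmod (c' i j))\<^sup>2) / (real n)\<^sup>2 < \<eta> / s + \<eta> / s) sequentially" .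
    then show ?thesis using eventually_gt_at_top[of 0]
    proof eventually_elim
      case (elim n)
      have "(\<Sum>i<n. \<Sum>j<n. (cmod (c i j))\<^sup>2) = s\<^sup>2 * (\<Sum>i<n. \<Sum>j<n. (cmod (c' i j))\<^sup>2)"
        by (simp add: c_eq norm_mult power_mult_distrib sum_distrib_left)
      also have "\<dots> \<le> s\<^sup>2 * ((real n)\<^sup>2 * (\<eta> / s + \<eta> / s))"
        using elim by (intro mult_left_mono) (auto simp: field_simps)
      also have "\<dots> = (real n)\<^sup>2 * (2 * s * \<eta>)" using s by (simp add: power2_eq_square field_simps)
      also have "\<dots> \<le> (real n)\<^sup>2 * (2 * 2 * \<eta>)"
        using h_sq \<eta> by (intro mult_left_mono mult_right_mono) (auto simp: s_def)
      finally have sq: "(\<Sum>i<n. \<Sum>j<n. (cmod (c i j))\<^sup>2) \<le> (real n)\<^sup>2 * (4 * \<eta>)" by simp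
      have "(\<Sum>i<n. \<Sum>j<n. cmod (c i j)) = (\<Sum>(i,j)\<in>{..<n} \<times> {..<n}. cmod (c i j))"
        by (rule sum.cartesian_product)
      also have "\<dots> = (\<Sum>p\<in>{..<n} \<times> {..<n}. cmod (c (fst p) (snd p)))"
        by (simp add: case_prod_beta)
      also have "\<dots> \<le> sqrt (real (card ({..<n} \<times> {..<n}))) * sqrt (\<Sum>p\<in>{..<n} \<times> {..<n}. (cmod (c (fst p) (snd p)))\<^sup>2)"
        by (rule sum_le_sqrt_sum_squares)
      also have "(\<Sum>p\<in>{..<n} \<times> {..<n}. (cmod (c (fst p) (snd p)))\<^sup>2) = (\<Sum>i<n. \<Sum>j<n. (cmod (c i j))\<^sup>2)"
        by (simp add: sum.cartesian_product case_prod_beta)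
      also have "sqrt (real (card ({..<n} \<times> {..<n}))) = real n" by simp
      also have "real n * sqrt (\<Sum>i<n. \<Sum>j<n. (cmod (c i j))\<^sup>2) \<le> real n * sqrt ((real n)\<^sup>2 * (4 * \<eta>))"
        using sq by (intro mult_left_mono real_sqrt_le_mono) auto
      also have "\<dots> = (real n)\<^sup>2 * (2 * sqrt \<eta>)"
        by (simp add: real_sqrt_mult power2_eq_square)
      finally show ?case .
    qed
  qed
  then show ?thesis using that[OF g h_def h2 Re_fh] unfolding c_def by blast
qed

text \<open>The sets \<open>A j\<close> are common to all times \<open>i < n\<close>; only the
  coefficients change. So the approximants lie in one space of dimension at most \<open>K\<close>.
  The sets may depend on \<open>n\<close>, but \<open>K\<close> is a parameter and can be held
  fixed. The bound 1 on the coefficients allows them to be dropped in correlation estimates.\<close>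

definition orbit_near_steps :: "('a \<Rightarrow> complex) \<Rightarrow> real \<Rightarrow> nat \<Rightarrow> nat \<Rightarrow> bool" where
  "orbit_near_steps f \<kappa> K n \<longleftrightarrow>
    (\<exists>A \<theta>. (\<forall>j<K. A j \<in> sets M) \<and> (\<forall>i j. \<bar>\<theta> i j :: real\<bar> \<le> 1) \<and>
      (\<Sum>i<n. (L2_seminorm M (\<lambda>x. f ((T ^^ i) x) - (\<Sum>j<K. of_real (\<theta> i j) * indicator (A j) x)))\<^sup>2) \<le> \<kappa> * real n)"

text \<open>If the orbit of \<open>f\<close> is, on average, close to step functions with a bounded number of steps,
  then it is close to finite-dimensional spaces of bounded dimension. The orbit of the residual \<open>h\<close>
  is asymptotically almost orthogonal to any such space, which forces \<open>h\<close> to be small.\<close>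

lemma span_dense_if_orbit_steps:
  assumes f: "f \<in> L2_functions M" and f1: "L2_seminorm M f \<le> 1"
    and steps: "\<And>\<kappa>. \<kappa> > 0 \<Longrightarrow> \<exists>K. \<forall>n\<ge>1. orbit_near_steps f \<kappa> K n"
    and \<epsilon>: "\<epsilon> > 0"
  shows "\<exists>g\<in>eigen_span. L2_seminorm M (\<lambda>x. f x - g x) < \<epsilon>"
proof -
  \<comment> \<open>Chosen so that the error of the step functions, after Cauchy-Schwarz over time
    and multiplication by the bound 2 on the norm of \<open>h\<close>, amounts to
    \<open>\<epsilon>\<^sup>2 / 4\<close> per unit of time.\<close>
  define \<kappa> where "\<kappa> = (\<epsilon>\<^sup>2 / 8)\<^sup>2"
  have "\<kappa> > 0" using \<epsilon> by (simp add: \<kappa>_def)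
  from steps[OF this] obtain K where K: "\<And>n. n \<ge> 1 \<Longrightarrow> orbit_near_steps f \<kappa> K n" by blast
  \<comment> \<open>The remaining errors are \<open>5 * v\<^sup>2\<close> from near-minimality and
    \<open>2 * real K * v\<close> from the \<open>K\<close> sets. Since \<open>v \<le> 1\<close>,
    both together are at most \<open>(5 + 2 * real K) * v\<close>.\<close>
  define v where "v = min 1 (\<epsilon>\<^sup>2 / (4 * (5 + 2 * real K)))"
  have v: "0 < v" "v \<le> 1" using \<epsilon> by (auto simp: v_def)
  have v_small: "(5 + 2 * real K) * v \<le> \<epsilon>\<^sup>2 / 4"
  proof -
    have "(5 + 2 * real K) * v \<le> (5 + 2 * real K) * (\<epsilon>\<^sup>2 / (4 * (5 + 2 * real K)))"
      by (intro mult_left_mono) (auto simp: v_def)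
    also have "\<dots> = \<epsilon>\<^sup>2 / 4"
    proof -
      have "5 + 2 * real K \<noteq> 0" using of_nat_0_le_iff[of K] by linarith
      then show ?thesis by (simp add: field_simps)
    qed
    finally show ?thesis .
  qed
  \<comment> \<open>A fourth power, because two square roots are taken: \<open>sqrt \<eta>\<close>
    enters the bound on the correlations, and norms are roots of sums of correlations.\<close>
  define \<eta> where "\<eta> = (v\<^sup>2)\<^sup>2"
  have \<eta>: "0 < \<eta>" "\<eta> \<le> 1" using v by (auto simp: \<eta>_def power_le_one)
  have sqrt_\<eta>: "sqrt \<eta> = v\<^sup>2" unfolding \<eta>_def by (rule real_sqrt_unique) simp_all
  obtain g h where g: "g \<in> eigen_span" and h_def: "h = (\<lambda>x. f x - g x)" and h2: "L2_seminorm M h \<le> 2"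
    and Re_fh: "(L2_seminorm M h)\<^sup>2 - 5 * sqrt \<eta> \<le> Re (L2_inner M f h)"
    and ev: "eventually (\<lambda>n. (\<Sum>i<n. \<Sum>j<n. cmod (L2_inner M (\<lambda>x. h ((T ^^ i) x)) (\<lambda>x. h ((T ^^ j) x))))
       \<le> (real n)\<^sup>2 * (2 * sqrt \<eta>)) sequentially"
    using near_minimiser[OF f f1 \<eta>] by blast
  have h: "h \<in> L2_functions M" unfolding h_def by (rule L2_diff[OF f eigen_span_L2[OF g]])
  obtain n where n: "n \<ge> 1" and corr: "(\<Sum>i<n. \<Sum>j<n. cmod (L2_inner M (\<lambda>x. h ((T ^^ i) x)) (\<lambda>x. h ((T ^^ j) x))))
       \<le> (real n)\<^sup>2 * (2 * sqrt \<eta>)"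
    using eventually_happens[OF eventually_conj[OF ev eventually_ge_at_top[of 1]]] by auto
  obtain A \<theta> where A: "\<And>j. j < K \<Longrightarrow> A j \<in> sets M" and \<theta>: "\<And>i j. \<bar>\<theta> i j :: real\<bar> \<le> 1" and
    close: "(\<Sum>i<n. (L2_seminorm M (\<lambda>x. f ((T ^^ i) x) - (\<Sum>j<K. of_real (\<theta> i j) * indicator (A j) x)))\<^sup>2) \<le> \<kappa> * real n"
    using K[OF n] unfolding orbit_near_steps_def by blast
  define p where "p i = (\<lambda>x. \<Sum>j<K. complex_of_real (\<theta> i j) * indicator (A j) x)" for i
  define b where "b i = (\<lambda>x. h ((T ^^ i) x))" for i
  define a where "a i = (\<lambda>x. f ((T ^^ i) x))" for i
  have b: "b i \<in> L2_functions M" for i unfolding b_def by (rule L2_funpow[OF h])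
  have a: "a i \<in> L2_functions M" for i unfolding a_def by (rule L2_funpow[OF f])
  have ind: "indicator (A j) \<in> L2_functions M" and ind_norm: "L2_seminorm M (indicator (A j)) \<le> 1" if "j < K" for j
    using L2_indicator[OF A[OF that]] by blast+
  have p: "p i \<in> L2_functions M" for i unfolding p_def by (intro L2_sum L2_scale ind) simp
  have norm_b: "L2_seminorm M (b i) = L2_seminorm M h" for i
    unfolding b_def by (rule L2_seminorm_funpow[OF h])
  \<comment> \<open>By invariance the inner product of \<open>f\<close> and \<open>h\<close> is the
    same at all times of the orbit. Its \<open>n\<close> copies are split into approximation error
    and step function.\<close>
  have fh: "of_nat n * L2_inner M f h = (\<Sum>i<n. L2_inner M (\<lambda>x. a i x - p i x) (b i)) + (\<Sum>i<n. L2_inner M (p i) (b i))"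
  proof -
    have "L2_inner M (\<lambda>x. a i x - p i x) (b i) + L2_inner M (p i) (b i) = L2_inner M f h" for i
      using L2_inner_funpow[OF f h, of i] by (simp add: L2_inner_diff_left a p b) (simp add: a_def b_def)
    then show ?thesis by (simp add: sum.distrib[symmetric])
  qed
  have first: "cmod (\<Sum>i<n. L2_inner M (\<lambda>x. a i x - p i x) (b i)) \<le> real n * (\<epsilon>\<^sup>2 / 4)"
  proof -
    have "cmod (\<Sum>i<n. L2_inner M (\<lambda>x. a i x - p i x) (b i)) \<le> (\<Sum>i<n. L2_seminorm M (\<lambda>x. a i x - p i x) * 2)"
    proof (rule sum_norm_le)
      fix i
      have "cmod (L2_inner M (\<lambda>x. a i x - p i x) (b i)) \<le> L2_seminorm M (\<lambda>x. a i x - p i x) * L2_seminorm M (b i)"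
        by (rule L2_cauchy_schwarz[OF L2_diff[OF a p] b])
      also have "\<dots> \<le> L2_seminorm M (\<lambda>x. a i x - p i x) * 2"
        using h2 by (intro mult_left_mono) (auto simp: norm_b)
      finally show "cmod (L2_inner M (\<lambda>x. a i x - p i x) (b i)) \<le> L2_seminorm M (\<lambda>x. a i x - p i x) * 2" .
    qed
    also have "\<dots> = (\<Sum>i<n. L2_seminorm M (\<lambda>x. a i x - p i x)) * 2" by (rule sum_distrib_right[symmetric])
    also have "(\<Sum>i<n. L2_seminorm M (\<lambda>x. a i x - p i x)) \<le> sqrt (real n) * sqrt (\<Sum>i<n. (L2_seminorm M (\<lambda>x. a i x - p i x))\<^sup>2)"
      using sum_le_sqrt_sum_squares[of "\<lambda>i. L2_seminorm M (\<lambda>x. a i x - p i x)" "{..<n}"] by simp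
    also have "\<dots> \<le> sqrt (real n) * sqrt (\<kappa> * real n)"
      using close by (intro mult_left_mono real_sqrt_le_mono) (auto simp: a_def p_def)
    also have "\<dots> = real n * (\<epsilon>\<^sup>2 / 8)"
      by (simp add: real_sqrt_mult \<kappa>_def)
    finally show ?thesis by simp
  qed
  have second: "cmod (\<Sum>i<n. L2_inner M (p i) (b i)) \<le> real n * (2 * real K * v)"
  proof -
    \<comment> \<open>Exchanging the sums over times and cells collects, for each cell, one weighted
      sum of the orbit of \<open>h\<close>. Its squared norm is at most the sum of all moduli of
      correlations, whatever the weights bounded by 1.\<close>
    define B where "B j = (\<lambda>x. \<Sum>i<n. complex_of_real (\<theta> i j) * b i x)" for j
    have B: "B j \<in> L2_functions M" for j unfolding B_def by (intro L2_sum L2_scale b)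
    have norm_B: "L2_seminorm M (B j) \<le> real n * (2 * v)" for j
    proof -
      have "complex_of_real ((L2_seminorm M (B j))\<^sup>2) = (\<Sum>i<n. \<Sum>k<n. of_real (\<theta> i j) * cnj (of_real (\<theta> k j)) * L2_inner M (b i) (b k))"
        unfolding L2_inner_self[symmetric] B_def b_def by (rule L2_inner_orbit_sum[OF h])
      then have "(L2_seminorm M (B j))\<^sup>2 = cmod (\<Sum>i<n. \<Sum>k<n. of_real (\<theta> i j) * cnj (of_real (\<theta> k j)) * L2_inner M (b i) (b k))"
        by (metis norm_of_real abs_of_nonneg zero_le_power2)
      also have "\<dots> \<le> (\<Sum>i<n. \<Sum>k<n. cmod (L2_inner M (b i) (b k)))"
      proof (intro sum_norm_le)
        fix i k
        have "\<bar>\<theta> i j\<bar> * \<bar>\<theta> k j\<bar> * cmod (L2_inner M (b i) (b k)) \<le> 1 * 1 * cmod (L2_inner M (b i) (b k))"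
          using \<theta> by (intro mult_mono) auto
        then show "cmod (of_real (\<theta> i j) * cnj (of_real (\<theta> k j)) * L2_inner M (b i) (b k)) \<le> cmod (L2_inner M (b i) (b k))"
          by (simp add: norm_mult)
      qed
      also have "\<dots> \<le> (real n)\<^sup>2 * (2 * v\<^sup>2)" using corr by (simp add: b_def sqrt_\<eta>)
      also have "\<dots> \<le> (real n)\<^sup>2 * (4 * v\<^sup>2)" by (intro mult_left_mono) auto
      also have "\<dots> = (real n * (2 * v))\<^sup>2" by (simp add: power_mult_distrib)
      finally have "(L2_seminorm M (B j))\<^sup>2 \<le> (real n * (2 * v))\<^sup>2" .
      then show ?thesis by (rule power2_le_imp_le) (use v in simp)
    qed
    have "(\<Sum>i<n. L2_inner M (p i) (b i)) = (\<Sum>i<n. \<Sum>j<K. of_real (\<theta> i j) * L2_inner M (indicator (A j)) (b i))"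
      unfolding p_def by (intro sum.cong refl L2_inner_sum_left ind b) simp
    also have "\<dots> = (\<Sum>j<K. \<Sum>i<n. of_real (\<theta> i j) * L2_inner M (indicator (A j)) (b i))"
      by (rule sum.swap)
    also have "\<dots> = (\<Sum>j<K. L2_inner M (indicator (A j)) (B j))"
    proof (intro sum.cong refl)
      fix j assume "j \<in> {..<K}"
      then show "(\<Sum>i<n. of_real (\<theta> i j) * L2_inner M (indicator (A j)) (b i)) = L2_inner M (indicator (A j)) (B j)"
        unfolding B_def by (subst L2_inner_sum_right) (auto intro: b ind)
    qed
    also have "cmod \<dots> \<le> (\<Sum>j<K. real n * (2 * v))"
    proof (rule sum_norm_le)
      fix j assume "j \<in> {..<K}"
      then have j: "j < K" by simp
      have "cmod (L2_inner M (indicator (A j)) (B j)) \<le> L2_seminorm M (indicator (A j)) * L2_seminorm M (B j)"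
        by (rule L2_cauchy_schwarz[OF ind[OF j] B])
      also have "\<dots> \<le> 1 * (real n * (2 * v))"
        using ind_norm[OF j] norm_B by (intro mult_mono) auto
      finally show "cmod (L2_inner M (indicator (A j)) (B j)) \<le> real n * (2 * v)" by simp
    qed
    finally show ?thesis by (simp add: mult_ac)
  qed
  have "real n * ((L2_seminorm M h)\<^sup>2 - 5 * v\<^sup>2) \<le> real n * Re (L2_inner M f h)"
    using Re_fh by (intro mult_left_mono) (auto simp: sqrt_\<eta>)
  also have "\<dots> = Re (of_nat n * L2_inner M f h)" by simp
  also have "\<dots> \<le> cmod (of_nat n * L2_inner M f h)" by (rule complex_Re_le_cmod)
  also have "\<dots> \<le> real n * (\<epsilon>\<^sup>2 / 4) + real n * (2 * real K * v)"
    unfolding fh by (rule norm_triangle_le[OF add_mono[OF first second]])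
  also have "\<dots> = real n * (\<epsilon>\<^sup>2 / 4 + 2 * real K * v)" by (simp add: distrib_left)
  finally have "(L2_seminorm M h)\<^sup>2 - 5 * v\<^sup>2 \<le> \<epsilon>\<^sup>2 / 4 + 2 * real K * v"
    using n by (simp add: mult_le_cancel_left)
  moreover have "5 * v\<^sup>2 \<le> 5 * v" using v by (simp add: power2_eq_square mult_le_one mult_left_le)
  ultimately have "(L2_seminorm M h)\<^sup>2 \<le> \<epsilon>\<^sup>2 / 4 + (5 + 2 * real K) * v"
    by (simp add: distrib_right)
  also have "\<dots> \<le> \<epsilon>\<^sup>2 / 4 + \<epsilon>\<^sup>2 / 4" using v_small by simp
  also have "\<dots> < \<epsilon>\<^sup>2" using \<epsilon> by simp
  finally have "L2_seminorm M h < \<epsilon>" using \<epsilon> by (rule power2_less_imp_less[OF _ less_imp_le])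
  then show ?thesis using g h_def by blast
qed

end

section \<open>Admissible semimetrics on Lebesgue spaces\<close>

lemma (in complete_measure) borel_measurable_AE_eq:
  fixes f g :: "'a \<Rightarrow> real"
  assumes g: "g \<in> borel_measurable M" and eq: "AE x in M. f x = g x"
  shows "f \<in> borel_measurable M"
proof (rule measurableI)
  fix U :: "real set" assume U: "U \<in> sets borel"
  show "f -` U \<inter> space M \<in> sets M"
  proof (rule in_sets_AE)
    show "g -` U \<inter> space M \<in> sets M" using g U by (rule measurable_sets)
    show "AE x in M. x \<in> g -` U \<inter> space M \<longleftrightarrow> x \<in> f -` U \<inter> space M"
      using eq by eventually_elim auto
  qed auto
qed simp

lemma semimetric_onD:
  assumes "semimetric_on X \<rho>"
  shows "x \<in> X \<Longrightarrow> y \<in> X \<Longrightarrow> 0 \<le> \<rho> x y" "x \<in> X \<Longrightarrow> \<rho> x x = 0"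
    "x \<in> X \<Longrightarrow> y \<in> X \<Longrightarrow> \<rho> x y = \<rho> y x"
    "x \<in> X \<Longrightarrow> y \<in> X \<Longrightarrow> z \<in> X \<Longrightarrow> \<rho> x z \<le> \<rho> x y + \<rho> y z"
  using assms unfolding semimetric_on_def by blast+

lemma AE_obtain_null_set:
  assumes "AE x in M. P x"
  obtains N where "N \<in> null_sets M" "\<And>x. x \<in> space M - N \<Longrightarrow> P x"
  using assms unfolding eventually_ae_filter by blast

text \<open>\<open>\<rho>\<close> is measurable for the completed product only, while Fubini's
  theorem is applied to \<open>M \<Otimes>\<^sub>M M\<close>. So \<open>\<rho>\<close> is replaced
  by a product-measurable version; almost every section agrees with it almost everywhere, and
  completeness of \<open>M\<close> returns measurability to the section of
  \<open>\<rho>\<close>.\<close>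

lemma AE_integrable_section:
  assumes M: "prob_space M" "complete_measure M"
    and adm: "admissible M \<rho>" and int: "integrable (square_space M) (\<lambda>(x, y). \<rho> x y)"
  shows "AE x in M. integrable M (\<lambda>y. \<rho> y x)"
proof -
  interpret prob_space M by fact
  interpret complete_measure M by fact
  interpret pair_sigma_finite M M ..
  let ?f = "\<lambda>(x, y). \<rho> x y"
  have sm: "semimetric_on (space M) \<rho>" using adm by (simp add: admissible_def)
  have "?f \<in> borel_measurable (square_space M)" using int by (rule borel_measurable_integrable)
  from completion_ex_borel_measurable_real[OF this] obtain g where
    g: "g \<in> borel_measurable (M \<Otimes>\<^sub>M M)" and eq: "AE p in M \<Otimes>\<^sub>M M. ?f p = g p" by blast
  have "integrable (square_space M) g"
    by (rule Bochner_Integration.integrable_cong_AE_imp[OF int])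
      (use g eq in \<open>auto intro: measurable_completion AE_completion\<close>)
  then have "integrable (M \<Otimes>\<^sub>M M) g" using integrable_completion[OF g] by simp
  then have "AE x in M. integrable M (\<lambda>y. g (x, y))" by (rule AE_integrable_fst')
  moreover have "AE x in M. AE y in M. ?f (x, y) = g (x, y)" using AE_pair[OF eq] .
  ultimately show ?thesis using AE_space
  proof eventually_elim
    case (elim x)
    have ae: "AE y in M. \<rho> y x = g (x, y)"
      using elim(2) AE_space by eventually_elim (use elim(3) semimetric_onD(3)[OF sm, of x] in auto)
    have "(\<lambda>y. g (x, y)) \<in> borel_measurable M" using elim(1) by (rule borel_measurable_integrable)
    from borel_measurable_AE_eq[OF this ae] show ?case
      using ae by (intro Bochner_Integration.integrable_cong_AE_imp[OF elim(1)]) auto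
  qed
qed

text \<open>A countable dense set may consist entirely of exceptional points at which the section is
  not integrable. Each of its points is therefore replaced, for every radius
  \<open>1 / real (Suc n)\<close>, by a good point within that radius, if there is one.\<close>

lemma admissible_dense_sequence:
  assumes M: "prob_space M" "complete_measure M"
    and adm: "admissible M \<rho>" and int: "integrable (square_space M) (\<lambda>(x, y). \<rho> x y)"
  obtains d :: "nat \<Rightarrow> 'a" and N where "N \<in> null_sets M" "\<And>i. d i \<in> space M"
    "\<And>i. integrable M (\<lambda>x. \<rho> x (d i))" "\<And>x e. x \<in> space M - N \<Longrightarrow> e > 0 \<Longrightarrow> \<exists>i. \<rho> x (d i) < e"
proof -
  interpret prob_space M by fact
  have sm: "semimetric_on (space M) \<rho>" using adm by (simp add: admissible_def)
  obtain X where X: "X \<in> sets M" "emeasure M (space M - X) = 0" "separable_on X \<rho>"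
    using adm by (auto simp: admissible_def)
  have "AE x in M. x \<in> X" using X by (intro AE_I[of _ _ "space M - X"]) auto
  with AE_integrable_section[OF M adm int] have "AE x in M. integrable M (\<lambda>y. \<rho> y x) \<and> x \<in> X"
    by eventually_elim simp
  then obtain N where N: "N \<in> null_sets M" and good: "\<And>x. x \<in> space M - N \<Longrightarrow> integrable M (\<lambda>y. \<rho> y x) \<and> x \<in> X"
    by (rule AE_obtain_null_set) blast
  have "space M - N \<noteq> {}"
  proof
    assume "space M - N = {}"
    then have "space M \<subseteq> N" by blast
    then have "emeasure M (space M) \<le> emeasure M N" using N by (intro emeasure_mono) auto
    then show False using N by (simp add: emeasure_space_1 null_setsD1)
  qed
  then obtain x0 where x0: "x0 \<in> space M - N" by blast
  obtain D where D: "countable D" "D \<subseteq> X" "\<And>x e. x \<in> X \<Longrightarrow> e > 0 \<Longrightarrow> \<exists>d\<in>D. \<rho> x d < e"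
    using X(3) by (auto simp: separable_on_def)
  define P where "P p x \<longleftrightarrow> x \<in> space M - N \<and> \<rho> x (fst p) < 1 / real (Suc (snd p))" for p x
  \<comment> \<open>The default \<open>x0\<close> serves balls without good points. Such balls do no
    harm: a good \<open>x\<close> close to a centre is itself a witness that the ball in question
    contains one.\<close>
  define pick where "pick p = (if \<exists>x. P p x then SOME x. P p x else x0)" for p
  have P_pick: "P p (pick p)" if "P p x" for p x
    using someI[of "P p", OF that] that by (auto simp: pick_def)
  have pick: "pick p \<in> space M - N" for p
  proof (cases "\<exists>x. P p x")
    case True
    then have "P p (pick p)" using P_pick by blast
    then show ?thesis by (simp add: P_def)
  next
    case False
    then show ?thesis using x0 by (auto simp: pick_def)
  qed
  define d where "d i = from_nat_into (insert x0 (pick ` (D \<times> UNIV))) i" for i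
  have range_d: "range d = insert x0 (pick ` (D \<times> UNIV))"
    unfolding d_def[abs_def] using D(1) by (intro range_from_nat_into) auto
  have d: "d i \<in> space M - N" for i using range_d pick x0 by (metis imageE insertE rangeI)
  show ?thesis
  proof (rule that[OF N])
    show "d i \<in> space M" for i using d by blast
    show "integrable M (\<lambda>x. \<rho> x (d i))" for i using good[OF d] by blast
    fix x and e :: real assume x: "x \<in> space M - N" and e: "e > 0"
    obtain n where n: "1 / real (Suc n) < e / 2" using e nat_approx_posE[of "e / 2"] by auto
    obtain b where b: "b \<in> D" "\<rho> x b < 1 / real (Suc n)"
      using D(3)[of x "1 / real (Suc n)"] good[OF x] by auto
    have "P (b, n) x" using x b by (simp add: P_def)
    from P_pick[OF this] have *: "\<rho> (pick (b, n)) b < 1 / real (Suc n)" by (simp add: P_def)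
    have bS: "b \<in> space M" using b D(2) X(1) sets.sets_into_space by blast
    have pS: "pick (b, n) \<in> space M" "x \<in> space M" using pick x by auto
    have "\<rho> x (pick (b, n)) \<le> \<rho> x b + \<rho> (pick (b, n)) b"
      using semimetric_onD(4)[OF sm pS(2) bS pS(1)] semimetric_onD(3)[OF sm bS pS(1)] by simp
    then have "\<rho> x (pick (b, n)) < e" using * b(2) n by simp
    moreover have "pick (b, n) \<in> range d" using range_d b by auto
    ultimately show "\<exists>i. \<rho> x (d i) < e" by auto
  qed
qed

text \<open>Inner regularity of a finite Borel measure on the line, pulled back along the
  isomorphism. The compact sets lie in the image of \<open>E - A\<close>, so that by injectivity
  their preimages lie in \<open>E\<close>.\<close>

lemma lebesgue_compact_approximation:
  assumes "lebesgue_prob_space M"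
  obtains \<phi> :: "'a \<Rightarrow> real" and A where "A \<in> null_sets M" "inj_on \<phi> (space M - A)"
    "\<And>U. U \<in> sets borel \<Longrightarrow> {x \<in> space M - A. \<phi> x \<in> U} \<in> sets M"
    "\<And>E e. E \<in> sets M \<Longrightarrow> e > 0 \<Longrightarrow> \<exists>C. compact C \<and> C \<subseteq> \<phi> ` (E - A) \<and>
       measure M (E - {x \<in> space M - A. \<phi> x \<in> C}) < e"
proof -
  obtain c p N where N: "interval_with_atoms c p N" and iso: "iso_mod_0 M (completion N)"
    using assms by (auto simp: lebesgue_prob_space_def)
  interpret prob_space M using assms by (simp add: lebesgue_prob_space_def)
  have sN: "sets N = sets borel" using N by (simp add: interval_with_atoms_def)
  then have spN: "space N = UNIV" using sets_eq_imp_space_eq[OF sN] by simp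
  obtain A B \<phi> where A: "A \<in> null_sets M" and B: "B \<in> null_sets (completion N)"
    and bij: "bij_betw \<phi> (space M - A) (UNIV - B)"
    and meas: "\<And>E. E \<subseteq> space M - A \<Longrightarrow> E \<in> sets M \<longleftrightarrow> \<phi> ` E \<in> sets (completion N)"
    and emeas: "\<And>E. E \<subseteq> space M - A \<Longrightarrow> E \<in> sets M \<Longrightarrow> emeasure (completion N) (\<phi> ` E) = emeasure M E"
    using iso unfolding iso_mod_0_def by (auto simp: spN)
  have inj: "inj_on \<phi> (space M - A)" and img: "\<phi> ` (space M - A) = UNIV - B"
    using bij by (auto simp: bij_betw_def)
  \<comment> \<open>The isomorphism is described through images. The image of the preimage of
    \<open>U\<close> is \<open>U - B\<close>, which is measurable in the completion.\<close>
  have pre: "{x \<in> space M - A. \<phi> x \<in> U} \<in> sets M" if U: "U \<in> sets borel" for U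
  proof -
    have "\<phi> ` {x \<in> space M - A. \<phi> x \<in> U} = \<phi> ` (space M - A) \<inter> U" by auto
    also have "\<dots> = U - B" unfolding img by auto
    finally have "\<phi> ` {x \<in> space M - A. \<phi> x \<in> U} = U - B" .
    moreover have "U \<in> sets (completion N)" using U sN by (intro sets_completionI_sets) simp
    ultimately have "\<phi> ` {x \<in> space M - A. \<phi> x \<in> U} \<in> sets (completion N)" using B by auto
    moreover have "{x \<in> space M - A. \<phi> x \<in> U} \<subseteq> space M - A" by blast
    ultimately show ?thesis using meas by blast
  qed
  have "emeasure N UNIV = 1"
  proof -
    have "emeasure M (space M - A) = 1"
      using emeasure_Diff_null_set[OF A, of "space M"] by (simp add: emeasure_space_1)
    then have "emeasure (completion N) (UNIV - B) = 1"
      using emeas[of "space M - A"] A img by auto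
    moreover have "emeasure (completion N) (UNIV - B) = emeasure (completion N) UNIV"
      using emeasure_Diff_null_set[OF B, of UNIV] sets.top[of "completion N"] by (simp add: spN)
    ultimately show ?thesis using emeasure_completion[of UNIV N] sets.top[of N] by (simp add: spN)
  qed
  then have fin: "emeasure N (space N) \<noteq> \<infinity>" by (simp add: spN)
  interpret N: finite_measure N using fin by (intro finite_measureI) simp
  have approx: "\<exists>C. compact C \<and> C \<subseteq> \<phi> ` (E - A) \<and> measure M (E - {x \<in> space M - A. \<phi> x \<in> C}) < e"
    if E: "E \<in> sets M" and e: "e > 0" for E e
  proof -
    define E' where "E' = E - A"
    have E': "E' \<in> sets M" "E' \<subseteq> space M - A" using E A sets.sets_into_space[OF E] by (auto simp: E'_def)
    define Y where "Y = \<phi> ` E'"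
    have Y: "Y \<in> sets (completion N)" using meas[OF E'(2)] E'(1) by (simp add: Y_def)
    \<comment> \<open>\<open>Y\<close> is measurable for the completion only. Its main part is a
      subset of the same measure that is Borel, as inner regularity demands.\<close>
    define S where "S = main_part N Y"
    have "S \<in> sets N" using Y by (simp add: S_def)
    moreover have "S \<subseteq> Y" unfolding S_def by (metis Un_upper1 main_part_null_part_Un[OF Y])
    ultimately have S: "S \<in> sets N" "S \<subseteq> Y" by blast+
    have eS: "emeasure N S = emeasure M E'"
      using emeas[OF E'(2,1)] emeasure_completion[OF Y] by (simp add: Y_def S_def)
    have "\<exists>C. compact C \<and> C \<subseteq> S \<and> measure N S - e < measure N C"
    \<comment> \<open>For a small \<open>S\<close> the empty compact set suffices; otherwise
      \<open>measure N S - e\<close> is nonnegative and may pass through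
      \<open>ennreal\<close>.\<close>
    proof (cases "measure N S < e")
      case True
      then show ?thesis by (intro exI[of _ "{}"]) simp
    next
      case False
      have "ennreal (measure N S - e) < emeasure N S"
        using False e by (simp add: N.emeasure_eq_measure ennreal_lessI)
      also have "emeasure N S = (SUP K\<in>{K. K \<subseteq> S \<and> compact K}. emeasure N K)"
        using S(1) sN by (intro inner_regular[OF sN fin]) simp
      finally obtain C where C: "C \<subseteq> S" "compact C" "ennreal (measure N S - e) < emeasure N C"
        by (auto simp: less_SUP_iff)
      then have "measure N S - e < measure N C"
        using False by (simp add: N.emeasure_eq_measure ennreal_less_iff)
      then show ?thesis using C by blast
    qed
    then obtain C where C: "compact C" "C \<subseteq> S" "measure N S - e < measure N C" by blast
    define E'' where "E'' = {x \<in> space M - A. \<phi> x \<in> C}"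
    have C_borel: "C \<in> sets borel" using C(1) by (intro borel_closed compact_imp_closed)
    have E'': "E'' \<in> sets M" "E'' \<subseteq> space M - A" unfolding E''_def using pre[OF C_borel] by auto
    have CY: "C \<subseteq> \<phi> ` E'" using C(2) S(2) by (auto simp: Y_def)
    have sub: "E'' \<subseteq> E'"
    proof
      fix x assume x: "x \<in> E''"
      then obtain y where "y \<in> E'" "\<phi> x = \<phi> y" using CY by (auto simp: E''_def)
      then show "x \<in> E'" using inj_onD[OF inj, of x y] x E'(2) E''(2) by auto
    qed
    have "\<phi> ` E'' = C" using CY E'(2) by (auto simp: E''_def)
    then have "emeasure M E'' = emeasure (completion N) C" using emeas[OF E''(2,1)] by simp
    also have "\<dots> = emeasure N C" using C_borel sN by simp
    finally have "measure M E'' = measure N C" by (simp add: measure_def)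
    moreover have "measure M E' = measure N S" using eS by (simp add: measure_def)
    moreover have "measure M (E - E'') = measure M (E' - E'')"
    proof (rule measure_eq_AE)
      have "AE x in M. x \<notin> A" using A by (rule AE_not_in)
      then show "AE x in M. x \<in> E - E'' \<longleftrightarrow> x \<in> E' - E''" by eventually_elim (auto simp: E'_def)
    qed (use E E' E'' in auto)
    moreover have "measure M (E' - E'') = measure M E' - measure M E''"
      using sub E' E'' by (intro finite_measure_Diff)
    ultimately have "measure M (E - E'') < e" using C(3) by simp
    then show ?thesis using C(1) CY by (auto simp: E''_def E'_def)
  qed
  show ?thesis by (rule that[OF A inj pre approx])
qed

lemma (in prob_space) geometric_null_union:
  fixes Z :: "nat \<Rightarrow> 'a set"
  assumes Z: "\<And>n. Z n \<in> sets M" and le: "\<And>n. measure M (Z n) \<le> e * (1 / 2) ^ Suc n"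
  shows "measure M (\<Union>n. Z n) \<le> e"
proof -
  have s: "(\<lambda>n. e * (1 / 2) ^ Suc n) sums (e * 1)" by (intro sums_mult power_half_series)
  have summ: "summable (\<lambda>n. measure M (Z n))"
    by (rule summable_comparison_test'[OF sums_summable[OF s], of 0]) (use le in simp)
  have "measure M (\<Union>n. Z n) \<le> (\<Sum>n. measure M (Z n))"
    using Z summ by (intro finite_measure_subadditive_countably) auto
  also have "\<dots> \<le> (\<Sum>n. e * (1 / 2) ^ Suc n)" by (rule suminf_le[OF le summ sums_summable[OF s]])
  also have "\<dots> = e" using sums_unique[OF s] by simp
  finally show ?thesis .
qed

text \<open>On a large
  compact set \<open>K\<close> of the model space, the traces of the countably many sets below and of their
  complements are compact; so membership in them is locally constant, and the metric is bounded below
  along convergent sequences with distinct limits.\<close>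

lemma metric_separation:
  assumes M: "lebesgue_prob_space M" and adm: "admissible M \<rho>"
    and int: "integrable (square_space M) (\<lambda>(x, y). \<rho> x y)"
    and metric: "metric_on (space M) \<rho>" and B: "B \<in> sets M" and \<epsilon>: "\<epsilon> > 0"
  shows "\<exists>\<delta>>0. \<exists>Z\<in>sets M. measure M Z < \<epsilon> \<and> (\<forall>x\<in>space M - Z. \<forall>y\<in>space M - Z. x \<in> B \<longrightarrow> y \<notin> B \<longrightarrow> \<delta> \<le> \<rho> x y)"
proof -
  have M': "prob_space M" "complete_measure M" using M by (auto simp: lebesgue_prob_space_def)
  interpret prob_space M by fact
  have sm: "semimetric_on (space M) \<rho>" using metric by (simp add: metric_on_def)
  note sym = semimetric_onD(3)[OF sm] and tri = semimetric_onD(4)[OF sm]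
  obtain d :: "nat \<Rightarrow> 'a" and N where N: "N \<in> null_sets M" and d: "\<And>i. d i \<in> space M"
    and int_d: "\<And>i. integrable M (\<lambda>x. \<rho> x (d i))"
    and dense: "\<And>x e. x \<in> space M - N \<Longrightarrow> e > 0 \<Longrightarrow> \<exists>i. \<rho> x (d i) < e"
    by (rule admissible_dense_sequence[OF M' adm int]) blast
  obtain \<phi> :: "'a \<Rightarrow> real" and A where A: "A \<in> null_sets M" and inj: "inj_on \<phi> (space M - A)"
    and pre: "\<And>U. U \<in> sets borel \<Longrightarrow> {x \<in> space M - A. \<phi> x \<in> U} \<in> sets M"
    and approx: "\<And>E e. E \<in> sets M \<Longrightarrow> e > 0 \<Longrightarrow> \<exists>C. compact C \<and> C \<subseteq> \<phi> ` (E - A) \<and>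
       measure M (E - {x \<in> space M - A. \<phi> x \<in> C}) < e"
    by (rule lebesgue_compact_approximation[OF M]) blast
  define q :: "nat \<Rightarrow> real" where "q = from_nat_into \<rat>"
  have range_q: "range q = \<rat>"
    unfolding q_def by (rule range_from_nat_into) (auto simp: countable_rat)
  \<comment> \<open>Index 0 holds \<open>B\<close>. The other indices enumerate the balls with
    rational radius around the points \<open>d i\<close>, which are enough to recover
    distances.\<close>
  define F where "F n = (case n of 0 \<Rightarrow> B | Suc m \<Rightarrow>
    {x \<in> space M. \<rho> x (d (fst (prod_decode m))) < q (snd (prod_decode m))})" for n
  have [measurable]: "(\<lambda>x. \<rho> x (d i)) \<in> borel_measurable M" for i using int_d by auto
  have F: "F n \<in> sets M" for n
    unfolding F_def using B by (cases n) auto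
  \<comment> \<open>For each \<open>n\<close> two compact sets are chosen, one for
    \<open>F n\<close> and one for its complement. The losses of both, summed over \<open>n\<close>,
    amount to at most \<open>\<epsilon> / 2\<close>, leaving room for the strict inequality.\<close>
  define e where "e n = \<epsilon> / 4 * (1 / 2) ^ Suc n" for n
  have e: "e n > 0" for n using \<epsilon> by (simp add: e_def)
  have FN: "F n - N \<in> sets M" "(space M - F n) - N \<in> sets M" for n using F N by auto
  have "\<forall>n. \<exists>C. compact C \<and> C \<subseteq> \<phi> ` ((F n - N) - A) \<and> measure M ((F n - N) - {x \<in> space M - A. \<phi> x \<in> C}) < e n"
    using approx[OF FN(1) e] by blast
  from choice[OF this] obtain C where C: "\<And>n. compact (C n)" "\<And>n. C n \<subseteq> \<phi> ` ((F n - N) - A)"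
    "\<And>n. measure M ((F n - N) - {x \<in> space M - A. \<phi> x \<in> C n}) < e n" by blast
  have "\<forall>n. \<exists>C. compact C \<and> C \<subseteq> \<phi> ` (((space M - F n) - N) - A) \<and> measure M (((space M - F n) - N) - {x \<in> space M - A. \<phi> x \<in> C}) < e n"
    using approx[OF FN(2) e] by blast
  from choice[OF this] obtain C' where C': "\<And>n. compact (C' n)" "\<And>n. C' n \<subseteq> \<phi> ` (((space M - F n) - N) - A)"
    "\<And>n. measure M (((space M - F n) - N) - {x \<in> space M - A. \<phi> x \<in> C' n}) < e n" by blast
  have preC: "{x \<in> space M - A. \<phi> x \<in> C n} \<in> sets M" "{x \<in> space M - A. \<phi> x \<in> C' n} \<in> sets M" for n
    using C(1) C'(1) by (intro pre borel_closed compact_imp_closed; blast)+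
  define W where "W n = {x \<in> space M - A. \<phi> x \<in> C n} \<union> {x \<in> space M - A. \<phi> x \<in> C' n}" for n
  have W: "W n \<in> sets M" for n
    unfolding W_def by (intro sets.Un preC)
  define Z where "Z = N \<union> (\<Union>n. space M - W n)"
  have Z: "Z \<in> sets M" unfolding Z_def using N W by auto
  have "measure M (space M - W n) \<le> \<epsilon> / 2 * (1 / 2) ^ Suc n" for n
  proof -
    let ?U = "(F n - N) - {x \<in> space M - A. \<phi> x \<in> C n}" and ?V = "((space M - F n) - N) - {x \<in> space M - A. \<phi> x \<in> C' n}"
    have UV: "?U \<in> sets M" "?V \<in> sets M"
      by (intro sets.Diff FN preC)+
    have "measure M (space M - W n) \<le> measure M (?U \<union> ?V \<union> N)"
      using UV N by (intro finite_measure_mono) (auto simp: W_def)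
    also have "\<dots> \<le> measure M (?U \<union> ?V) + measure M N"
      using UV N by (intro measure_Un_le) auto
    also have "measure M (?U \<union> ?V) \<le> measure M ?U + measure M ?V"
      using UV by (intro measure_Un_le) auto
    also have "measure M N = 0" using N by (simp add: measure_def null_setsD1)
    finally show ?thesis using C(3)[of n] C'(3)[of n] by (simp add: e_def)
  qed
  then have "measure M (\<Union>n. space M - W n) \<le> \<epsilon> / 2"
    using W by (intro geometric_null_union) auto
  moreover have "measure M Z \<le> measure M N + measure M (\<Union>n. space M - W n)"
    unfolding Z_def using N W by (intro measure_Un_le) auto
  moreover have "measure M N = 0" using N by (simp add: measure_def null_setsD1)
  ultimately have mZ: "measure M Z < \<epsilon>" using \<epsilon> by simp
  \<comment> \<open>The first factor repeats the set for index 0: it is compact, whereas the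
    intersection over all \<open>n\<close> is used as a closed set. Being inside it also gives each
    point of \<open>K\<close> a preimage outside \<open>A\<close> and \<open>N\<close>.\<close>
  define K where "K = (C 0 \<union> C' 0) \<inter> (\<Inter>n. C n \<union> C' n)"
  have K: "compact K"
    unfolding K_def using C(1) C'(1)
    by (intro compact_Int_closed compact_Un closed_INT ballI closed_Un compact_imp_closed) auto
  have K_point: "x \<in> space M - A \<and> x \<notin> N \<and> \<phi> x \<in> K" if x: "x \<in> space M - Z" for x
  proof -
    have "x \<in> W n" for n using x by (auto simp: Z_def)
    then have "x \<in> space M - A" "\<phi> x \<in> C n \<union> C' n" for n by (auto simp: W_def)
    then show ?thesis using x by (auto simp: K_def Z_def)
  qed
  have in_C: "x \<in> F n" if "x \<in> space M - A" "\<phi> x \<in> C n" for x n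
  proof -
    have "\<phi> x \<in> \<phi> ` ((F n - N) - A)" using subsetD[OF C(2)] that(2) by blast
    then obtain y where y: "y \<in> (F n - N) - A" "\<phi> x = \<phi> y" by blast
    have "y \<in> space M - A" using y(1) subsetD[OF sets.sets_into_space[OF F]] by blast
    from inj_onD[OF inj y(2) that(1) this] show ?thesis using y(1) by blast
  qed
  have in_C': "x \<notin> F n" if "x \<in> space M - A" "\<phi> x \<in> C' n" for x n
  proof -
    have "\<phi> x \<in> \<phi> ` (((space M - F n) - N) - A)" using subsetD[OF C'(2)] that(2) by blast
    then obtain y where y: "y \<in> ((space M - F n) - N) - A" "\<phi> x = \<phi> y" by blast
    have "y \<in> space M - A" using y(1) by blast
    from inj_onD[OF inj y(2) that(1) this] show ?thesis using y(1) by blast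
  qed
  have K_cases: "\<phi> x \<in> C n \<or> \<phi> x \<in> C' n" if "\<phi> x \<in> K" for x n using that by (auto simp: K_def)
  have preimage: "\<exists>x\<in>space M - A - N. a = \<phi> x" if "a \<in> K" for a
  proof -
    have "a \<in> C 0 \<union> C' 0" using that by (simp add: K_def)
    then have "a \<in> \<phi> ` ((F 0 - N) - A) \<or> a \<in> \<phi> ` (((space M - F 0) - N) - A)"
      using subsetD[OF C(2)] subsetD[OF C'(2)] by blast
    moreover have "F 0 \<subseteq> space M" by (rule sets.sets_into_space[OF F])
    ultimately show ?thesis by blast
  qed
  have stable: "eventually (\<lambda>k. w k \<in> F n) sequentially"
    if w: "\<And>k. w k \<in> space M - Z" and lim: "(\<lambda>k. \<phi> (w k)) \<longlonglongrightarrow> \<phi> x" and x: "x \<in> space M - A" "\<phi> x \<in> K" "x \<in> F n" for w x n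
  proof -
    have "\<phi> x \<in> - C' n" using in_C'[OF x(1)] x(3) by blast
    moreover have "open (- C' n)" using C'(1) by (intro open_Compl compact_imp_closed)
    ultimately have "eventually (\<lambda>k. \<phi> (w k) \<in> - C' n) sequentially"
      using lim topological_tendstoD by blast
    then show ?thesis
      by eventually_elim (use K_point[OF w] K_cases in_C in blast)
  qed
  have stable': "eventually (\<lambda>k. w k \<notin> F n) sequentially"
    if w: "\<And>k. w k \<in> space M - Z" and lim: "(\<lambda>k. \<phi> (w k)) \<longlonglongrightarrow> \<phi> x" and x: "x \<in> space M - A" "\<phi> x \<in> K" "x \<notin> F n" for w x n
  proof -
    have "\<phi> x \<in> - C n" using in_C[OF x(1)] x(3) by blast
    moreover have "open (- C n)" using C(1) by (intro open_Compl compact_imp_closed)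
    ultimately have "eventually (\<lambda>k. \<phi> (w k) \<in> - C n) sequentially"
      using lim topological_tendstoD by blast
    then show ?thesis
      by eventually_elim (use K_point[OF w] K_cases in_C' in blast)
  qed
  have "\<exists>\<delta>>0. \<forall>x\<in>space M - Z. \<forall>y\<in>space M - Z. x \<in> B \<longrightarrow> y \<notin> B \<longrightarrow> \<delta> \<le> \<rho> x y"
  proof (rule ccontr)
    assume neg: "\<not> ?thesis"
    have "\<exists>x y. x \<in> space M - Z \<and> y \<in> space M - Z \<and> x \<in> B \<and> y \<notin> B \<and> \<rho> x y < 1 / real (Suc m)" for m
    proof -
      have "1 / real (Suc m) > 0" by simp
      with neg show ?thesis by (meson not_le)
    qed
    then obtain u v where uv: "\<And>m. u m \<in> space M - Z" "\<And>m. v m \<in> space M - Z" "\<And>m. u m \<in> B" "\<And>m. v m \<notin> B"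
      "\<And>m. \<rho> (u m) (v m) < 1 / real (Suc m)" by metis
    have KK: "seq_compact (K \<times> K)" by (intro compact_imp_seq_compact compact_Times K)
    have "\<forall>m. (\<phi> (u m), \<phi> (v m)) \<in> K \<times> K" using K_point uv(1,2) by blast
    from seq_compactE[OF KK this] obtain ab r where ab: "ab \<in> K \<times> K" and r: "strict_mono (r :: nat \<Rightarrow> nat)"
      and lim: "((\<lambda>m. (\<phi> (u m), \<phi> (v m))) \<circ> r) \<longlonglongrightarrow> ab"
      by blast
    obtain x where x: "x \<in> space M - A - N" "fst ab = \<phi> x" using preimage[of "fst ab"] ab by auto
    obtain y where y: "y \<in> space M - A - N" "snd ab = \<phi> y" using preimage[of "snd ab"] ab by auto
    have limu: "(\<lambda>m. \<phi> (u (r m))) \<longlonglongrightarrow> \<phi> x" using tendsto_fst[OF lim] x(2) by (simp add: o_def)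
    have limv: "(\<lambda>m. \<phi> (v (r m))) \<longlonglongrightarrow> \<phi> y" using tendsto_snd[OF lim] y(2) by (simp add: o_def)
    have Kx: "\<phi> x \<in> K" "\<phi> y \<in> K" using ab x y by auto
    have xA: "x \<in> space M - A" "y \<in> space M - A" using x y by auto
    note su = stable[of "\<lambda>m. u (r m)", OF uv(1) limu xA(1) Kx(1)]
      and su' = stable'[of "\<lambda>m. u (r m)", OF uv(1) limu xA(1) Kx(1)]
      and sv = stable[of "\<lambda>m. v (r m)", OF uv(2) limv xA(2) Kx(2)]
      and sv' = stable'[of "\<lambda>m. v (r m)", OF uv(2) limv xA(2) Kx(2)]
    have F0: "F 0 = B" by (simp add: F_def)
    have "x \<in> B"
    proof (rule ccontr)
      assume "x \<notin> B"
      then have "eventually (\<lambda>m. u (r m) \<notin> B) sequentially" using su'[of 0] by (simp add: F0)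
      then show False using uv(3) by simp
    qed
    moreover have "y \<notin> B"
    proof
      assume "y \<in> B"
      then have "eventually (\<lambda>m. v (r m) \<in> B) sequentially" using sv[of 0] by (simp add: F0)
      then show False using uv(4) by simp
    qed
    ultimately have "x \<noteq> y" by auto
    then have pos: "0 < \<rho> x y" using metric xA by (auto simp: metric_on_def)
    \<comment> \<open>Some \<open>d i\<close> is within \<open>t\<close> of \<open>x\<close>, hence
      farther than \<open>2 * t\<close> from \<open>y\<close>. The rational radii
      \<open>q1 < q2\<close> are placed between \<open>t\<close> and \<open>2 * t\<close>;
      eventually the first sequence is inside the smaller ball and the second outside the larger
      one, so their distance stays at least \<open>q2 - q1\<close>.\<close>
    define t where "t = \<rho> x y / 3"
    have t: "t > 0" using pos by (simp add: t_def)
    obtain i where i: "\<rho> x (d i) < t" using dense[of x t] x(1) t by auto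
    have "\<rho> x y \<le> \<rho> x (d i) + \<rho> y (d i)"
      using tri[of x "d i" y] sym[of "d i" y] d xA by auto
    then have yi: "2 * t < \<rho> y (d i)" using i by (simp add: t_def)
    obtain q1 where q1: "q1 \<in> \<rat>" "t < q1" "q1 < 3 / 2 * t" using Rats_dense_in_real[of t "3 / 2 * t"] t by auto
    obtain q2 where q2: "q2 \<in> \<rat>" "3 / 2 * t < q2" "q2 < 2 * t" using Rats_dense_in_real[of "3 / 2 * t" "2 * t"] t by auto
    obtain k1 where k1: "q k1 = q1" using range_q q1(1) by (metis imageE)
    obtain k2 where k2: "q k2 = q2" using range_q q2(1) by (metis imageE)
    define n1 n2 where "n1 = Suc (prod_encode (i, k1))" and "n2 = Suc (prod_encode (i, k2))"
    have F1: "F n1 = {x \<in> space M. \<rho> x (d i) < q1}" by (simp add: F_def n1_def k1)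
    have F2: "F n2 = {x \<in> space M. \<rho> x (d i) < q2}" by (simp add: F_def n2_def k2)
    have "x \<in> F n1" using i q1 xA by (simp add: F1)
    from su[OF this] have ev1: "eventually (\<lambda>m. u (r m) \<in> F n1) sequentially" .
    have "y \<notin> F n2" using yi q2 by (simp add: F2)
    from sv'[OF this] have ev2: "eventually (\<lambda>m. v (r m) \<notin> F n2) sequentially" .
    have "eventually (\<lambda>m. q2 - q1 \<le> 1 / real (Suc m)) sequentially"
      using ev1 ev2
    proof eventually_elim
      case (elim m)
      have S: "u (r m) \<in> space M" "v (r m) \<in> space M" using uv by auto
      have "\<rho> (u (r m)) (d i) < q1" "q2 \<le> \<rho> (v (r m)) (d i)"
        using elim S by (auto simp: F1 F2)
      moreover have "\<rho> (v (r m)) (d i) \<le> \<rho> (u (r m)) (v (r m)) + \<rho> (u (r m)) (d i)"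
        using tri[OF S(2,1) d, of i] sym[OF S] by simp
      moreover have "\<rho> (u (r m)) (v (r m)) < 1 / real (Suc (r m))" by (rule uv(5))
      moreover have "1 / real (Suc (r m)) \<le> 1 / real (Suc m)"
        using seq_suble[OF r, of m] by (simp add: frac_le)
      ultimately show ?case by simp
    qed
    moreover have "(\<lambda>m. 1 / real (Suc m)) \<longlonglongrightarrow> 0" by (rule LIMSEQ_inverse_real_of_nat[unfolded inverse_eq_divide])
    ultimately have "q2 - q1 \<le> 0" by (intro tendsto_lowerbound[of _ 0 sequentially]) auto
    then show False using q1 q2 by simp
  qed
  then show ?thesis using Z mZ by blast
qed

section \<open>Bounded entropy\<close>

lemma semimetric_diam_le:
  assumes "\<And>x y. x \<in> A \<Longrightarrow> y \<in> A \<Longrightarrow> \<rho> x y \<le> r"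
  shows "semimetric_diam \<rho> A \<le> ennreal r"
  unfolding semimetric_diam_def using assms by (auto intro!: SUP_least ennreal_leI)

lemma semimetric_diam_lessD:
  assumes "semimetric_diam \<rho> A < ennreal r" "x \<in> A" "y \<in> A" "0 < r"
  shows "\<rho> x y < r"
proof -
  have "ennreal (\<rho> x y) \<le> semimetric_diam \<rho> A"
    unfolding semimetric_diam_def using assms(2,3) by (intro SUP_upper2[of "(x, y)"]) auto
  then have "ennreal (\<rho> x y) < ennreal r" using assms(1) by (rule le_less_trans)
  then show ?thesis using assms(4) by (cases "0 \<le> \<rho> x y") (auto simp: ennreal_less_iff)
qed

lemma entropy_cover_mono:
  assumes "entropy_cover M \<rho> \<epsilon> k" "k \<le> K" "\<epsilon> > 0"
  shows "entropy_cover M \<rho> \<epsilon> K"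
proof -
  obtain A where A: "\<And>j. j \<le> k \<Longrightarrow> A j \<in> sets M" "space M = (\<Union>j\<le>k. A j)" "emeasure M (A 0) < ennreal \<epsilon>"
    "\<And>j. j \<in> {1..k} \<Longrightarrow> semimetric_diam \<rho> (A j) < ennreal \<epsilon>"
    using assms(1) unfolding entropy_cover_def by blast
  define B where "B j = (if j \<le> k then A j else {})" for j
  have "space M = (\<Union>j\<le>K. B j)"
    using A(2) assms(2) by (fastforce simp: B_def split: if_splits)
  moreover have "semimetric_diam \<rho> (B j) < ennreal \<epsilon>" if "j \<in> {1..K}" for j
  proof (cases "j \<le> k")
    case True
    then show ?thesis using A(4)[of j] that by (simp add: B_def)
  next
    case False
    then have "semimetric_diam \<rho> (B j) \<le> ennreal 0" by (intro semimetric_diam_le) (simp add: B_def)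
    then show ?thesis using assms(3) by (simp add: le_less_trans)
  qed
  ultimately show ?thesis
    unfolding entropy_cover_def using A(1,3) by (intro exI[of _ B]) (auto simp: B_def)
qed

text \<open>Covers may be padded with empty sets, so a bound on the least sizes is the same as one
  size that works for all \<open>n\<close>. From here on logarithms and minima no longer
  occur.\<close>

lemma bounded_eps_entropy_iff:
  assumes \<epsilon>: "\<epsilon> > 0"
  shows "(SUP n\<in>{1..}. eps_entropy M (r n) \<epsilon>) < \<infinity> \<longleftrightarrow> (\<exists>K. \<forall>n\<ge>(1::nat). entropy_cover M (r n) \<epsilon> K)"
proof
  assume "(SUP n\<in>{1..}. eps_entropy M (r n) \<epsilon>) < \<infinity>"
  then obtain C :: nat where C: "(SUP n\<in>{1..}. eps_entropy M (r n) \<epsilon>) < ereal (real C)"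
    using less_PInf_Ex_of_nat by auto
  have "entropy_cover M (r n) \<epsilon> (2 ^ C)" if n: "n \<ge> 1" for n
  proof -
    have "eps_entropy M (r n) \<epsilon> \<le> (SUP n\<in>{1..}. eps_entropy M (r n) \<epsilon>)"
      using n by (intro SUP_upper) simp
    then have less: "eps_entropy M (r n) \<epsilon> < ereal (real C)" using C by (rule le_less_trans)
    then have ex: "\<exists>k\<ge>1. entropy_cover M (r n) \<epsilon> k"
    proof (rule contrapos_pp)
      assume "\<not> (\<exists>k\<ge>1. entropy_cover M (r n) \<epsilon> k)"
      then have "eps_entropy M (r n) \<epsilon> = \<infinity>" unfolding eps_entropy_def by (rule if_not_P)
      then show "\<not> eps_entropy M (r n) \<epsilon> < ereal (real C)" by simp
    qed
    define k where "k = (LEAST k. 1 \<le> k \<and> entropy_cover M (r n) \<epsilon> k)"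
    have k: "1 \<le> k" "entropy_cover M (r n) \<epsilon> k"
      using LeastI_ex[OF ex] by (auto simp: k_def)
    have "log 2 (real k) < real C" using less ex by (simp add: eps_entropy_def k_def)
    then have "real k < 2 powr real C" using k by (simp add: log_less_iff)
    then have "real k < real (2 ^ C)" by (simp add: powr_realpow)
    then have "k \<le> 2 ^ C" by linarith
    then show ?thesis by (rule entropy_cover_mono[OF k(2) _ \<epsilon>])
  qed
  then show "\<exists>K. \<forall>n\<ge>1. entropy_cover M (r n) \<epsilon> K" by blast
next
  assume "\<exists>K. \<forall>n\<ge>1. entropy_cover M (r n) \<epsilon> K"
  then obtain K where K: "\<And>n. n \<ge> 1 \<Longrightarrow> entropy_cover M (r n) \<epsilon> K" by blast
  have "eps_entropy M (r n) \<epsilon> \<le> ereal (log 2 (real (max 1 K)))" if n: "n \<ge> 1" for n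
  proof -
    \<comment> \<open>The entropy counts from \<open>k = 1\<close> on, while \<open>K\<close> may be
      0 when the exceptional set alone covers the space.\<close>
    have c: "1 \<le> max 1 K \<and> entropy_cover M (r n) \<epsilon> (max 1 K)"
      using entropy_cover_mono[OF K[OF n], of "max 1 K"] \<epsilon> by simp
    define k where "k = (LEAST k. 1 \<le> k \<and> entropy_cover M (r n) \<epsilon> k)"
    have "1 \<le> k \<and> entropy_cover M (r n) \<epsilon> k" unfolding k_def by (rule LeastI[where P = "\<lambda>k. 1 \<le> k \<and> entropy_cover M (r n) \<epsilon> k", OF c])
    moreover have "k \<le> max 1 K" unfolding k_def by (rule Least_le[where P = "\<lambda>k. 1 \<le> k \<and> entropy_cover M (r n) \<epsilon> k", OF c])
    ultimately have "log 2 (real k) \<le> log 2 (real (max 1 K))" by simp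
    moreover have "eps_entropy M (r n) \<epsilon> = ereal (log 2 (real k))"
      unfolding eps_entropy_def k_def by (rule if_P) (use c in blast)
    ultimately show ?thesis by simp
  qed
  then have "(SUP n\<in>{1..}. eps_entropy M (r n) \<epsilon>) \<le> ereal (log 2 (real (max 1 K)))"
    by (intro SUP_least) simp
  then show "(SUP n\<in>{1..}. eps_entropy M (r n) \<epsilon>) < \<infinity>" by (rule le_less_trans) simp
qed

section \<open>From bounded entropy to discrete spectrum\<close>

context measure_preserving
begin

lemma funpow_in_space: "x \<in> space M \<Longrightarrow> (T ^^ n) x \<in> space M"
  using measurable_space[OF funpow_T_measurable] .

text \<open>Invariance makes the integral of the orbit sum equal to \<open>n\<close> times that of
  \<open>G\<close>, so the bound on the exceptional set is the same for all
  \<open>n\<close>.\<close>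

lemma orbit_average_Markov:
  fixes G :: "'a \<Rightarrow> real"
  assumes G: "integrable M G" "\<And>x. x \<in> space M \<Longrightarrow> 0 \<le> G x" and s: "s > 0" and n: "n \<ge> 1"
  shows "measure M {x \<in> space M. real n * s \<le> (\<Sum>i<n. G ((T ^^ i) x))} \<le> (LINT x|M. G x) / s"
proof -
  have int: "integrable M (\<lambda>x. \<Sum>i<n. G ((T ^^ i) x))"
    by (intro Bochner_Integration.integrable_sum integrable_funpow G)
  have "measure M {x \<in> space M. real n * s \<le> (\<Sum>i<n. G ((T ^^ i) x))} \<le> (LINT x|M. (\<Sum>i<n. G ((T ^^ i) x))) / (real n * s)"
    using s n G(2) funpow_in_space by (intro integral_Markov_inequality_measure[OF int, of "{}"]) (auto intro!: sum_nonneg AE_I2)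
  also have "(LINT x|M. (\<Sum>i<n. G ((T ^^ i) x))) = (\<Sum>i<n. LINT x|M. G ((T ^^ i) x))"
    by (intro Bochner_Integration.integral_sum integrable_funpow G)
  also have "\<dots> = real n * (LINT x|M. G x)"
    using G(1) by (simp add: integral_funpow borel_measurable_integrable)
  finally show ?thesis using n by simp
qed

text \<open>Two points of one cell have orbits that are close in \<open>\<rho>\<close> on average. A
  time at which exactly one of them is in \<open>B\<close> costs either \<open>\<delta>\<close> in
  \<open>\<rho>\<close> or a visit to \<open>Z\<close>, and both are rare. So on each cell the
  indicator of \<open>B\<close> along the orbit may be replaced by its value at one
  representative.\<close>

lemma orbit_steps_of_bounded_entropy:
  assumes B: "B \<in> sets M"
    and sep: "\<And>\<epsilon>. \<epsilon> > 0 \<Longrightarrow> \<exists>\<delta>>0. \<exists>Z\<in>sets M. measure M Z < \<epsilon> \<and>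
      (\<forall>x\<in>space M - Z. \<forall>y\<in>space M - Z. x \<in> B \<longrightarrow> y \<notin> B \<longrightarrow> \<delta> \<le> \<rho> x y)"
    and sm: "semimetric_on (space M) \<rho>"
    and ent: "\<And>\<epsilon>. \<epsilon> > 0 \<Longrightarrow> \<exists>K. \<forall>n\<ge>1. entropy_cover M (average_semimetric T \<rho> n) \<epsilon> K"
    and \<kappa>: "\<kappa> > 0"
  shows "\<exists>K. \<forall>n\<ge>1. orbit_near_steps (indicator B) \<kappa> K n"
proof -
  \<comment> \<open>The five shares: on the good set one each for \<open>\<rho>\<close> and for the
    visits to \<open>Z\<close> of the point and of the representative, and two for the measure of
    the bad set \<open>R\<close>.\<close>
  define s where "s = \<kappa> / 5"
  have s: "s > 0" using \<kappa> by (simp add: s_def)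
  \<comment> \<open>Markov's inequality at level \<open>s\<close> divides the measure of
    \<open>Z\<close> by \<open>s\<close>, and the result has to be below \<open>s\<close>.\<close>
  then have "s * s > 0" by simp
  from sep[OF this] obtain \<delta> Z where \<delta>: "\<delta> > 0" and Z: "Z \<in> sets M" "measure M Z < s * s"
    and far: "\<And>x y. x \<in> space M - Z \<Longrightarrow> y \<in> space M - Z \<Longrightarrow> x \<in> B \<Longrightarrow> y \<notin> B \<Longrightarrow> \<delta> \<le> \<rho> x y"
    by blast
  define b :: "'a \<Rightarrow> real" where "b = indicator B"
  define z :: "'a \<Rightarrow> real" where "z = indicator Z"
  have b_diff: "(b x - b y)\<^sup>2 \<le> \<rho> x y / \<delta> + z x + z y" if xy: "x \<in> space M" "y \<in> space M" for x y
  proof -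
    have r: "0 \<le> \<rho> x y / \<delta>" using semimetric_onD(1)[OF sm xy] \<delta> by simp
    have "1 \<le> \<rho> x y / \<delta>" if "x \<notin> Z" "y \<notin> Z" "x \<in> B \<longleftrightarrow> y \<notin> B"
      using far[of x y] far[of y x] semimetric_onD(3)[OF sm xy] xy that \<delta> by (auto simp: le_divide_eq)
    then show ?thesis using r by (auto simp: b_def z_def indicator_def)
  qed
  \<comment> \<open>The first entry bounds the measure of \<open>A 0\<close>. The second absorbs the
    division of \<open>\<rho>\<close> by \<open>\<delta>\<close>.\<close>
  define \<epsilon> where "\<epsilon> = min s (\<delta> * s)"
  have \<epsilon>: "\<epsilon> > 0" "\<epsilon> \<le> s" "\<epsilon> \<le> \<delta> * s" using s \<delta> by (auto simp: \<epsilon>_def)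
  obtain K where K: "\<And>n. n \<ge> 1 \<Longrightarrow> entropy_cover M (average_semimetric T \<rho> n) \<epsilon> K"
    using ent[OF \<epsilon>(1)] by blast
  show ?thesis
  proof (intro exI[of _ K] allI impI)
    fix n :: nat assume n: "n \<ge> 1"
    obtain A where A: "\<And>j. j \<le> K \<Longrightarrow> A j \<in> sets M" "space M = (\<Union>j\<le>K. A j)" "emeasure M (A 0) < ennreal \<epsilon>"
      and diam: "\<And>j. j \<in> {1..K} \<Longrightarrow> semimetric_diam (average_semimetric T \<rho> n) (A j) < ennreal \<epsilon>"
      using K[OF n] unfolding entropy_cover_def by blast
    define Y where "Y = {x \<in> space M. real n * s \<le> (\<Sum>i<n. z ((T ^^ i) x))}"
    have int_z: "integrable M z"
      unfolding z_def using Z(1) by (intro integrable_real_indicator) (simp_all add: less_top[symmetric])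
    have [measurable]: "z \<in> borel_measurable M" "b \<in> borel_measurable M" using Z B by (auto simp: z_def b_def)
    have Y: "Y \<in> sets M" unfolding Y_def by measurable
    have "measure M Y \<le> (LINT x|M. z x) / s"
      unfolding Y_def by (rule orbit_average_Markov[OF int_z _ s n]) (simp add: z_def)
    also have "\<dots> < s" using Z s by (simp add: z_def divide_less_eq)
    finally have mY: "measure M Y < s" .
    define R where "R = A 0 \<union> Y"
    have R: "R \<in> sets M" using A(1) Y by (simp add: R_def)
    have "measure M (A 0) < s"
      using A(3) \<epsilon> s by (simp add: emeasure_eq_measure ennreal_less_iff)
    then have mR: "measure M R \<le> 2 * s"
      using measure_Un_le[of "A 0" M Y] A(1) Y mY by (simp add: R_def)
    have int_R: "integrable M (indicator R :: 'a \<Rightarrow> real)"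
      using R by (intro integrable_real_indicator) (simp_all add: less_top[symmetric])
    \<comment> \<open>Disjoint cells, renumbered from 0 with the exceptional set \<open>A 0\<close>
      left out. Removing \<open>R\<close> from them ensures that the representatives, too, visit
      \<open>Z\<close> rarely.\<close>
    define A' where "A' j = (A (Suc j) - R) - (\<Union>l<j. A (Suc l))" for j
    have A'_sets: "A' j \<in> sets M" if "j < K" for j
      unfolding A'_def using that A(1) R by auto
    \<comment> \<open>For an empty cell the representative is arbitrary; the cell's indicator
      vanishes, and the coefficient is still 0 or 1.\<close>
    define y where "y j = (SOME y. y \<in> A' j)" for j
    have y: "y j \<in> A' j" if "x \<in> A' j" for x j unfolding y_def using that by (rule someI)
    define \<theta> where "\<theta> i j = b ((T ^^ i) (y j))" for i j
    define p where "p i x = (\<Sum>j<K. \<theta> i j * indicator (A' j) x)" for i x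
    have p_eq: "p i x = \<theta> i j" if x: "x \<in> A' j" "j < K" for i j x
    proof -
      have "indicator (A' l) x = (if l = j then 1 else (0::real))" if "l < K" for l
        using x that by (cases l j rule: linorder_cases) (auto simp: A'_def indicator_def)
      then have "p i x = (\<Sum>l<K. if l = j then \<theta> i l else 0)"
        unfolding p_def by (intro sum.cong refl) auto
      then show ?thesis using x(2) by simp
    qed
    have p_0: "p i x = 0" if "x \<in> R" for i x
      unfolding p_def using that by (intro sum.neutral) (auto simp: A'_def)
    have point: "(\<Sum>i<n. (b ((T ^^ i) x) - p i x)\<^sup>2) \<le> real n * (3 * s) + real n * indicator R x"
      if x: "x \<in> space M" for x
    proof (cases "x \<in> R")
      case True
      have "(\<Sum>i<n. (b ((T ^^ i) x) - p i x)\<^sup>2) \<le> (\<Sum>i<n. 1)"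
        by (intro sum_mono) (simp add: p_0[OF True] b_def indicator_def)
      then show ?thesis using True s by (simp add: add_increasing)
    next
      case False
      have "\<exists>j. j < K \<and> x \<in> A (Suc j)"
      proof -
        obtain l where "l \<le> K" "x \<in> A l" using x A(2) by blast
        then show ?thesis using False by (cases l) (auto simp: R_def Suc_le_eq)
      qed
      then obtain j where j: "j < K" "x \<in> A (Suc j)" and min: "\<And>l. l < j \<Longrightarrow> \<not> (l < K \<and> x \<in> A (Suc l))"
        using exists_least_iff[of "\<lambda>j. j < K \<and> x \<in> A (Suc j)"] by blast
      have xj: "x \<in> A' j" using j min False by (auto simp: A'_def)
      have yj: "y j \<in> A' j" by (rule y[OF xj])
      then have yj': "y j \<in> A (Suc j)" "y j \<notin> R" by (auto simp: A'_def)
      have yS: "y j \<in> space M" using yj'(1) A(1)[of "Suc j"] j(1) sets.sets_into_space by fastforce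
      have "average_semimetric T \<rho> n x (y j) < \<epsilon>"
        using j yj'(1) \<epsilon>(1) by (intro semimetric_diam_lessD[OF diam[of "Suc j"]]) auto
      then have "(\<Sum>i<n. \<rho> ((T ^^ i) x) ((T ^^ i) (y j))) \<le> real n * (\<delta> * s)"
        using n \<epsilon>(3) by (simp add: average_semimetric_def divide_less_eq mult.commute[of "real n"])
          (smt (verit) mult_right_mono of_nat_0_le_iff)
      then have 1: "(\<Sum>i<n. \<rho> ((T ^^ i) x) ((T ^^ i) (y j)) / \<delta>) \<le> real n * s"
        using \<delta> by (simp add: sum_divide_distrib[symmetric] divide_le_eq mult_ac)
      have 2: "(\<Sum>i<n. z ((T ^^ i) x)) \<le> real n * s" "(\<Sum>i<n. z ((T ^^ i) (y j))) \<le> real n * s"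
        using False x yj'(2) yS by (auto simp: R_def Y_def)
      have "(\<Sum>i<n. (b ((T ^^ i) x) - p i x)\<^sup>2) = (\<Sum>i<n. (b ((T ^^ i) x) - b ((T ^^ i) (y j)))\<^sup>2)"
        by (simp add: p_eq[OF xj j(1)] \<theta>_def)
      also have "\<dots> \<le> (\<Sum>i<n. \<rho> ((T ^^ i) x) ((T ^^ i) (y j)) / \<delta> + z ((T ^^ i) x) + z ((T ^^ i) (y j)))"
        by (intro sum_mono b_diff funpow_in_space x yS)
      also have "\<dots> \<le> real n * (3 * s)" using 1 2 by (simp add: sum.distrib)
      finally show ?thesis using False by simp
    qed
    have p_meas [measurable]: "p i \<in> borel_measurable M" for i
      unfolding p_def[abs_def] using A'_sets by (intro borel_measurable_sum) auto
    have p_le: "\<bar>b ((T ^^ i) x) - p i x\<bar> \<le> 1 + real K" for i x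
    proof -
      have "\<bar>p i x\<bar> \<le> (\<Sum>j<K. 1)"
        unfolding p_def by (intro order_trans[OF sum_abs] sum_mono) (auto simp: \<theta>_def b_def indicator_def)
      moreover have "0 \<le> b ((T ^^ i) x)" "b ((T ^^ i) x) \<le> 1" by (simp_all add: b_def)
      ultimately show ?thesis by simp
    qed
    have int: "integrable M (\<lambda>x. (b ((T ^^ i) x) - p i x)\<^sup>2)" for i
      by (rule integrable_const_bound[of _ "(1 + real K)\<^sup>2"])
        (use p_le in \<open>auto intro!: AE_I2 simp: abs_le_square_iff[symmetric]\<close>)
    have norm: "(L2_seminorm M (\<lambda>x. indicator B ((T ^^ i) x) - (\<Sum>j<K. of_real (\<theta> i j) * indicator (A' j) x)))\<^sup>2
        = (LINT x|M. (b ((T ^^ i) x) - p i x)\<^sup>2)" for i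
    proof -
      have "indicator B ((T ^^ i) x) - (\<Sum>j<K. complex_of_real (\<theta> i j) * indicator (A' j) x) = of_real (b ((T ^^ i) x) - p i x)" for x
        by (simp add: b_def p_def of_real_indicator)
      then show ?thesis unfolding L2_seminorm_square by (simp only: norm_of_real power2_abs)
    qed
    have "(\<Sum>i<n. (L2_seminorm M (\<lambda>x. indicator B ((T ^^ i) x) - (\<Sum>j<K. of_real (\<theta> i j) * indicator (A' j) x)))\<^sup>2)
        = (LINT x|M. (\<Sum>i<n. (b ((T ^^ i) x) - p i x)\<^sup>2))"
      unfolding norm by (rule Bochner_Integration.integral_sum[symmetric]) (rule int)
    also have "\<dots> \<le> (LINT x|M. real n * (3 * s) + real n * indicator R x)"
      using point int int_R by (intro integral_mono Bochner_Integration.integrable_sum) auto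
    also have "\<dots> = real n * (3 * s) + real n * measure M R" using R int_R by (simp add: prob_space)
    also have "\<dots> \<le> real n * (3 * s) + real n * (2 * s)" using mR by (intro add_left_mono mult_left_mono) auto
    also have "\<dots> = \<kappa> * real n" by (simp add: s_def)
    finally have "(\<Sum>i<n. (L2_seminorm M (\<lambda>x. indicator B ((T ^^ i) x) - (\<Sum>j<K. of_real (\<theta> i j) * indicator (A' j) x)))\<^sup>2) \<le> \<kappa> * real n" .
    moreover have "\<bar>\<theta> i j\<bar> \<le> 1" for i j by (simp add: \<theta>_def b_def indicator_def)
    ultimately show "orbit_near_steps (indicator B) \<kappa> K n"
      unfolding orbit_near_steps_def using A'_sets by blast
  qed
qed

text \<open>The functions approximable from the span form a linear space, which contains the simple
  functions once it contains the indicators. Simple functions are dense by dominated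
  convergence.\<close>

lemma purely_discrete_spectrum_if_indicators:
  assumes ind: "\<And>B \<epsilon>. B \<in> sets M \<Longrightarrow> \<epsilon> > 0 \<Longrightarrow> \<exists>g\<in>eigen_span. L2_seminorm M (\<lambda>x. indicator B x - g x) < \<epsilon>"
  shows "purely_discrete_spectrum M T"
proof -
  define P where "P f \<longleftrightarrow> f \<in> L2_functions M \<and> (\<forall>\<epsilon>>0. \<exists>g\<in>eigen_span. L2_seminorm M (\<lambda>x. f x - g x) < \<epsilon>)" for f
  have P_0: "P (\<lambda>x. 0)"
    unfolding P_def using L2_zero eigen_span_0 by (auto intro!: bexI[of _ "\<lambda>x. 0"] simp: L2_seminorm_def)
  have P_add: "P (\<lambda>x. f x + g x)" if fP: "P f" and gP: "P g" for f g
    unfolding P_def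
  proof (intro conjI allI impI)
    show "(\<lambda>x. f x + g x) \<in> L2_functions M" using fP gP by (auto simp: P_def intro: L2_add)
    fix \<epsilon> :: real assume "\<epsilon> > 0"
    then have e: "\<epsilon> / 2 > 0" by simp
    obtain u where u: "u \<in> eigen_span" "L2_seminorm M (\<lambda>x. f x - u x) < \<epsilon> / 2" using fP e unfolding P_def by blast
    obtain v where v: "v \<in> eigen_span" "L2_seminorm M (\<lambda>x. g x - v x) < \<epsilon> / 2" using gP e unfolding P_def by blast
    have "L2_seminorm M (\<lambda>x. (f x - u x) + (g x - v x)) \<le> L2_seminorm M (\<lambda>x. f x - u x) + L2_seminorm M (\<lambda>x. g x - v x)"
      using fP gP unfolding P_def
      by (intro L2_triangle L2_diff eigen_span_L2[OF u(1)] eigen_span_L2[OF v(1)]) auto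
    then have "L2_seminorm M (\<lambda>x. (f x + g x) - (u x + v x)) < \<epsilon>" using u v by (simp add: algebra_simps)
    then show "\<exists>w\<in>eigen_span. L2_seminorm M (\<lambda>x. (f x + g x) - w x) < \<epsilon>"
      by (rule bexI[OF _ eigen_span_add[OF u(1) v(1)]])
  qed
  have P_scale: "P (\<lambda>x. c * f x)" if fP: "P f" for c f
    unfolding P_def
  proof (intro conjI allI impI)
    show "(\<lambda>x. c * f x) \<in> L2_functions M" using fP by (auto simp: P_def intro: L2_scale)
    fix \<epsilon> :: real assume "\<epsilon> > 0"
    then have e: "\<epsilon> / (cmod c + 1) > 0" by (simp add: add_nonneg_pos)
    obtain u where u: "u \<in> eigen_span" "L2_seminorm M (\<lambda>x. f x - u x) < \<epsilon> / (cmod c + 1)" using fP e unfolding P_def by blast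
    have "L2_seminorm M (\<lambda>x. c * f x - c * u x) = cmod c * L2_seminorm M (\<lambda>x. f x - u x)"
      using L2_seminorm_scale[of M c "\<lambda>x. f x - u x"] by (simp add: right_diff_distrib)
    also have "\<dots> \<le> (cmod c + 1) * L2_seminorm M (\<lambda>x. f x - u x)" by (intro mult_right_mono) auto
    also have "\<dots> < \<epsilon>"
      using u(2) pos_less_divide_eq[of "cmod c + 1" "L2_seminorm M (\<lambda>x. f x - u x)" \<epsilon>] by (simp add: add_nonneg_pos mult.commute)
    finally show "\<exists>w\<in>eigen_span. L2_seminorm M (\<lambda>x. c * f x - w x) < \<epsilon>"
      by (rule bexI[OF _ eigen_span_scale[OF u(1)]])
  qed
  have P_sum: "P (\<lambda>x. \<Sum>i\<in>I. h i x)" if "finite I" "\<And>i. i \<in> I \<Longrightarrow> P (h i)" for I and h :: "complex \<Rightarrow> 'a \<Rightarrow> complex"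
    using that by (induction I rule: finite_induct) (auto simp: P_0 intro: P_add)
  have P_simple: "P s" if s: "simple_function M s" for s
  proof -
    have "P (indicator B)" if "B \<in> sets M" for B unfolding P_def using L2_indicator(1) ind that by blast
    then have "P (\<lambda>x. \<Sum>y\<in>s ` space M. y * indicator (s -` {y} \<inter> space M) x)"
      using s by (intro P_sum P_scale) (auto simp: simple_function_def)
    moreover have "(\<Sum>y\<in>s ` space M. y * indicator (s -` {y} \<inter> space M) x) = s x" if "x \<in> space M" for x
    proof -
      have "(\<Sum>y\<in>s ` space M. y * indicator (s -` {y} \<inter> space M) x) = (\<Sum>y\<in>s ` space M. if y = s x then y else 0)"
        using that by (intro sum.cong refl) (auto simp: indicator_def)
      then show ?thesis using s that by (simp add: simple_function_def)
    qed
    \<comment> \<open>The canonical representation of a simple function agrees with it on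
      \<open>space M\<close> only, so \<open>P\<close> has to be carried over to functions that
      differ outside.\<close>
    moreover have "P f \<longleftrightarrow> P g" if eq: "\<And>x. x \<in> space M \<Longrightarrow> f x = g x" for f g
    proof -
      have 1: "f \<in> L2_functions M \<longleftrightarrow> g \<in> L2_functions M"
        unfolding L2_functions_def using measurable_cong[of M f g borel, OF eq]
          Bochner_Integration.integrable_cong[of M M "\<lambda>x. (cmod (f x))\<^sup>2" "\<lambda>x. (cmod (g x))\<^sup>2"] eq by auto
      have "L2_seminorm M (\<lambda>x. f x - u x) = L2_seminorm M (\<lambda>x. g x - u x)" for u
        unfolding L2_seminorm_def using eq by (intro arg_cong[where f = sqrt] Bochner_Integration.integral_cong) auto
      with 1 show ?thesis unfolding P_def by simp
    qed
    ultimately show ?thesis by (metis (no_types, lifting))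
  qed
  show ?thesis unfolding purely_discrete_spectrum_iff
  proof (intro ballI allI impI)
    fix g and \<epsilon> :: real assume g: "g \<in> L2_functions M" and \<epsilon>: "\<epsilon> > 0"
    have [measurable]: "g \<in> borel_measurable M" using g by measurable
    obtain s where s: "\<And>i. simple_function M (s i)" "\<And>x. x \<in> space M \<Longrightarrow> (\<lambda>i. s i x) \<longlonglongrightarrow> g x"
      "\<And>i x. x \<in> space M \<Longrightarrow> dist (s i x) 0 \<le> 2 * dist (g x) 0"
      using borel_measurable_implies_sequence_metric[OF L2_measurable[OF g], of 0] by blast
    have [measurable]: "s i \<in> borel_measurable M" for i using s(1) by (rule borel_measurable_simple_function)
    have "(\<lambda>i. LINT x|M. (cmod (g x - s i x))\<^sup>2) \<longlonglongrightarrow> (LINT x|M. 0)"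
    \<comment> \<open>The approximants satisfy \<open>cmod (s i x) \<le> 2 * cmod (g x)\<close>,
      hence the difference is at most three times \<open>cmod (g x)\<close>, and the square gives
      9.\<close>
    proof (rule integral_dominated_convergence[where w = "\<lambda>x. 9 * (cmod (g x))\<^sup>2"])
      show "integrable M (\<lambda>x. 9 * (cmod (g x))\<^sup>2)" using L2_integrable[OF g] by simp
      show "AE x in M. (\<lambda>i. (cmod (g x - s i x))\<^sup>2) \<longlonglongrightarrow> 0"
      proof (rule AE_I2)
        fix x assume "x \<in> space M"
        then have "(\<lambda>i. (cmod (g x - s i x))\<^sup>2) \<longlonglongrightarrow> (cmod (g x - g x))\<^sup>2" by (intro tendsto_intros s)
        then show "(\<lambda>i. (cmod (g x - s i x))\<^sup>2) \<longlonglongrightarrow> 0" by simp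
      qed
      show "AE x in M. norm ((cmod (g x - s i x))\<^sup>2) \<le> 9 * (cmod (g x))\<^sup>2" for i
      proof (rule AE_I2)
        fix x assume "x \<in> space M"
        then have "cmod (g x - s i x) \<le> 3 * cmod (g x)"
          using norm_triangle_ineq4[of "g x" "s i x"] s(3)[of x i] by simp
        then have "(cmod (g x - s i x))\<^sup>2 \<le> (3 * cmod (g x))\<^sup>2" by (intro power_mono) auto
        then show "norm ((cmod (g x - s i x))\<^sup>2) \<le> 9 * (cmod (g x))\<^sup>2" by (simp add: power_mult_distrib)
      qed
    qed measurable
    then have "eventually (\<lambda>i. (LINT x|M. (cmod (g x - s i x))\<^sup>2) < (\<epsilon> / 2)\<^sup>2) sequentially"
      using \<epsilon> by (intro order_tendstoD(2)) auto
    then obtain i where "(L2_seminorm M (\<lambda>x. g x - s i x))\<^sup>2 < (\<epsilon> / 2)\<^sup>2"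
      unfolding L2_seminorm_square by (auto dest: eventually_happens)
    then have i: "L2_seminorm M (\<lambda>x. g x - s i x) < \<epsilon> / 2"
      using \<epsilon> by (intro power2_less_imp_less[of _ "\<epsilon> / 2"]) auto
    have si: "P (s i)" by (rule P_simple[OF s(1)])
    have "\<epsilon> / 2 > 0" using \<epsilon> by simp
    with si obtain u where u: "u \<in> eigen_span" "L2_seminorm M (\<lambda>x. s i x - u x) < \<epsilon> / 2" unfolding P_def by blast
    have "L2_seminorm M (\<lambda>x. g x - u x) \<le> L2_seminorm M (\<lambda>x. g x - s i x) + L2_seminorm M (\<lambda>x. s i x - u x)"
      using si unfolding P_def by (intro L2_triangle3 g eigen_span_L2[OF u(1)]) simp
    then show "\<exists>u\<in>eigen_span. L2_seminorm M (\<lambda>x. g x - u x) < \<epsilon>" using i u by (intro bexI[of _ u]) auto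
  qed
qed

lemma purely_discrete_spectrum_if_bounded_entropy:
  assumes M: "lebesgue_prob_space M" and adm: "admissible M \<rho>"
    and int: "integrable (square_space M) (\<lambda>(x, y). \<rho> x y)"
    and metric: "metric_on (space M) \<rho>"
    and ent: "\<And>\<epsilon>. \<epsilon> > 0 \<Longrightarrow> \<exists>K. \<forall>n\<ge>1. entropy_cover M (average_semimetric T \<rho> n) \<epsilon> K"
  shows "purely_discrete_spectrum M T"
proof (rule purely_discrete_spectrum_if_indicators)
  fix B and \<epsilon> :: real assume B: "B \<in> sets M" and \<epsilon>: "\<epsilon> > 0"
  have sm: "semimetric_on (space M) \<rho>" using metric by (simp add: metric_on_def)
  show "\<exists>g\<in>eigen_span. L2_seminorm M (\<lambda>x. indicator B x - g x) < \<epsilon>"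
    by (rule span_dense_if_orbit_steps[OF L2_indicator[OF B]
          orbit_steps_of_bounded_entropy[OF B metric_separation[OF M adm int metric B] sm ent] \<epsilon>])
qed

end

section \<open>Discrete spectrum implies bounded entropy\<close>

text \<open>The distance of the line, truncated at 1, is pulled back along the injective part of the
  isomorphism. Points of the null set \<open>A\<close> get distance 1 from all others, which makes
  the function a metric everywhere. The truncation keeps the triangle inequality valid when the
  intermediate point is in \<open>A\<close>, and gives integrability. Separability is established
  off \<open>A\<close>, as admissibility permits.\<close>

lemma lebesgue_metric_exists:
  assumes M: "lebesgue_prob_space M"
  shows "\<exists>\<rho>. metric_on (space M) \<rho> \<and> admissible M \<rho> \<and> integrable (square_space M) (\<lambda>(x, y). \<rho> x y)"
proof -
  interpret prob_space M using M by (simp add: lebesgue_prob_space_def)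
  have sf: "sigma_finite_measure M" ..
  interpret pair_prob_space M M ..
  obtain \<phi> :: "'a \<Rightarrow> real" and A where A: "A \<in> null_sets M" and inj: "inj_on \<phi> (space M - A)"
    and pre: "\<And>U. U \<in> sets borel \<Longrightarrow> {x \<in> space M - A. \<phi> x \<in> U} \<in> sets M"
    by (rule lebesgue_compact_approximation[OF M]) blast
  have A_sets: "A \<in> sets M" "A \<subseteq> space M" using A sets.sets_into_space by auto
  define \<rho> where "\<rho> x y = (if x = y then 0 else if x \<in> A \<or> y \<in> A then 1 else min 1 \<bar>\<phi> x - \<phi> y\<bar>)" for x y
  have \<rho>01: "0 \<le> \<rho> x y" "\<rho> x y \<le> 1" for x y by (auto simp: \<rho>_def)
  have tri: "\<rho> x z \<le> \<rho> x y + \<rho> y z" for x y z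
  proof (cases "x = z \<or> y = x \<or> y = z \<or> x \<in> A \<or> y \<in> A \<or> z \<in> A")
    case True
    have "\<rho> x z = 0 \<or> \<rho> x y = 1 \<or> \<rho> y z = 1 \<or> y = x \<or> y = z"
      using True unfolding \<rho>_def by (cases "x = z"; cases "y = x"; cases "y = z") auto
    then show ?thesis
    proof (elim disjE)
      assume "y = x"
      then show ?thesis using \<rho>01[of x x] by simp
    next
      assume "y = z"
      then show ?thesis using \<rho>01[of z z] by simp
    qed (use \<rho>01[of x z] \<rho>01[of x y] \<rho>01[of y z] in linarith)+
  next
    case False
    have "min 1 \<bar>a - c\<bar> \<le> min 1 \<bar>a - b\<bar> + min 1 \<bar>b - c\<bar>" for a b c :: real
    proof -
      have "\<bar>a - c\<bar> \<le> \<bar>a - b\<bar> + \<bar>b - c\<bar>" by linarith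
      then show ?thesis by (auto simp: min_def)
    qed
    then show ?thesis using False by (simp add: \<rho>_def)
  qed
  have sm: "semimetric_on (space M) \<rho>"
    unfolding semimetric_on_def using tri \<rho>01 by (auto simp: \<rho>_def abs_minus_commute)
  have metric: "metric_on (space M) \<rho>"
    unfolding metric_on_def using sm inj by (auto simp: \<rho>_def inj_on_def)
  \<comment> \<open>\<open>\<phi>\<close> is controlled off \<open>A\<close> only. Its extension by
    0 is measurable and yields a product-measurable function equal to \<open>\<rho>\<close> almost
    everywhere.\<close>
  define \<psi> where "\<psi> x = (if x \<in> space M - A then \<phi> x else 0)" for x
  have [measurable]: "\<psi> \<in> borel_measurable M"
  proof (rule measurableI)
    fix U :: "real set" assume U: "U \<in> sets borel"
    have "\<psi> -` U \<inter> space M = {x \<in> space M - A. \<phi> x \<in> U} \<union> (if 0 \<in> U then A else {})"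
      using A_sets(2) by (auto simp: \<psi>_def split: if_splits)
    then show "\<psi> -` U \<inter> space M \<in> sets M" using pre[OF U] A_sets by auto
  qed simp
  define g where "g = (\<lambda>(x, y). min 1 \<bar>\<psi> x - \<psi> y\<bar>)"
  have g_meas [measurable]: "g \<in> borel_measurable (M \<Otimes>\<^sub>M M)" unfolding g_def by measurable
  have null: "A \<times> space M \<in> null_sets (M \<Otimes>\<^sub>M M)" "space M \<times> A \<in> null_sets (M \<Otimes>\<^sub>M M)"
    using A A_sets by (auto simp: null_sets_def sigma_finite_measure.emeasure_pair_measure_Times[OF sf])
  have ae: "AE p in M \<Otimes>\<^sub>M M. (\<lambda>(x, y). \<rho> x y) p = g p"
    using AE_not_in[OF null(1)] AE_not_in[OF null(2)] AE_space
  proof eventually_elim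
    case (elim p)
    obtain x y where p: "p = (x, y)" by (cases p)
    have "x \<in> space M - A" "y \<in> space M - A" using elim by (auto simp: p space_pair_measure)
    then show ?case by (simp add: p \<rho>_def g_def \<psi>_def)
  qed
  have ae': "AE p in square_space M. (\<lambda>(x, y). \<rho> x y) p = g p" by (rule AE_completion[OF ae])
  have meas: "(\<lambda>(x, y). \<rho> x y) \<in> borel_measurable (square_space M)"
    by (rule complete_measure.borel_measurable_AE_eq[OF completion.complete_measure_axioms measurable_completion[OF g_meas] ae'])
  have "integrable (M \<Otimes>\<^sub>M M) g"
    by (rule P.integrable_const_bound[of _ 1]) (auto simp: g_def)
  then have "integrable (square_space M) g" using integrable_completion[OF g_meas] by simp
  moreover have "AE p in square_space M. g p = (\<lambda>(x, y). \<rho> x y) p"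
    using ae' by eventually_elim (rule sym)
  ultimately have int: "integrable (square_space M) (\<lambda>(x, y). \<rho> x y)"
    by (intro Bochner_Integration.integrable_cong_AE_imp[OF _ meas])
  have "separable_on (space M - A) \<rho>"
  proof -
    obtain D where D: "countable D" "D \<subseteq> \<phi> ` (space M - A)" "\<phi> ` (space M - A) \<subseteq> closure D"
      by (rule separable)
    define D' where "D' = inv_into (space M - A) \<phi> ` D"
    have D': "countable D'" "D' \<subseteq> space M - A"
      using D(1) inv_into_into[OF subsetD[OF D(2)]] by (auto simp: D'_def simp del: Diff_iff)
    have "\<exists>d\<in>D'. \<rho> x d < e" if x: "x \<in> space M - A" and e: "e > 0" for x e
    proof -
      have "\<phi> x \<in> closure D" using D(3) x by blast
      then obtain u where u: "u \<in> D" "dist u (\<phi> x) < e" using e by (meson closure_approachable)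
      define d where "d = inv_into (space M - A) \<phi> u"
      have d: "d \<in> D'" "\<phi> d = u" using u(1) D(2) by (auto simp: D'_def d_def f_inv_into_f)
      then have "\<rho> x d \<le> \<bar>\<phi> x - \<phi> d\<bar>" using D'(2) x by (auto simp: \<rho>_def)
      also have "\<dots> < e" using u(2) d(2) by (simp add: dist_real_def abs_minus_commute)
      finally show ?thesis using d(1) by blast
    qed
    then show ?thesis unfolding separable_on_def using D' by blast
  qed
  moreover have "space M - A \<in> sets M" "emeasure M (space M - (space M - A)) = 0"
    using A A_sets by (auto simp: double_diff null_setsD1)
  ultimately have "admissible M \<rho>" unfolding admissible_def using sm meas by blast
  then show ?thesis using metric int by blast
qed

section \<open>Total boundedness in measure, uniformly along orbits\<close>

context measure_preserving
begin

text \<open>The simple function \<open>L\<close> encodes a finite partition. The quantifier over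
  \<open>n\<close> comes last, so one partition and one small exceptional set serve all times, which
  makes the number of cells independent of \<open>n\<close>. Labels in \<open>nat\<close> let the
  common refinement of two partitions be written with \<open>prod_encode\<close>.\<close>

definition orbit_totally_bounded :: "('a \<Rightarrow> 'a \<Rightarrow> real) \<Rightarrow> bool" where
  "orbit_totally_bounded W \<longleftrightarrow> (\<forall>e>0. \<exists>(L :: 'a \<Rightarrow> nat) R. simple_function M L \<and> R \<in> sets M \<and> measure M R < e \<and>
    (\<forall>x\<in>space M - R. \<forall>y\<in>space M - R. L x = L y \<longrightarrow> (\<forall>n. W ((T ^^ n) x) ((T ^^ n) y) \<le> e)))"

lemma orbit_totally_bounded_0: "orbit_totally_bounded (\<lambda>x y. 0)"
  unfolding orbit_totally_bounded_def
  by (intro allI impI exI[of _ "\<lambda>x. 0"] exI[of _ "{}"]) auto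

lemma orbit_totally_bounded_add:
  assumes V: "orbit_totally_bounded V" and W: "orbit_totally_bounded W"
  shows "orbit_totally_bounded (\<lambda>x y. V x y + W x y)"
  unfolding orbit_totally_bounded_def
proof (intro allI impI)
  fix e :: real assume "e > 0"
  then have e: "e / 2 > 0" by simp
  obtain L R where L: "simple_function M (L :: 'a \<Rightarrow> nat)" "R \<in> sets M" "measure M R < e / 2"
    and V': "\<And>x y n. x \<in> space M - R \<Longrightarrow> y \<in> space M - R \<Longrightarrow> L x = L y \<Longrightarrow> V ((T ^^ n) x) ((T ^^ n) y) \<le> e / 2"
    using V[unfolded orbit_totally_bounded_def, rule_format, OF e] by blast
  obtain L' R' where L': "simple_function M (L' :: 'a \<Rightarrow> nat)" "R' \<in> sets M" "measure M R' < e / 2"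
    and W': "\<And>x y n. x \<in> space M - R' \<Longrightarrow> y \<in> space M - R' \<Longrightarrow> L' x = L' y \<Longrightarrow> W ((T ^^ n) x) ((T ^^ n) y) \<le> e / 2"
    using W[unfolded orbit_totally_bounded_def, rule_format, OF e] by blast
  have "simple_function M (\<lambda>x. prod_encode (L x, L' x))"
    by (rule simple_function_compose2[OF L(1) L'(1), of "\<lambda>a b. prod_encode (a, b)"])
  moreover have "measure M (R \<union> R') < e"
    using measure_Un_le[OF L(2) L'(2)] L(3) L'(3) by simp
  moreover have "V ((T ^^ n) x) ((T ^^ n) y) + W ((T ^^ n) x) ((T ^^ n) y) \<le> e"
    if "x \<in> space M - (R \<union> R')" "y \<in> space M - (R \<union> R')" "prod_encode (L x, L' x) = prod_encode (L y, L' y)" for x y n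
    using V'[of x y n] W'[of x y n] that by simp
  ultimately show "\<exists>(L :: 'a \<Rightarrow> nat) R. simple_function M L \<and> R \<in> sets M \<and> measure M R < e \<and>
    (\<forall>x\<in>space M - R. \<forall>y\<in>space M - R. L x = L y \<longrightarrow> (\<forall>n. V ((T ^^ n) x) ((T ^^ n) y) + W ((T ^^ n) x) ((T ^^ n) y) \<le> e))"
    using sets.Un[OF L(2) L'(2)] by blast
qed

lemma orbit_totally_bounded_scale:
  assumes W: "orbit_totally_bounded W" and c: "c \<ge> 0"
  shows "orbit_totally_bounded (\<lambda>x y. c * W x y)"
  unfolding orbit_totally_bounded_def
proof (intro allI impI)
  fix e :: real assume e: "e > 0"
  then have e': "e / (c + 1) > 0" using c by simp
  obtain L R where L: "simple_function M (L :: 'a \<Rightarrow> nat)" "R \<in> sets M" "measure M R < e / (c + 1)"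
    and W': "\<And>x y n. x \<in> space M - R \<Longrightarrow> y \<in> space M - R \<Longrightarrow> L x = L y \<Longrightarrow> W ((T ^^ n) x) ((T ^^ n) y) \<le> e / (c + 1)"
    using W[unfolded orbit_totally_bounded_def, rule_format, OF e'] by blast
  have le: "c * (e / (c + 1)) \<le> e" "e / (c + 1) \<le> e" using c e by (auto simp: field_simps)
  have "c * W ((T ^^ n) x) ((T ^^ n) y) \<le> e" if "x \<in> space M - R" "y \<in> space M - R" "L x = L y" for x y n
    using mult_left_mono[OF W'[OF that, of n] c] le(1) by linarith
  then show "\<exists>(L :: 'a \<Rightarrow> nat) R. simple_function M L \<and> R \<in> sets M \<and> measure M R < e \<and>
    (\<forall>x\<in>space M - R. \<forall>y\<in>space M - R. L x = L y \<longrightarrow> (\<forall>n. c * W ((T ^^ n) x) ((T ^^ n) y) \<le> e))"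
    using L less_le_trans[OF L(3) le(2)] by blast
qed

lemma orbit_totally_bounded_mono:
  assumes W: "orbit_totally_bounded W" and le: "\<And>x y. V x y \<le> W x y"
  shows "orbit_totally_bounded V"
  using W unfolding orbit_totally_bounded_def by (meson le order_trans)

lemma orbit_totally_bounded_sum:
  assumes "finite I" "\<And>i. i \<in> I \<Longrightarrow> orbit_totally_bounded (W i)"
  shows "orbit_totally_bounded (\<lambda>x y. \<Sum>i\<in>I. W i x y)"
  using assms by (induction I rule: finite_induct) (auto simp: orbit_totally_bounded_0 intro: orbit_totally_bounded_add)

lemma simple_function_bounded_floor:
  fixes u :: "'a \<Rightarrow> real"
  assumes u [measurable]: "u \<in> borel_measurable M" and b: "\<And>x. x \<in> space M \<Longrightarrow> \<bar>u x\<bar> \<le> K"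
  shows "simple_function M (\<lambda>x. \<lfloor>u x\<rfloor>)"
proof -
  have "(\<lambda>x. \<lfloor>u x\<rfloor>) ` space M \<subseteq> {\<lfloor>- K\<rfloor>..\<lfloor>K\<rfloor>}"
  proof
    fix k assume "k \<in> (\<lambda>x. \<lfloor>u x\<rfloor>) ` space M"
    then obtain x where "x \<in> space M" "k = \<lfloor>u x\<rfloor>" by blast
    then show "k \<in> {\<lfloor>- K\<rfloor>..\<lfloor>K\<rfloor>}" using b[of x] by (auto intro!: floor_mono)
  qed
  then have fin: "finite ((\<lambda>x. \<lfloor>u x\<rfloor>) ` space M)" by (rule finite_subset) simp
  have "(\<lambda>x. \<lfloor>u x\<rfloor>) \<in> measurable M (count_space UNIV)" by measurable
  then have "(\<lambda>x. \<lfloor>u x\<rfloor>) -` {k} \<inter> space M \<in> sets M" for k by (rule measurable_sets) simp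
  then show ?thesis unfolding simple_function_def using fin by blast
qed

text \<open>Composition with \<open>T\<close> preserves the norm, and an eigenfunction has nonzero
  norm.\<close>

lemma eigenvalue_on_circle:
  assumes f: "f \<in> eigenfunctions M T" and c: "AE x in M. f (T x) = c * f x"
  shows "cmod c = 1"
proof -
  have f2: "f \<in> L2_functions M" and nz: "\<not> (AE x in M. f x = 0)" using f by (auto simp: eigenfunctions_def)
  have "L2_seminorm M f = L2_seminorm M (\<lambda>x. f (T x))" using L2_seminorm_funpow[OF f2, of 1] by simp
  also have "\<dots> = L2_seminorm M (\<lambda>x. c * f x)"
    using L2_funpow[OF f2, of 1] by (intro L2_seminorm_cong_AE L2_measurable L2_scale f2 c) simp
  also have "\<dots> = cmod c * L2_seminorm M f" by (rule L2_seminorm_scale)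
  finally show ?thesis using nz L2_seminorm_eq_0_iff[OF f2] by simp
qed

text \<open>Invariance reduces all times to time 0, off one null set for all \<open>n\<close>. There
  the values of \<open>f\<close>, apart from a tail cut off by Chebyshev's inequality, lie in a
  bounded region of the plane, which a square grid cuts into finitely many pieces.\<close>

lemma eigenfunction_orbit_totally_bounded:
  assumes f: "f \<in> eigenfunctions M T"
  shows "orbit_totally_bounded (\<lambda>x y. cmod (f x - f y))"
  unfolding orbit_totally_bounded_def
proof (intro allI impI)
  fix e :: real assume e: "e > 0"
  have f2: "f \<in> L2_functions M" using f by (simp add: eigenfunctions_def)
  have [measurable]: "f \<in> borel_measurable M" using f2 by measurable
  obtain c where c: "AE x in M. f (T x) = c * f x" using f by (auto simp: eigenfunctions_def)
  have c1: "cmod c = 1" by (rule eigenvalue_on_circle[OF f c])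
  have "AE x in M. f ((T ^^ n) x) = c ^ n * f x" for n
  proof (induction n)
    case (Suc n)
    from Suc.IH AE_funpow[OF c, of n] show ?case by eventually_elim simp
  qed simp
  then have "AE x in M. \<forall>n. f ((T ^^ n) x) = c ^ n * f x" by (simp add: AE_all_countable)
  then obtain N where N: "N \<in> null_sets M" and orbit: "\<And>x n. x \<in> space M - N \<Longrightarrow> f ((T ^^ n) x) = c ^ n * f x"
    by (rule AE_obtain_null_set) blast
  define I where "I = (LINT x|M. (cmod (f x))\<^sup>2)"
  \<comment> \<open>Makes \<open>I / Q < e\<close>; the summand 1 keeps \<open>Q\<close> positive
    when \<open>I = 0\<close>.\<close>
  define Q where "Q = 2 * I / e + 1"
  have I: "I \<ge> 0" by (simp add: I_def)
  have Q: "Q > 0" using I e by (simp add: Q_def add_nonneg_pos)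
  define S where "S = {x \<in> space M. Q \<le> (cmod (f x))\<^sup>2}"
  have S: "S \<in> sets M" unfolding S_def by measurable
  have "measure M S \<le> I / Q"
    unfolding S_def I_def by (rule integral_Markov_inequality_measure[OF L2_integrable[OF f2], of "{}"]) (use Q in auto)
  also have "\<dots> < e"
  proof -
    have "I < e * Q" using e I by (simp add: Q_def distrib_left)
    then show ?thesis using Q by (simp add: divide_less_eq mult.commute)
  qed
  finally have "measure M S < e" .
  have "measure M (S \<union> N) < e"
  proof -
    have "measure M N = 0" "N \<in> sets M" using N by (auto simp: measure_def null_setsD1)
    then show ?thesis using \<open>measure M S < e\<close> measure_Un_le[OF S, of N] by linarith
  qed
  \<comment> \<open>Coordinates in units of the grid width \<open>e / 2\<close>. The value 0 beyond
    the level \<open>Q\<close> keeps the floors in a finite range; these points belong to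
    \<open>S\<close> and are discarded.\<close>
  define u where "u x = (if (cmod (f x))\<^sup>2 < Q then Re (f x) / (e / 2) else 0)" for x
  define v where "v x = (if (cmod (f x))\<^sup>2 < Q then Im (f x) / (e / 2) else 0)" for x
  have bound: "\<bar>u x\<bar> \<le> sqrt Q / (e / 2)" "\<bar>v x\<bar> \<le> sqrt Q / (e / 2)" for x
  proof -
    have "cmod (f x) \<le> sqrt Q" if "(cmod (f x))\<^sup>2 < Q" using that by (simp add: real_le_rsqrt)
    then have "\<bar>Re (f x)\<bar> \<le> sqrt Q" "\<bar>Im (f x)\<bar> \<le> sqrt Q" if "(cmod (f x))\<^sup>2 < Q"
      using that abs_Re_le_cmod[of "f x"] abs_Im_le_cmod[of "f x"] by auto
    then show "\<bar>u x\<bar> \<le> sqrt Q / (e / 2)" "\<bar>v x\<bar> \<le> sqrt Q / (e / 2)"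
      using e Q by (auto simp: u_def v_def abs_divide intro!: divide_right_mono)
  qed
  have "u \<in> borel_measurable M" "v \<in> borel_measurable M" unfolding u_def[abs_def] v_def[abs_def] by measurable
  then have "simple_function M (\<lambda>x. \<lfloor>u x\<rfloor>)" "simple_function M (\<lambda>x. \<lfloor>v x\<rfloor>)"
    using bound by (auto intro: simple_function_bounded_floor)
  then have L: "simple_function M (\<lambda>x. prod_encode (int_encode \<lfloor>u x\<rfloor>, int_encode \<lfloor>v x\<rfloor>))"
    by (rule simple_function_compose2[where h = "\<lambda>a b. prod_encode (int_encode a, int_encode b)"])
  have "cmod (f ((T ^^ n) x) - f ((T ^^ n) y)) \<le> e"
    if x: "x \<in> space M - (S \<union> N)" and y: "y \<in> space M - (S \<union> N)" and eq: "\<lfloor>u x\<rfloor> = \<lfloor>u y\<rfloor>" "\<lfloor>v x\<rfloor> = \<lfloor>v y\<rfloor>" for x y n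
  proof -
    have small: "\<bar>a - b\<bar> \<le> t" if "\<lfloor>a / t\<rfloor> = \<lfloor>b / t\<rfloor>" "t > 0" for a b t :: real
    proof -
      have "\<bar>a / t - b / t\<bar> \<le> 1"
        using that(1) floor_correct[of "a / t"] floor_correct[of "b / t"] by linarith
      then have "\<bar>a / t - b / t\<bar> * t \<le> 1 * t" using that(2) by (intro mult_right_mono) auto
      moreover have "\<bar>a - b\<bar> = \<bar>a / t - b / t\<bar> * t"
        using that(2) by (simp add: diff_divide_distrib[symmetric])
      ultimately show ?thesis by simp
    qed
    have "f ((T ^^ n) x) - f ((T ^^ n) y) = c ^ n * (f x - f y)"
      using orbit x y by (simp add: right_diff_distrib)
    then have "cmod (f ((T ^^ n) x) - f ((T ^^ n) y)) = cmod (f x - f y)"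
      by (simp add: norm_mult norm_power c1)
    also have "\<dots> \<le> \<bar>Re (f x - f y)\<bar> + \<bar>Im (f x - f y)\<bar>" by (rule cmod_le)
    also have "\<dots> \<le> e / 2 + e / 2"
      using small[of "Re (f x)" "e / 2" "Re (f y)"] small[of "Im (f x)" "e / 2" "Im (f y)"] eq e x y
      by (intro add_mono) (auto simp: u_def v_def S_def)
    finally show ?thesis by simp
  qed
  then show "\<exists>(L :: 'a \<Rightarrow> nat) R. simple_function M L \<and> R \<in> sets M \<and> measure M R < e \<and>
    (\<forall>x\<in>space M - R. \<forall>y\<in>space M - R. L x = L y \<longrightarrow> (\<forall>n. cmod (f ((T ^^ n) x) - f ((T ^^ n) y)) \<le> e))"
    using L S N \<open>measure M (S \<union> N) < e\<close>
    by (intro exI[of _ "\<lambda>x. prod_encode (int_encode \<lfloor>u x\<rfloor>, int_encode \<lfloor>v x\<rfloor>)"] exI[of _ "S \<union> N"]) (auto simp: int_encode_eq)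
qed

lemma eigen_span_orbit_totally_bounded:
  assumes "g \<in> eigen_span"
  shows "orbit_totally_bounded (\<lambda>x y. cmod (g x - g y))"
proof -
  obtain F a where F: "finite F" "F \<subseteq> eigenfunctions M T" and g: "g = (\<lambda>x. \<Sum>f\<in>F. a f * f x)"
    using assms by (auto simp: eigen_span_def)
  have "orbit_totally_bounded (\<lambda>x y. \<Sum>f\<in>F. cmod (a f) * cmod (f x - f y))"
    using F by (intro orbit_totally_bounded_sum orbit_totally_bounded_scale eigenfunction_orbit_totally_bounded) auto
  then show ?thesis
  proof (rule orbit_totally_bounded_mono)
    fix x y
    have "g x - g y = (\<Sum>f\<in>F. a f * (f x - f y))"
      by (simp add: g sum_subtractf right_diff_distrib)
    then show "cmod (g x - g y) \<le> (\<Sum>f\<in>F. cmod (a f) * cmod (f x - f y))"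
      by (simp add: sum_norm_le norm_mult)
  qed
qed

text \<open>A semimetric is, up to an integrable error of small integral, a combination of
  \<open>\<bar>1\<^sub>D x - 1\<^sub>D y\<bar>\<close> for finitely many sets \<open>D\<close> of small diameter, and each indicator function is
  close to the span of the eigenfunctions.\<close>

lemma semimetric_orbit_approximation:
  assumes pds: "purely_discrete_spectrum M T" and M: "complete_measure M"
    and adm: "admissible M \<rho>" and int: "integrable (square_space M) (\<lambda>(x, y). \<rho> x y)" and e: "e > 0"
  obtains G W where "integrable M G" "\<And>x. x \<in> space M \<Longrightarrow> 0 \<le> G x" "(LINT x|M. G x) < e"
    "orbit_totally_bounded W" "\<And>x y. x \<in> space M \<Longrightarrow> y \<in> space M \<Longrightarrow> \<rho> x y \<le> e + G x + G y + W x y"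
proof -
  have sm: "semimetric_on (space M) \<rho>" using adm by (simp add: admissible_def)
  obtain d :: "nat \<Rightarrow> 'a" and N where N: "N \<in> null_sets M" and d: "\<And>i. d i \<in> space M"
    and int_d: "\<And>i. integrable M (\<lambda>x. \<rho> x (d i))"
    and dense: "\<And>x e. x \<in> space M - N \<Longrightarrow> e > 0 \<Longrightarrow> \<exists>i. \<rho> x (d i) < e"
    by (rule admissible_dense_sequence[OF prob_space_axioms M adm int]) blast
  have [measurable]: "(\<lambda>x. \<rho> x (d i)) \<in> borel_measurable M" for i using int_d by auto
  define B where "B i = {x \<in> space M. \<rho> x (d i) < e / 2}" for i
  have B [measurable]: "B i \<in> sets M" for i unfolding B_def by measurable
  \<comment> \<open>Balls of radius \<open>e / 2\<close> made disjoint, so that two points in one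
    \<open>D i\<close> have distance at most \<open>e\<close> and points in different ones are told
    apart by indicators.\<close>
  define D where "D i = B i - (\<Union>j<i. B j)" for i
  have D [measurable]: "D i \<in> sets M" for i unfolding D_def by measurable
  have D_diam: "\<rho> x y \<le> e" if "x \<in> D i" "y \<in> D i" for x y i
  proof -
    have xy: "x \<in> space M" "y \<in> space M" "\<rho> x (d i) < e / 2" "\<rho> y (d i) < e / 2"
      using that by (auto simp: D_def B_def)
    then show ?thesis
      using semimetric_onD(4)[OF sm, of x "d i" y] semimetric_onD(3)[OF sm, of "d i" y] d[of i] by simp
  qed
  have D_disj: "x \<notin> D j" if "x \<in> D i" "i \<noteq> j" for x i j
    using that by (cases i j rule: linorder_cases) (auto simp: D_def)
  define g where "g x = \<rho> x (d 0)" for x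
  have g: "integrable M g" unfolding g_def[abs_def] by (rule int_d)
  have [measurable]: "g \<in> borel_measurable M" using g by auto
  have g0: "0 \<le> g x" if "x \<in> space M" for x using semimetric_onD(1)[OF sm that d] by (simp add: g_def)
  have \<rho>_g: "\<rho> x y \<le> g x + g y" if "x \<in> space M" "y \<in> space M" for x y
    using semimetric_onD(4)[OF sm that(1) d that(2), of 0] semimetric_onD(3)[OF sm d that(2), of 0] by (simp add: g_def)
  \<comment> \<open>The tail of \<open>g\<close> above the level \<open>k\<close>. It splits the
    possibly unbounded \<open>\<rho>\<close> into two tails of small integral and a part bounded by
    \<open>2 * real k\<close>.\<close>
  define gK where "gK k x = (if real k < g x then g x else 0)" for k :: nat and x
  have gK_int: "integrable M (gK k)" for k
    by (rule Bochner_Integration.integrable_bound[OF g]) (auto simp: gK_def[abs_def])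
  have "(\<lambda>k. LINT x|M. gK k x) \<longlonglongrightarrow> (LINT x|M. 0)"
  proof (rule integral_dominated_convergence[where w = "\<lambda>x. \<bar>g x\<bar>"])
    show "AE x in M. (\<lambda>k. gK k x) \<longlonglongrightarrow> 0"
    proof (rule AE_I2, rule tendsto_eventually)
      fix x
      obtain k0 :: nat where "g x \<le> real k0" using real_arch_simple by blast
      then have "gK k x = 0" if "k \<ge> k0" for k using that by (auto simp: gK_def)
      then show "eventually (\<lambda>k. gK k x = 0) sequentially" by (auto simp: eventually_sequentially)
    qed
  qed (use g gK_int in \<open>auto simp: gK_def\<close>)
  then have "eventually (\<lambda>k. (LINT x|M. gK k x) < e / 4) sequentially"
    using e by (intro order_tendstoD(2)) auto
  then obtain k where k: "(LINT x|M. gK k x) < e / 4" by (auto dest: eventually_happens)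
  \<comment> \<open>Bounds \<open>\<rho>\<close> apart from the tails; the summand 1 allows division
    by it when \<open>k = 0\<close>.\<close>
  define k2 where "k2 = 2 * real k + 1"
  have k2: "k2 > 0" "2 * real k \<le> k2" by (auto simp: k2_def)
  define R where "R m = space M - (\<Union>i<m. D i)" for m
  have R [measurable]: "R m \<in> sets M" for m unfolding R_def by measurable
  have UD: "(\<Union>i<m. D i) = (\<Union>i<m. B i)" for m :: nat
    by (induction m) (auto simp: lessThan_Suc D_def)
  have "(\<lambda>m. measure M (R m)) \<longlonglongrightarrow> 0"
  proof -
    have lim: "(\<lambda>m. measure M (R m)) \<longlonglongrightarrow> measure M (\<Inter>m. R m)"
      by (rule finite_Lim_measure_decseq) (auto simp: decseq_def R_def)
    have "(\<Inter>m. R m) \<subseteq> N"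
    proof
      fix x assume x: "x \<in> (\<Inter>m. R m)"
      then have "x \<in> space M" "\<And>i. x \<notin> B i" using UD by (auto simp: R_def)
      then show "x \<in> N" using dense[of x "e / 2"] e by (auto simp: B_def)
    qed
    then have "measure M (\<Inter>m. R m) \<le> measure M N" using N by (intro finite_measure_mono) auto
    moreover have "measure M N = 0" using N by (simp add: measure_def null_setsD1)
    ultimately have "measure M (\<Inter>m. R m) = 0" using measure_nonneg[of M "\<Inter>m. R m"] by linarith
    with lim show ?thesis by simp
  qed
  moreover have "0 < e / 4 / k2" using e k2 by simp
  ultimately have "eventually (\<lambda>m. measure M (R m) < e / 4 / k2) sequentially" by (rule order_tendstoD(2))
  then obtain m where m: "measure M (R m) < e / 4 / k2" by (auto dest: eventually_happens)
  \<comment> \<open>The integral of \<open>G\<close> is budgeted as a quarter of \<open>e\<close>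
    each for the tail, the uncovered set \<open>R m\<close> and the \<open>m\<close> approximation
    errors, all but the tail weighted by \<open>k2\<close>. Hence the order of choices:
    \<open>k\<close>, then \<open>m\<close>, then \<open>\<eta>\<close>; \<open>real m + 1\<close>
    covers the case \<open>m = 0\<close>.\<close>
  define \<eta> where "\<eta> = e / 4 / (k2 * (real m + 1))"
  have \<eta>: "\<eta> > 0" using e k2 by (simp add: \<eta>_def)
  have ind: "indicator (D i) \<in> L2_functions M" for i
    by (rule L2_indicator(1)[OF D])
  have "\<forall>i. \<exists>h. h \<in> eigen_span \<and> L2_seminorm M (\<lambda>x. indicator (D i) x - h x) < \<eta>"
    using pds ind \<eta> unfolding purely_discrete_spectrum_iff by blast
  from choice[OF this] obtain h where h: "\<And>i. h i \<in> eigen_span"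
    and h_close: "\<And>i. L2_seminorm M (\<lambda>x. indicator (D i) x - h i x) < \<eta>" by blast
  define E where "E i x = cmod (indicator (D i) x - h i x)" for i x
  have diff: "(\<lambda>x. indicator (D i) x - h i x) \<in> L2_functions M" for i by (intro L2_diff ind eigen_span_L2 h)
  have E: "integrable M (E i)" for i
    unfolding E_def[abs_def] by (intro integrable_norm L1_le_L2(1) diff)
  have E_le: "(LINT x|M. E i x) \<le> \<eta>" for i
    unfolding E_def using L1_le_L2(2)[OF diff, of i] h_close[of i] by simp
  define G where "G x = gK k x + k2 * (indicator (R m) x + (\<Sum>i<m. E i x))" for x
  define W where "W x y = k2 * (\<Sum>i<m. cmod (h i x - h i y))" for x y
  have int_R: "integrable M (indicator (R m) :: 'a \<Rightarrow> real)"
    using R by (intro integrable_real_indicator) (simp_all add: less_top[symmetric])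
  have G: "integrable M G"
    unfolding G_def[abs_def]
    by (intro Bochner_Integration.integrable_add gK_int integrable_mult_right int_R Bochner_Integration.integrable_sum E)
  have gK0: "0 \<le> gK k x" if "x \<in> space M" for x using g0[OF that] by (simp add: gK_def)
  have E0: "0 \<le> E i x" for i x by (simp add: E_def)
  have G0: "0 \<le> G x" if "x \<in> space M" for x
    unfolding G_def using gK0[OF that] E0 k2(1) by (intro add_nonneg_nonneg mult_nonneg_nonneg sum_nonneg) auto
  have "(LINT x|M. G x) = (LINT x|M. gK k x) + k2 * (measure M (R m) + (\<Sum>i<m. LINT x|M. E i x))"
    unfolding G_def using gK_int int_R E R by simp
  also have "\<dots> < e / 4 + k2 * (e / 4 / k2 + (\<Sum>i<m. \<eta>))"
    using k m k2(1) E_le by (intro add_less_le_mono mult_left_mono add_mono sum_mono) auto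
  also have "\<dots> \<le> e"
  proof -
    have "k2 * (real m * \<eta>) \<le> e / 4"
    proof -
      have "k2 * (real m * \<eta>) \<le> k2 * ((real m + 1) * \<eta>)" using k2 \<eta> by (intro mult_left_mono mult_right_mono) auto
      also have "\<dots> = e / 4"
      proof -
        have "k2 * (real m + 1) \<noteq> 0" using k2(1) by (auto simp: add_nonneg_eq_0_iff)
        then show ?thesis unfolding \<eta>_def by (simp add: mult.assoc[symmetric])
      qed
      finally show ?thesis .
    qed
    then show ?thesis using k2(1) e by (simp add: distrib_left)
  qed
  finally have G_small: "(LINT x|M. G x) < e" .
  have "orbit_totally_bounded W"
    unfolding W_def[abs_def] using k2(1)
    by (intro orbit_totally_bounded_scale orbit_totally_bounded_sum eigen_span_orbit_totally_bounded h) auto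
  moreover have "\<rho> x y \<le> e + G x + G y + W x y" if x: "x \<in> space M" and y: "y \<in> space M" for x y
  proof -
    \<comment> \<open>At least 1 as soon as \<open>x\<close> and \<open>y\<close> do not share one
      of the first \<open>m\<close> cells, since then a point is uncovered or some indicator
      separates them. In that case \<open>k2 * q\<close> dominates the bounded part of
      \<open>\<rho>\<close>.\<close>
    define q :: real where "q = indicator (R m) x + indicator (R m) y + (\<Sum>i<m. \<bar>indicator (D i) x - indicator (D i) y\<bar>)"
    have q_le: "q \<le> (indicator (R m) x + (\<Sum>i<m. E i x)) + (indicator (R m) y + (\<Sum>i<m. E i y)) + (\<Sum>i<m. cmod (h i x - h i y))"
    proof -
      have "\<bar>indicator (D i) x - indicator (D i) y :: real\<bar> \<le> E i x + E i y + cmod (h i x - h i y)" for i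
      proof -
        have "\<bar>indicator (D i) x - indicator (D i) y :: real\<bar> = cmod (of_real (indicator (D i) x - indicator (D i) y))"
          by (simp only: norm_of_real)
        also have "complex_of_real (indicator (D i) x - indicator (D i) y) =
            (indicator (D i) x - h i x) - (indicator (D i) y - h i y) + (h i x - h i y)"
          by (simp add: of_real_indicator)
        also have "cmod \<dots> \<le> cmod ((indicator (D i) x - h i x) - (indicator (D i) y - h i y)) + cmod (h i x - h i y)"
          by (rule norm_triangle_ineq)
        also have "\<dots> \<le> E i x + E i y + cmod (h i x - h i y)"
          unfolding E_def by (intro add_right_mono norm_triangle_ineq4)
        finally show ?thesis .
      qed
      then have "(\<Sum>i<m. \<bar>indicator (D i) x - indicator (D i) y :: real\<bar>) \<le> (\<Sum>i<m. E i x + E i y + cmod (h i x - h i y))"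
        by (intro sum_mono)
      then show ?thesis by (simp add: q_def sum.distrib)
    qed
    have tail: "g z \<le> gK k z + real k" if "z \<in> space M" for z using g0[OF that] by (simp add: gK_def)
    have W_nonneg: "0 \<le> W x y" unfolding W_def using k2(1) by (intro mult_nonneg_nonneg sum_nonneg) auto
    consider "\<rho> x y \<le> e" | "q \<ge> 1"
    proof (cases "x \<in> R m \<or> y \<in> R m")
      case True
      have "0 \<le> (\<Sum>i<m. \<bar>indicator (D i) x - indicator (D i) y :: real\<bar>)" by (intro sum_nonneg) auto
      with True have "q \<ge> 1" by (auto simp: q_def indicator_def)
      then show ?thesis using that by blast
    next
      case False
      then obtain i j where ij: "i < m" "x \<in> D i" "j < m" "y \<in> D j" using x y by (auto simp: R_def)
      show ?thesis
      proof (cases "i = j")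
        case True
        then show ?thesis using that D_diam ij by blast
      next
        case False
        have "1 = \<bar>indicator (D i) x - indicator (D i) y :: real\<bar>" using ij D_disj[OF ij(4), of i] False by simp
        also have "\<dots> \<le> (\<Sum>i<m. \<bar>indicator (D i) x - indicator (D i) y :: real\<bar>)"
          using ij(1) by (intro member_le_sum) auto
        finally have "q \<ge> 1" by (simp add: q_def add_nonneg_nonneg add_increasing)
        then show ?thesis using that by blast
      qed
    qed
    then show ?thesis
    proof cases
      case 1
      then show ?thesis using G0[OF x] G0[OF y] W_nonneg by linarith
    next
      case 2
      have "\<rho> x y \<le> gK k x + gK k y + k2" using \<rho>_g[OF x y] tail[OF x] tail[OF y] k2(2) by linarith
      also have "k2 \<le> k2 * q" using 2 k2(1) by (simp add: mult_le_cancel_left1)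
      also have "k2 * q \<le> k2 * ((indicator (R m) x + (\<Sum>i<m. E i x)) + (indicator (R m) y + (\<Sum>i<m. E i y)) + (\<Sum>i<m. cmod (h i x - h i y)))"
        using q_le k2(1) by (intro mult_left_mono) auto
      also have "gK k x + gK k y + \<dots> = G x + G y + W x y"
        by (simp add: G_def W_def algebra_simps)
      finally show ?thesis using e by simp
    qed
  qed
  ultimately show ?thesis using that[OF G G0 G_small] by blast
qed

lemma bounded_entropy_if_purely_discrete_spectrum:
  assumes pds: "purely_discrete_spectrum M T" and M: "complete_measure M"
    and adm: "admissible M \<rho>" and int: "integrable (square_space M) (\<lambda>(x, y). \<rho> x y)" and \<epsilon>: "\<epsilon> > 0"
  shows "\<exists>K. \<forall>n\<ge>1. entropy_cover M (average_semimetric T \<rho> n) \<epsilon> K"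
proof -
  \<comment> \<open>On a cell the average collects four errors of at most \<open>e\<close>, and the
    exceptional set consists of two sets of measure below \<open>e\<close>; both totals stay below
    \<open>\<epsilon>\<close>.\<close>
  define e where "e = \<epsilon> / 8"
  have e: "e > 0" using \<epsilon> by (simp add: e_def)
  \<comment> \<open>The square is for the integral of \<open>G\<close>, which Markov's inequality
    divides by \<open>e\<close>; the first entry is for the additive error in the bound of
    \<open>\<rho>\<close>.\<close>
  define e0 where "e0 = min e (e * e)"
  have e0: "e0 > 0" "e0 \<le> e" "e0 \<le> e * e" using e by (auto simp: e0_def)
  obtain G W where G: "integrable M G" "\<And>x. x \<in> space M \<Longrightarrow> 0 \<le> G x" "(LINT x|M. G x) < e0"
    and W: "orbit_totally_bounded W" and le: "\<And>x y. x \<in> space M \<Longrightarrow> y \<in> space M \<Longrightarrow> \<rho> x y \<le> e0 + G x + G y + W x y"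
    using semimetric_orbit_approximation[OF pds M adm int e0(1)] by blast
  obtain L R where L: "simple_function M (L :: 'a \<Rightarrow> nat)" and R: "R \<in> sets M" "measure M R < e"
    and W_le: "\<And>x y n. x \<in> space M - R \<Longrightarrow> y \<in> space M - R \<Longrightarrow> L x = L y \<Longrightarrow> W ((T ^^ n) x) ((T ^^ n) y) \<le> e"
    using W[unfolded orbit_totally_bounded_def, rule_format, OF e] by blast
  have [measurable]: "G \<in> borel_measurable M" using G(1) by auto
  have "finite (L ` space M)" using L by (rule simple_functionD)
  then obtain K where K: "\<And>x. x \<in> space M \<Longrightarrow> L x < K"
    unfolding finite_nat_set_iff_bounded by blast
  show ?thesis
  proof (intro exI[of _ K] allI impI)
    fix n :: nat assume n: "n \<ge> 1"
    define Z where "Z = {x \<in> space M. real n * e \<le> (\<Sum>i<n. G ((T ^^ i) x))}"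
    have Z: "Z \<in> sets M" unfolding Z_def by measurable
    have "measure M Z \<le> (LINT x|M. G x) / e"
      unfolding Z_def by (rule orbit_average_Markov[OF G(1,2) e n])
    also have "\<dots> < e" using less_le_trans[OF G(3) e0(3)] e by (simp add: divide_less_eq)
    finally have mZ: "measure M Z < e" .
    \<comment> \<open>Cell 0 is the exceptional set, the only one that depends on \<open>n\<close>
      through more than its complement. Label \<open>l\<close> becomes cell \<open>Suc l\<close>, so
      labels below \<open>K\<close> fill the indices from 1 to \<open>K\<close>.\<close>
    define A where "A j = (case j of 0 \<Rightarrow> R \<union> Z | Suc l \<Rightarrow> {x \<in> space M - (R \<union> Z). L x = l})" for j
    have "A j \<in> sets M" for j
    proof (cases j)
      case 0
      then show ?thesis using R Z by (simp add: A_def)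
    next
      case (Suc l)
      have "A j = (L -` {l} \<inter> space M) - (R \<union> Z)" by (auto simp: A_def Suc)
      then show ?thesis using simple_functionD(2)[OF L, of "{l}"] R Z by auto
    qed
    moreover have "space M = (\<Union>j\<le>K. A j)"
    proof
      show "space M \<subseteq> (\<Union>j\<le>K. A j)"
      proof
        fix x assume x: "x \<in> space M"
        show "x \<in> (\<Union>j\<le>K. A j)"
        proof (cases "x \<in> R \<union> Z")
          case True
          then have "x \<in> A 0" by (simp add: A_def)
          then show ?thesis by blast
        next
          case False
          then have "x \<in> A (Suc (L x))" using x by (simp add: A_def)
          then show ?thesis using K[OF x] by (intro UN_I[of "Suc (L x)"]) auto
        qed
      qed
      show "(\<Union>j\<le>K. A j) \<subseteq> space M" using \<open>\<And>j. A j \<in> sets M\<close> sets.sets_into_space by blast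
    qed
    moreover have "emeasure M (A 0) < ennreal \<epsilon>"
    proof -
      have "measure M (R \<union> Z) < \<epsilon>" using measure_Un_le[OF R(1) Z] R(2) mZ e by (simp add: e_def)
      then show ?thesis by (simp add: A_def emeasure_eq_measure ennreal_lessI \<epsilon>)
    qed
    moreover have "semimetric_diam (average_semimetric T \<rho> n) (A j) < ennreal \<epsilon>" if j: "j \<in> {1..K}" for j
    proof -
      obtain l where l: "j = Suc l" using j by (cases j) auto
      have "semimetric_diam (average_semimetric T \<rho> n) (A j) \<le> ennreal (4 * e)"
      proof (rule semimetric_diam_le)
        fix x y assume "x \<in> A j" "y \<in> A j"
        then have xy: "x \<in> space M" "y \<in> space M" "x \<notin> R" "y \<notin> R" "x \<notin> Z" "y \<notin> Z" "L x = L y"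
          by (auto simp: A_def l)
        have "(\<Sum>i<n. \<rho> ((T ^^ i) x) ((T ^^ i) y)) \<le> (\<Sum>i<n. e0 + G ((T ^^ i) x) + G ((T ^^ i) y) + W ((T ^^ i) x) ((T ^^ i) y))"
          by (intro sum_mono le funpow_in_space xy)
        also have "\<dots> \<le> (\<Sum>i<n. e0 + G ((T ^^ i) x) + G ((T ^^ i) y) + e)"
          using W_le xy by (intro sum_mono add_left_mono) auto
        also have "\<dots> = real n * e0 + (\<Sum>i<n. G ((T ^^ i) x)) + (\<Sum>i<n. G ((T ^^ i) y)) + real n * e"
          by (simp add: sum.distrib)
        also have "\<dots> \<le> real n * e + real n * e + real n * e + real n * e"
          using xy e0(2) by (intro add_mono mult_left_mono) (auto simp: Z_def)
        finally show "average_semimetric T \<rho> n x y \<le> 4 * e"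
          using n by (simp add: average_semimetric_def divide_le_eq mult_ac)
      qed
      also have "ennreal (4 * e) < ennreal \<epsilon>" using \<epsilon> by (intro ennreal_lessI) (auto simp: e_def)
      finally show ?thesis .
    qed
    ultimately show "entropy_cover M (average_semimetric T \<rho> n) \<epsilon> K"
      unfolding entropy_cover_def by (intro exI[of _ A]) auto
  qed
qed

end

theorem theorem10:
  fixes M :: "'a measure" and T :: "'a \<Rightarrow> 'a"
  assumes "lebesgue_prob_space M" and "automorphism M T"
  shows "(purely_discrete_spectrum M T \<longleftrightarrow>
            (\<forall>\<rho>. admissible M \<rho> \<longrightarrow> integrable (square_space M) (\<lambda>(x, y). \<rho> x y) \<longrightarrow>
               (\<forall>\<epsilon>>0. (SUP n\<in>{1..}. eps_entropy M (average_semimetric T \<rho> n) \<epsilon>) < \<infinity>))) \<and>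
         ((\<forall>\<rho>. admissible M \<rho> \<longrightarrow> integrable (square_space M) (\<lambda>(x, y). \<rho> x y) \<longrightarrow>
               (\<forall>\<epsilon>>0. (SUP n\<in>{1..}. eps_entropy M (average_semimetric T \<rho> n) \<epsilon>) < \<infinity>)) \<longleftrightarrow>
            (\<exists>\<rho>. metric_on (space M) \<rho> \<and> admissible M \<rho> \<and>
               integrable (square_space M) (\<lambda>(x, y). \<rho> x y) \<and>
               (\<forall>\<epsilon>>0. (SUP n\<in>{1..}. eps_entropy M (average_semimetric T \<rho> n) \<epsilon>) < \<infinity>)))"
    (is "(?one \<longleftrightarrow> ?two) \<and> (?two \<longleftrightarrow> ?three)")
proof -
  interpret measure_preserving M T
    using assms unfolding measure_preserving_def measure_preserving_axioms_def
    by (simp add: lebesgue_prob_space_def automorphism_def)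
  have complete: "complete_measure M" using assms(1) by (simp add: lebesgue_prob_space_def)
  have "?two" if ?one
  proof (intro allI impI)
    fix \<rho> and \<epsilon> :: real
    assume "admissible M \<rho>" "integrable (square_space M) (\<lambda>(x, y). \<rho> x y)" "\<epsilon> > 0"
    then show "(SUP n\<in>{1..}. eps_entropy M (average_semimetric T \<rho> n) \<epsilon>) < \<infinity>"
      unfolding bounded_eps_entropy_iff[OF \<open>\<epsilon> > 0\<close>]
      by (rule bounded_entropy_if_purely_discrete_spectrum[OF that complete])
  qed
  \<comment> \<open>The second condition already covers every integrable admissible metric, so only
    the existence of one is at stake.\<close>
  moreover have "?three" if ?two using lebesgue_metric_exists[OF assms(1)] that by blast
  moreover have "?one" if three: ?three
  proof -
    obtain \<rho> where "metric_on (space M) \<rho>" "admissible M \<rho>" "integrable (square_space M) (\<lambda>(x, y). \<rho> x y)"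
      and ent: "\<forall>\<epsilon>>0. (SUP n\<in>{1..}. eps_entropy M (average_semimetric T \<rho> n) \<epsilon>) < \<infinity>"
      using three by blast
    moreover have "\<exists>K. \<forall>n\<ge>1. entropy_cover M (average_semimetric T \<rho> n) \<epsilon> K" if "\<epsilon> > 0" for \<epsilon>
      using ent that bounded_eps_entropy_iff[OF that] by blast
    ultimately show ?thesis
      by (intro purely_discrete_spectrum_if_bounded_entropy[OF assms(1)])
  qed
  ultimately show ?thesis by argo
qed

end
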